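(* Let $p$ be an odd prime, let $\mu$ be a character of $\mathbb Q_p^\times$ of conductor exponent $n>1$, let $\eta$ be trivial or $\left(\frac{\cdot}{p}\right)$, with $\mu(-1)=\eta(-1)$. Then $f_1,f_\lambda$ are common eigenvectors in $V(\mu)_\eta^{K_{2n}}$ of the operators $\mathcal Y_{2n-1}$ and $\mathcal W_{2n-1}$. More precisely, there is a sign $s\in\{\pm1\}$ (depending on $\mu$) such that $$\mathcal V_{2n-1,1}f_1=\tfrac{-1+s\sqrt{p^*}}{2}f_1,\quad \mathcal V_{2n-1,\lambda}f_1=\tfrac{-1-s\sqrt{p^*}}{2}f_1,\quad \mathcal V_{2n-1,1}f_\lambda=\tfrac{-1-s\sqrt{p^*}}{2}f_\lambda,\quad \mathcal V_{2n-1,\lambda}f_\lambda=\tfrac{-1+s\sqrt{p^*}}{2}f_\lambda,$$ $$\mathcal Y_{2n-1}f_1=\mathcal Y_{2n-1}f_\lambda=0,\qquad \mathcal W_{2n-1}f_1=s\sqrt{p^*}\,f_1,\qquad \mathcal W_{2n-1}f_\lambda=-s\sqrt{p^*}\,f_\lambda .$$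
   Context: Let $G=\mathrm{SL}_2(\mathbb Q_p)$, $K=\mathrm{SL}_2(\mathbb Z_p)$, $K_m=K_0(p^m)=\{\begin{pmatrix}a&b\\ c&d\end{pmatrix}\in K:c\in p^m\mathbb Z_p\}$. $(\cdot,\cdot)_p$ is the quadratic Hilbert symbol. For $A=\begin{pmatrix}a&b\\ c&d\end{pmatrix}$ put $\tau(A)=c$ if $c\ne0$, $\tau(A)=d$ if $c=0$; for $g\in G$ put $s_p(g)=(c,d)_p$ if $cd\neq0$ and $\mathrm{ord}_p(c)$ is odd, $s_p(g)=1$ otherwise; $c(g,h)=(\tau(gh)\tau(g),\tau(gh)\tau(h))_p\,s_p(g)s_p(h)s_p(gh)$. $\widetilde G=G\times\{\pm1\}$ with $(g,\epsilon_1)(h,\epsilon_2)=(gh,\epsilon_1\epsilon_2c(g,h))$; $\overline S$ is the full inverse image of $S\subset G$. The cover splits over $K$ by $k\mapsto (k,1)$. $\eta$ defines the genuine character $\eta((\begin{pmatrix}a&b\\ c&d\end{pmatrix},\epsilon))=\epsilon\eta(d)$ of $\overline{K_m}$ ($m\ge1$). $\lambda\in\mathbb Z_p^\times$ is a nonsquare mod $p$; $x(s)=\begin{pmatrix}1&s\\ 0&1\end{pmatrix}$, $y(s)=\begin{pmatrix}1&0\\ s&1\end{pmatrix}$, $h(t)=\mathrm{diag}(t,t^{-1})$. $B\subset\widetilde G$ is the full inverse image of the upper triangular Borel subgroup. $\psi$ is a nontrivial additive character of $\mathbb Q_p$ of conductor $0$ (trivial on $\mathbb Z_p$, not on $p^{-1}\mathbb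 Z_p$); $\gamma(\psi')$ is the Weil index of $x\mapsto x^2$ with respect to $\psi'$, $\gamma(a,\psi)=\gamma(\psi_a)/\gamma(\psi)$, $\psi_a(x)=\psi(ax)$. Put $\mu_B((h(a)x(b),\epsilon))=\epsilon|a|\mu(a)\gamma(a,\psi)^{-1}$. $V(\mu)$ is the space of locally constant $f:\widetilde G\to\mathbb C$ with $f(bg)=\mu_B(b)f(g)$, $b\in B$, with right translation action, and $V(\mu)_\eta^{K_m}=\{f\in V(\mu):f(g\tilde k)=f(g)\eta(\tilde k)\ \forall\tilde k\in\overline{K_m}\}$. For $\kappa\in\{1,\lambda\}$, $f_\kappa\in V(\mu)_\eta^{K_{2n}}$ is the function with $f_\kappa(b(y(\kappa p^n),1)k_0)=\mu_B(b)\eta(k_0)$ for $b\in B,k_0\in\overline{K_{2n}}$, and zero elsewhere. $\mathcal V_{2n-1,\beta}$ ($\beta\in\{1,\lambda\}$) is the function on $\widetilde G$ supported on $\overline{K_{2n}}(y(\beta p^{2n-1}),1)\overline{K_{2n}}$, with value $1$ at $(y(\beta p^{2n-1}),1)$ and satisfying $\mathcal V(\tilde k\tilde g\tilde k')=\overline\eta(\tilde k)\overline\eta(\tilde k')\mathcal V(\tilde g)$ for $\tilde k,\tilde k'\in\overline{K_{2n}}$; it acts on $V(\mu)_\eta^{K_{2n}}$ by convolution with $\mathrm{vol}(\overline{K_{2n}})=1$, i.e. $\mathcal V_{2n-1,\beta}(f)(g)=\sum_{u\in\mathbb Z_p^\times/\sqrt{1+p\mathbb Z_p}}\eta(u)f\big(g\,(h(u),1)(y(\beta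 p^{2n-1}),1)\big)$, where $\sqrt{1+p\mathbb Z_p}=\{u\in\mathbb Z_p^\times:u^2\in1+p\mathbb Z_p\}$. $\mathcal Y_{2n-1}=I+\mathcal V_{2n-1,1}+\mathcal V_{2n-1,\lambda}$, $\mathcal W_{2n-1}=\mathcal V_{2n-1,1}-\mathcal V_{2n-1,\lambda}$. $p^*=\left(\frac{-1}p\right)p$ and $\sqrt{p^*}=\epsilon_p\sqrt p$ with $\epsilon_p=\gamma(p,\psi)$. *)

theory Defs
  imports
    "HOL-Analysis.Analysis"
    "HOL-Computational_Algebra.Fraction_Field"
    "HOL-Number_Theory.Number_Theory"
begin

section \<open>The field \<open>\<rat>\<^sub>p\<close>\<close>

text \<open>
  The prime \<open>p\<close> is carried by a type variable as \<open>p = CARD('p)\<close>; a type of every finite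
  cardinality can be introduced, so quantifying over \<open>'p\<close> quantifies over all primes.
  \<open>\<int>\<^sub>p\<close> is the inverse limit of the rings \<open>\<int>/p\<^sup>n\<close>, and \<open>\<rat>\<^sub>p\<close> is its fraction field, wrapped
  in a type of its own so that it can carry the \<open>p\<close>-adic metric.
\<close>

class prime_card = finite +
  assumes prime_card: "prime CARD('a)"

typedef 'p zp = "{f :: nat \<Rightarrow> int. \<forall>n. f (Suc n) mod int CARD('p::prime_card) ^ n = f n}"
  by (rule exI[of _ "\<lambda>_. 0"]) simp

setup_lifting type_definition_zp

lemma p_gt_1: "int CARD('p::prime_card) > 1"
  using prime_gt_1_nat[OF prime_card[where 'a='p]] by simp

lemma mod_Suc_power: "(a mod int CARD('p::prime_card) ^ Suc n) mod int CARD('p) ^ n = a mod int CARD('p) ^ n"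
  by (rule mod_mod_cancel) (simp add: le_imp_power_dvd)

instantiation zp :: (prime_card) comm_ring_1
begin

lift_definition zero_zp :: "'a zp" is "\<lambda>_. 0" by simp

lift_definition one_zp :: "'a zp" is "\<lambda>n. 1 mod int CARD('a) ^ n"
  by (simp only: mod_Suc_power)

lift_definition plus_zp :: "'a zp \<Rightarrow> 'a zp \<Rightarrow> 'a zp"
  is "\<lambda>f g n. (f n + g n) mod int CARD('a) ^ n"
  by (simp only: mod_Suc_power) (metis mod_add_eq)

lift_definition uminus_zp :: "'a zp \<Rightarrow> 'a zp"
  is "\<lambda>f n. (- f n) mod int CARD('a) ^ n"
  by (simp only: mod_Suc_power) (metis mod_minus_eq)

lift_definition minus_zp :: "'a zp \<Rightarrow> 'a zp \<Rightarrow> 'a zp"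
  is "\<lambda>f g n. (f n - g n) mod int CARD('a) ^ n"
  by (simp only: mod_Suc_power) (metis mod_diff_eq)

lift_definition times_zp :: "'a zp \<Rightarrow> 'a zp \<Rightarrow> 'a zp"
  is "\<lambda>f g n. (f n * g n) mod int CARD('a) ^ n"
  by (simp only: mod_Suc_power) (metis mod_mult_eq)

lemma zp_canonical:
  assumes "\<forall>n. f (Suc n) mod int CARD('a::prime_card) ^ n = f n"
  shows "f n mod int CARD('a) ^ n = f n"
  using assms by (metis mod_mod_trivial)

instance
proof
  fix a b c :: "'a zp"
  show "a * b * c = a * (b * c)"
    by transfer (simp add: mod_simps mult.assoc)
  show "a * b = b * a"
    by transfer (simp add: mult.commute)
  show "1 * a = a"
    by transfer (auto simp: fun_eq_iff mod_simps intro: zp_canonical)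
  show "a + b + c = a + (b + c)"
    by transfer (simp add: mod_simps add.assoc)
  show "a + b = b + a"
    by transfer (simp add: add.commute)
  show "0 + a = a"
    by transfer (auto simp: fun_eq_iff intro: zp_canonical)
  show "- a + a = 0"
    by transfer (simp add: mod_simps)
  show "a - b = a + - b"
    by transfer (simp add: mod_simps)
  show "(a + b) * c = a * c + b * c"
    by transfer (simp add: mod_simps distrib_right)
  show "(0 :: 'a zp) \<noteq> 1"
  proof transfer
    have "(1::int) mod int CARD('a) ^ 1 \<noteq> 0" using p_gt_1[where 'p='a] by simp
    then show "(\<lambda>_. 0) \<noteq> (\<lambda>n. (1::int) mod int CARD('a) ^ n)" by metis
  qed
qed

end

lemma zp_mod_le:
  assumes "\<forall>n. f (Suc n) mod int CARD('p::prime_card) ^ n = f n" "n \<le> m"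
  shows "f m mod int CARD('p) ^ n = f n"
  using assms(2)
proof (induction m rule: dec_induct)
  case base
  then show ?case using zp_canonical[OF assms(1)] .
next
  case (step m)
  have "f (Suc m) mod int CARD('p) ^ n = (f (Suc m) mod int CARD('p) ^ m) mod int CARD('p) ^ n"
    using step by (simp add: mod_mod_cancel le_imp_power_dvd)
  then show ?case using step assms(1) by simp
qed

text \<open>The valuation on \<open>\<int>\<^sub>p\<close>: \<open>p ^ k\<close> divides \<open>x\<close> iff the component \<open>Rep_zp x k\<close> vanishes.
  At \<open>0\<close> the value is immaterial.\<close>

definition zord :: "'p::prime_card zp \<Rightarrow> nat"
  where "zord x = (LEAST k. Rep_zp x (Suc k) \<noteq> 0)"

lemma Rep_zp_Suc: "\<forall>n. Rep_zp (x::'p::prime_card zp) (Suc n) mod int CARD('p) ^ n = Rep_zp x n"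
  using Rep_zp[of x] by simp

lemma Rep_zp_0: "Rep_zp (x::'p::prime_card zp) 0 = 0"
  using Rep_zp_Suc[of x, rule_format, of 0] by simp

lemma Rep_zp_dvd: "k \<le> m \<Longrightarrow> int CARD('p) ^ k dvd Rep_zp (x::'p::prime_card zp) m \<longleftrightarrow> Rep_zp x k = 0"
  using zp_mod_le[OF Rep_zp_Suc[of x]] by (simp add: dvd_eq_mod_eq_0)

lemma Rep_zp_eq_0_iff:
  assumes "x \<noteq> (0::'p::prime_card zp)"
  shows "Rep_zp x k = 0 \<longleftrightarrow> k \<le> zord x"
proof -
  have "\<exists>k. Rep_zp x (Suc k) \<noteq> 0"
  proof (rule ccontr)
    assume "\<not> ?thesis"
    then have "Rep_zp x n = 0" for n by (cases n) (auto simp: Rep_zp_0)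
    then have "Rep_zp x = Rep_zp 0" by (simp add: fun_eq_iff zero_zp.rep_eq)
    then show False using assms Rep_zp_inject by blast
  qed
  then have 1: "Rep_zp x (Suc (zord x)) \<noteq> 0" unfolding zord_def by (rule LeastI_ex)
  have 2: "Rep_zp x (Suc j) = 0" if "j < zord x" for j
    using not_less_Least[of j "\<lambda>k. Rep_zp x (Suc k) \<noteq> 0"] that unfolding zord_def by blast
  show ?thesis
  proof
    assume k: "Rep_zp x k = 0"
    show "k \<le> zord x"
    proof (rule ccontr)
      assume "\<not> k \<le> zord x"
      then have "Suc (zord x) \<le> k" by simp
      from zp_mod_le[OF Rep_zp_Suc[of x] this] k 1 show False by simp
    qed
  next
    assume "k \<le> zord x"
    then show "Rep_zp x k = 0" using 2 Rep_zp_0 by (cases k) auto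
  qed
qed

lemma zord_mult:
  assumes "x \<noteq> 0" "y \<noteq> (0::'p::prime_card zp)"
  shows "x * y \<noteq> 0 \<and> zord (x * y) = zord x + zord y"
proof -
  let ?p = "int CARD('p)"
  have p: "prime ?p" using prime_card[where 'a='p] by simp
  let ?i = "zord x" and ?j = "zord y"
  have key: "Rep_zp (x * y) k = 0 \<longleftrightarrow> k \<le> ?i + ?j" if k: "k \<le> Suc (?i + ?j)" for k
  proof -
    let ?m = "Suc (?i + ?j)"
    have "?p ^ ?i dvd Rep_zp x ?m" "\<not> ?p ^ Suc ?i dvd Rep_zp x ?m"
      "?p ^ ?j dvd Rep_zp y ?m" "\<not> ?p ^ Suc ?j dvd Rep_zp y ?m"
      using assms by (auto simp: Rep_zp_dvd Rep_zp_eq_0_iff simp del: power_Suc)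
    then obtain a b where a: "Rep_zp x ?m = ?p ^ ?i * a" and b: "Rep_zp y ?m = ?p ^ ?j * b"
      by (elim dvdE)
    have "\<not> ?p dvd a" "\<not> ?p dvd b"
      using \<open>\<not> ?p ^ Suc ?i dvd Rep_zp x ?m\<close> \<open>\<not> ?p ^ Suc ?j dvd Rep_zp y ?m\<close> a b
      by (auto simp: mult.commute intro: mult_dvd_mono)
    then have ab: "\<not> ?p dvd a * b" using p by (simp add: prime_dvd_mult_iff)
    have "Rep_zp (x * y) k = 0 \<longleftrightarrow> ?p ^ k dvd Rep_zp (x * y) ?m"
      using k by (simp add: Rep_zp_dvd)
    also have "\<dots> \<longleftrightarrow> ?p ^ k dvd Rep_zp x ?m * Rep_zp y ?m"
      unfolding times_zp.rep_eq using k by (intro dvd_mod_iff le_imp_power_dvd)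
    also have "Rep_zp x ?m * Rep_zp y ?m = ?p ^ (?i + ?j) * (a * b)"
      by (simp only: a b power_add) (simp add: algebra_simps)
    also have "?p ^ k dvd ?p ^ (?i + ?j) * (a * b) \<longleftrightarrow> k \<le> ?i + ?j"
    proof
      assume d: "?p ^ k dvd ?p ^ (?i + ?j) * (a * b)"
      show "k \<le> ?i + ?j"
      proof (rule ccontr)
        assume "\<not> k \<le> ?i + ?j"
        then have "k = Suc (?i + ?j)" using k by simp
        then have "?p ^ (?i + ?j) * ?p dvd ?p ^ (?i + ?j) * (a * b)" using d by (simp add: mult.commute)
        then show False using ab p_gt_1[where 'p='p] by (subst (asm) dvd_mult_cancel_left) auto
      qed
    next
      assume "k \<le> ?i + ?j"
      then show "?p ^ k dvd ?p ^ (?i + ?j) * (a * b)" by (intro dvd_mult2 le_imp_power_dvd)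
    qed
    finally show ?thesis .
  qed
  have "Rep_zp (x * y) (Suc (?i + ?j)) \<noteq> 0" using key[of "Suc (?i + ?j)"] by simp
  then have nz: "x * y \<noteq> 0" by (auto simp: zero_zp.rep_eq)
  then have "k \<le> zord (x * y) \<longleftrightarrow> k \<le> ?i + ?j" if "k \<le> Suc (?i + ?j)" for k
    using key[OF that] Rep_zp_eq_0_iff[OF nz, of k] by simp
  from this[of "Suc (?i + ?j)"] this[of "?i + ?j"] nz show ?thesis by simp
qed

lemma zord_add:
  assumes "x \<noteq> 0" "y \<noteq> 0" "x + y \<noteq> (0::'p::prime_card zp)"
  shows "min (zord x) (zord y) \<le> zord (x + y)"
proof -
  let ?k = "min (zord x) (zord y)"
  have "Rep_zp x ?k = 0" "Rep_zp y ?k = 0" using assms by (auto simp: Rep_zp_eq_0_iff)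
  then have "Rep_zp (x + y) ?k = 0" by (simp add: plus_zp.rep_eq)
  then show ?thesis using assms(3) by (simp add: Rep_zp_eq_0_iff)
qed

instance zp :: (prime_card) idom
  by standard (simp add: zord_mult)

typedef 'p padic = "UNIV :: 'p::prime_card zp fract set" ..

setup_lifting type_definition_padic

instantiation padic :: (prime_card) field
begin
lift_definition zero_padic :: "'a padic" is 0 .
lift_definition one_padic :: "'a padic" is 1 .
lift_definition plus_padic :: "'a padic \<Rightarrow> 'a padic \<Rightarrow> 'a padic" is "(+)" .
lift_definition minus_padic :: "'a padic \<Rightarrow> 'a padic \<Rightarrow> 'a padic" is "(-)" .
lift_definition uminus_padic :: "'a padic \<Rightarrow> 'a padic" is uminus .
lift_definition times_padic :: "'a padic \<Rightarrow> 'a padic \<Rightarrow> 'a padic" is "(*)" .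
lift_definition inverse_padic :: "'a padic \<Rightarrow> 'a padic" is inverse .
lift_definition divide_padic :: "'a padic \<Rightarrow> 'a padic \<Rightarrow> 'a padic" is "(/)" .
instance
  by standard (transfer, simp add: algebra_simps divide_inverse)+
end

definition of_zp :: "'p::prime_card zp \<Rightarrow> 'p padic"
  where "of_zp a = Abs_padic (Fract a 1)"

lemma Rep_of_zp: "Rep_padic (of_zp a) = Fract a 1"
  by (simp add: of_zp_def Abs_padic_inverse)

lemma padic_cases: "\<exists>a b. b \<noteq> 0 \<and> (x::'p::prime_card padic) = of_zp a / of_zp b"
proof -
  obtain a b where "Rep_padic x = Fract a b" "b \<noteq> 0" by (cases "Rep_padic x") auto
  then have "Rep_padic x = Rep_padic (of_zp a / of_zp b)"
    by (simp add: divide_padic.rep_eq Rep_of_zp)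
  then show ?thesis using \<open>b \<noteq> 0\<close> Rep_padic_inject by blast
qed

lemma of_zp_mult: "of_zp (a * b) = of_zp a * of_zp b"
  by (simp add: Rep_padic_inject[symmetric] times_padic.rep_eq Rep_of_zp)

lemma of_zp_add: "of_zp (a + b) = of_zp a + of_zp b"
  by (simp add: Rep_padic_inject[symmetric] plus_padic.rep_eq Rep_of_zp)

lemma of_zp_inject: "of_zp a = of_zp b \<longleftrightarrow> a = b"
  by (simp add: Rep_padic_inject[symmetric] Rep_of_zp eq_fract)

lemma of_zp_eq_0: "of_zp a = 0 \<longleftrightarrow> a = 0"
  by (simp add: Rep_padic_inject[symmetric] zero_padic.rep_eq Rep_of_zp Zero_fract_def eq_fract)

text \<open>The normalised valuation on \<open>\<rat>\<^sub>p\<close>; the value at \<open>0\<close> is immaterial.\<close>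

definition padic_ord :: "'p::prime_card padic \<Rightarrow> int"
  where "padic_ord x =
    (THE k. \<exists>a b. a \<noteq> 0 \<and> b \<noteq> 0 \<and> x = of_zp a / of_zp b \<and> k = int (zord a) - int (zord b))"

lemma padic_ord_frac:
  assumes "a \<noteq> 0" "b \<noteq> (0::'p::prime_card zp)"
  shows "padic_ord (of_zp a / of_zp b) = int (zord a) - int (zord b)"
  unfolding padic_ord_def
proof (rule the_equality)
  fix k assume "\<exists>c d. c \<noteq> 0 \<and> d \<noteq> 0 \<and> of_zp a / of_zp b = of_zp c / of_zp d \<and>
    k = int (zord c) - int (zord d)"
  then obtain c d where cd: "c \<noteq> 0" "d \<noteq> 0" "of_zp a / of_zp b = of_zp c / of_zp d"
    "k = int (zord c) - int (zord d)" by blast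
  then have "of_zp (a * d) = of_zp (c * b)"
    using assms by (simp add: of_zp_mult of_zp_eq_0 frac_eq_eq)
  then have "a * d = c * b" by (simp add: of_zp_inject)
  then have "zord a + zord d = zord c + zord b" using assms cd zord_mult by metis
  then show "k = int (zord a) - int (zord b)" using cd by simp
qed (use assms in blast)

definition padic_abs :: "'p::prime_card padic \<Rightarrow> real"
  where "padic_abs x = (if x = 0 then 0 else real CARD('p) powi (- padic_ord x))"

lemma padic_ord_mult:
  assumes "x \<noteq> 0" "y \<noteq> (0::'p::prime_card padic)"
  shows "padic_ord (x * y) = padic_ord x + padic_ord y"
proof -
  obtain a b c d where *: "b \<noteq> 0" "x = of_zp a / of_zp b" "d \<noteq> 0" "y = of_zp c / of_zp d"
    using padic_cases by metis
  with assms have nz: "a \<noteq> 0" "c \<noteq> 0" by (auto simp: of_zp_eq_0)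
  have "x * y = of_zp (a * c) / of_zp (b * d)" using * by (simp add: of_zp_mult)
  then show ?thesis using * nz zord_mult[of a c] zord_mult[of b d] by (simp add: padic_ord_frac)
qed

lemma padic_ord_add:
  assumes "x \<noteq> 0" "y \<noteq> 0" "x + y \<noteq> (0::'p::prime_card padic)"
  shows "min (padic_ord x) (padic_ord y) \<le> padic_ord (x + y)"
proof -
  obtain a b c d where *: "b \<noteq> 0" "x = of_zp a / of_zp b" "d \<noteq> 0" "y = of_zp c / of_zp d"
    using padic_cases by metis
  with assms have nz: "a \<noteq> 0" "c \<noteq> 0" by (auto simp: of_zp_eq_0)
  have s: "x + y = of_zp (a * d + c * b) / of_zp (b * d)"
    using * by (simp add: of_zp_mult of_zp_add of_zp_eq_0 field_simps)
  then have nz2: "a * d + c * b \<noteq> 0" using assms(3) by (auto simp: of_zp_eq_0)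
  have "min (zord (a * d)) (zord (c * b)) \<le> zord (a * d + c * b)"
    using * nz nz2 by (intro zord_add) auto
  then show ?thesis using * nz nz2 s zord_mult[of a d] zord_mult[of c b] zord_mult[of b d]
    by (simp add: padic_ord_frac)
qed

lemma padic_abs_add: "padic_abs (x + y) \<le> max (padic_abs x) (padic_abs (y::'p::prime_card padic))"
proof (cases "x = 0 \<or> y = 0 \<or> x + y = 0")
  case True
  then show ?thesis by (auto simp: padic_abs_def le_max_iff_disj)
next
  case False
  have "real CARD('p) > 1" using p_gt_1[where 'p='p] by simp
  then show ?thesis using padic_ord_add[of x y] False
    by (auto simp: padic_abs_def le_max_iff_disj min_def split: if_splits
        intro: power_int_increasing)
qed

lemma padic_abs_minus: "padic_abs (- x) = padic_abs (x::'p::prime_card padic)"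
proof (cases "x = 0")
  case False
  have "padic_ord (-1 * -1 :: 'p padic) = 2 * padic_ord (-1 :: 'p padic)"
    by (subst padic_ord_mult) auto
  moreover have "padic_ord (1 * 1 :: 'p padic) = 2 * padic_ord (1 :: 'p padic)"
    by (subst padic_ord_mult) auto
  ultimately have "padic_ord (-1 :: 'p padic) = 0" by simp
  then show ?thesis using padic_ord_mult[of "-1" x] False by (simp add: padic_abs_def)
qed simp

instantiation padic :: (prime_card) metric_space
begin

definition dist_padic :: "'a padic \<Rightarrow> 'a padic \<Rightarrow> real"
  where "dist_padic x y = padic_abs (x - y)"

definition uniformity_padic :: "('a padic \<times> 'a padic) filter"
  where "uniformity_padic = (INF e\<in>{0<..}. principal {(x, y). dist x y < e})"

definition open_padic :: "'a padic set \<Rightarrow> bool"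
  where "open_padic U \<longleftrightarrow> (\<forall>x\<in>U. \<forall>\<^sub>F (x', y) in uniformity. x' = x \<longrightarrow> y \<in> U)"

instance
proof
  fix x y z :: "'a padic"
  show "dist x y = 0 \<longleftrightarrow> x = y"
    using p_gt_1[where 'p='a] by (auto simp: dist_padic_def padic_abs_def)
  have pos: "padic_abs w \<ge> 0" for w :: "'a padic" by (simp add: padic_abs_def)
  have "dist x y = padic_abs ((x - z) + - (y - z))" by (simp add: dist_padic_def)
  also have "\<dots> \<le> max (padic_abs (x - z)) (padic_abs (y - z))"
    using padic_abs_add[of "x - z" "- (y - z)"] padic_abs_minus[of "y - z"] by metis
  finally show "dist x y \<le> dist x z + dist y z"
    using pos[of "x - z"] pos[of "y - z"] by (simp add: dist_padic_def)
qed (fact uniformity_padic_def open_padic_def)+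

end

definition Zp :: "'p::prime_card padic set"
  where "Zp = {x. padic_abs x \<le> 1}"

definition Zp_units :: "'p::prime_card padic set"
  where "Zp_units = {x. padic_abs x = 1}"

abbreviation \<pp> :: "'p::prime_card padic"
  where "\<pp> \<equiv> of_nat CARD('p)"

definition residue_p :: "'p::prime_card padic \<Rightarrow> int"
  where "residue_p x = (THE a. a \<in> {0..<int CARD('p)} \<and> padic_abs (x - of_int a) < 1)"

definition legendre_p :: "'p::prime_card padic \<Rightarrow> int"
  where "legendre_p u = Legendre (residue_p u) (int CARD('p))"

definition hilbert_symbol :: "'p::prime_card padic \<Rightarrow> 'p padic \<Rightarrow> int"
  where "hilbert_symbol a b =
    (if \<exists>x y z. (x, y, z) \<noteq> (0, 0, 0) \<and> z\<^sup>2 = a * x\<^sup>2 + b * y\<^sup>2 then 1 else -1)"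

section \<open>Characters and the Weil index\<close>

definition additive_character :: "('p::prime_card padic \<Rightarrow> complex) \<Rightarrow> bool"
  where "additive_character \<psi> \<longleftrightarrow>
    continuous_on UNIV \<psi> \<and> (\<forall>x. norm (\<psi> x) = 1) \<and> (\<forall>x y. \<psi> (x + y) = \<psi> x * \<psi> y)"

definition additive_conductor_0 :: "('p::prime_card padic \<Rightarrow> complex) \<Rightarrow> bool"
  where "additive_conductor_0 \<psi> \<longleftrightarrow>
    (\<forall>x\<in>Zp. \<psi> x = 1) \<and> (\<exists>x\<in>Zp. \<psi> (x / \<pp>) \<noteq> 1)"

text \<open>Characters of \<open>\<rat>\<^sub>p\<^sup>\<times>\<close> are not assumed to be unitary; their value at \<open>0\<close> is irrelevant.\<close>

definition mult_character :: "('p::prime_card padic \<Rightarrow> complex) \<Rightarrow> bool"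
  where "mult_character \<mu> \<longleftrightarrow> continuous_on (- {0}) \<mu> \<and>
    (\<forall>x. x \<noteq> 0 \<longrightarrow> \<mu> x \<noteq> 0) \<and> (\<forall>x y. x \<noteq> 0 \<longrightarrow> y \<noteq> 0 \<longrightarrow> \<mu> (x * y) = \<mu> x * \<mu> y)"

definition unit_subgroup :: "nat \<Rightarrow> 'p::prime_card padic set"
  where "unit_subgroup m = (if m = 0 then Zp_units else {1 + \<pp> ^ m * x | x. x \<in> Zp})"

definition conductor_exponent :: "('p::prime_card padic \<Rightarrow> complex) \<Rightarrow> nat \<Rightarrow> bool"
  where "conductor_exponent \<mu> n \<longleftrightarrow>
    (\<forall>u\<in>unit_subgroup n. \<mu> u = 1) \<and> (\<forall>m<n. \<exists>u\<in>unit_subgroup m. \<mu> u \<noteq> 1)"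

text \<open>The Haar integral (with \<open>\<int>\<^sub>p\<close> of volume \<open>1\<close>) of a continuous function over \<open>p\<^sup>-\<^sup>m\<int>\<^sub>p\<close>
  as the limit of its Riemann sums: the elements \<open>j / p\<^sup>m\<close> with \<open>j < p\<^sup>m\<^sup>+\<^sup>N\<close> represent the cosets
  of \<open>p\<^sup>N\<int>\<^sub>p\<close>, each of volume \<open>p\<^sup>-\<^sup>N\<close>.\<close>

definition ball_integral :: "nat \<Rightarrow> ('p::prime_card padic \<Rightarrow> complex) \<Rightarrow> complex"
  where "ball_integral m \<phi> =
    lim (\<lambda>N. (\<Sum>j<CARD('p) ^ (m + N). \<phi> (of_nat j / \<pp> ^ m)) / of_nat (CARD('p) ^ N))"

text \<open>The Weil index of \<open>x \<mapsto> x\<^sup>2\<close> with respect to \<open>\<psi>\<close> is the phase of the (regularised) integral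
  of \<open>\<psi>(x\<^sup>2)\<close> over \<open>\<rat>\<^sub>p\<close>; taking the phase removes the dependence on the Haar measure.\<close>

definition weil_index :: "('p::prime_card padic \<Rightarrow> complex) \<Rightarrow> complex"
  where "weil_index \<psi> = lim (\<lambda>m. sgn (ball_integral m (\<lambda>x. \<psi> (x\<^sup>2))))"

definition weil_ratio :: "'p::prime_card padic \<Rightarrow> ('p padic \<Rightarrow> complex) \<Rightarrow> complex"
  where "weil_ratio a \<psi> = weil_index (\<lambda>x. \<psi> (a * x)) / weil_index \<psi>"

definition sqrt_p_star :: "('p::prime_card padic \<Rightarrow> complex) \<Rightarrow> complex"
  where "sqrt_p_star \<psi> = weil_ratio \<pp> \<psi> * of_real (sqrt (real CARD('p)))"

section \<open>The metaplectic double cover of \<open>SL\<^sub>2(\<rat>\<^sub>p)\<close>\<close>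

type_synonym 'p mat2 = "('p padic)^2^2"

definition mat2 :: "'p::prime_card padic \<Rightarrow> 'p padic \<Rightarrow> 'p padic \<Rightarrow> 'p padic \<Rightarrow> 'p mat2"
  where "mat2 a b c d = vector [vector [a, b], vector [c, d]]"

definition SL2 :: "'p::prime_card mat2 set"
  where "SL2 = {A. det A = 1}"

definition SL2_Zp :: "'p::prime_card mat2 set"
  where "SL2_Zp = {A \<in> SL2. \<forall>i j. A $ i $ j \<in> Zp}"

definition K0 :: "nat \<Rightarrow> 'p::prime_card mat2 set"
  where "K0 m = {A \<in> SL2_Zp. \<exists>z\<in>Zp. A $ 2 $ 1 = \<pp> ^ m * z}"

definition y_mat :: "'p::prime_card padic \<Rightarrow> 'p mat2"
  where "y_mat s = mat2 1 0 s 1"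

definition \<tau> :: "'p::prime_card mat2 \<Rightarrow> 'p padic"
  where "\<tau> A = (if A $ 2 $ 1 \<noteq> 0 then A $ 2 $ 1 else A $ 2 $ 2)"

definition s_p :: "'p::prime_card mat2 \<Rightarrow> int"
  where "s_p A = (if A $ 2 $ 1 * A $ 2 $ 2 \<noteq> 0 \<and> odd (padic_ord (A $ 2 $ 1))
    then hilbert_symbol (A $ 2 $ 1) (A $ 2 $ 2) else 1)"

definition cocycle :: "'p::prime_card mat2 \<Rightarrow> 'p mat2 \<Rightarrow> int"
  where "cocycle g h =
    hilbert_symbol (\<tau> (g ** h) * \<tau> g) (\<tau> (g ** h) * \<tau> h) * s_p g * s_p h * s_p (g ** h)"

type_synonym 'p mp = "'p mat2 \<times> int"

definition full_preimage :: "'p::prime_card mat2 set \<Rightarrow> 'p mp set"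
  where "full_preimage S = S \<times> {1, -1}"

definition Mp :: "'p::prime_card mp set"
  where "Mp = full_preimage SL2"

definition mp_mult :: "'p::prime_card mp \<Rightarrow> 'p mp \<Rightarrow> 'p mp"  (infixl \<open>\<odot>\<close> 70)
  where "x \<odot> y = (fst x ** fst y, snd x * snd y * cocycle (fst x) (fst y))"

definition Borel :: "'p::prime_card mp set"
  where "Borel = full_preimage {A \<in> SL2. A $ 2 $ 1 = 0}"

definition genuine :: "('p::prime_card padic \<Rightarrow> complex) \<Rightarrow> 'p mp \<Rightarrow> complex"
  where "genuine \<eta> k = of_int (snd k) * \<eta> (fst k $ 2 $ 2)"

text \<open>The element \<open>h(a)x(b)\<close> of the Borel subgroup has upper left entry \<open>a\<close>.\<close>

definition \<mu>_B ::
  "('p::prime_card padic \<Rightarrow> complex) \<Rightarrow> ('p padic \<Rightarrow> complex) \<Rightarrow> 'p mp \<Rightarrow> complex"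
  where "\<mu>_B \<psi> \<mu> b = (let a = fst b $ 1 $ 1 in
    of_int (snd b) * of_real (padic_abs a) * \<mu> a * inverse (weil_ratio a \<psi>))"

text \<open>Local constancy refers to the topology making the double cover a topological group in which
  \<open>k \<mapsto> (k, 1)\<close> is a homeomorphism of \<open>SL\<^sub>2(\<int>\<^sub>p)\<close> onto an open subgroup of the cover, so that the
  neighbourhoods of \<open>g\<close> are generated by the translates of neighbourhoods of \<open>1\<close> in \<open>SL\<^sub>2(\<int>\<^sub>p)\<close>.
  This is not the product topology on \<open>SL\<^sub>2(\<rat>\<^sub>p) \<times> {\<plusminus>1}\<close>, for which the group
  law above is not continuous.\<close>

definition locally_constant_mp :: "('p::prime_card mp \<Rightarrow> complex) \<Rightarrow> bool"
  where "locally_constant_mp f \<longleftrightarrow> (\<forall>g\<in>Mp. \<exists>U. open U \<and> mat 1 \<in> U \<and>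
    (\<forall>k\<in>U \<inter> SL2_Zp. f (g \<odot> (k, 1)) = f g))"

text \<open>Functions on the cover are represented by functions on the type \<open>'p mp\<close>; only their values
  on \<open>Mp\<close> are meaningful.\<close>

definition principal_series ::
  "('p::prime_card padic \<Rightarrow> complex) \<Rightarrow> ('p padic \<Rightarrow> complex) \<Rightarrow> ('p mp \<Rightarrow> complex) set"
  where "principal_series \<psi> \<mu> = {f. locally_constant_mp f \<and>
    (\<forall>b\<in>Borel. \<forall>g\<in>Mp. f (b \<odot> g) = \<mu>_B \<psi> \<mu> b * f g)}"

definition principal_series_K ::
  "('p::prime_card padic \<Rightarrow> complex) \<Rightarrow> ('p padic \<Rightarrow> complex) \<Rightarrow> ('p padic \<Rightarrow> complex)
    \<Rightarrow> nat \<Rightarrow> ('p mp \<Rightarrow> complex) set"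
  where "principal_series_K \<psi> \<mu> \<eta> m = {f \<in> principal_series \<psi> \<mu>.
    \<forall>g\<in>Mp. \<forall>k\<in>full_preimage (K0 m). f (g \<odot> k) = f g * genuine \<eta> k}"

definition f_cell ::
  "('p::prime_card padic \<Rightarrow> complex) \<Rightarrow> ('p padic \<Rightarrow> complex) \<Rightarrow> ('p padic \<Rightarrow> complex)
    \<Rightarrow> nat \<Rightarrow> 'p padic \<Rightarrow> 'p mp \<Rightarrow> complex"
  where "f_cell \<psi> \<mu> \<eta> n \<kappa> = (THE f.
    (\<forall>b\<in>Borel. \<forall>k\<in>full_preimage (K0 (2 * n)).
      f (b \<odot> (y_mat (\<kappa> * \<pp> ^ n), 1) \<odot> k) = \<mu>_B \<psi> \<mu> b * genuine \<eta> k) \<and>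
    (\<forall>g. (\<nexists>b k. b \<in> Borel \<and> k \<in> full_preimage (K0 (2 * n)) \<and>
      g = b \<odot> (y_mat (\<kappa> * \<pp> ^ n), 1) \<odot> k) \<longrightarrow> f g = 0))"

section \<open>Hecke operators\<close>

definition hecke_fun ::
  "('p::prime_card padic \<Rightarrow> complex) \<Rightarrow> nat \<Rightarrow> 'p mp \<Rightarrow> 'p mp \<Rightarrow> complex"
  where "hecke_fun \<eta> m g\<^sub>0 = (THE \<Phi>.
    (\<forall>g. (\<nexists>k k'. k \<in> full_preimage (K0 m) \<and> k' \<in> full_preimage (K0 m) \<and>
      g = k \<odot> g\<^sub>0 \<odot> k') \<longrightarrow> \<Phi> g = 0) \<and>
    \<Phi> g\<^sub>0 = 1 \<and>
    (\<forall>k\<in>full_preimage (K0 m). \<forall>k'\<in>full_preimage (K0 m). \<forall>g\<in>Mp.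
      \<Phi> (k \<odot> g \<odot> k') = cnj (genuine \<eta> k) * cnj (genuine \<eta> k') * \<Phi> g))"

definition left_cosets :: "nat \<Rightarrow> 'p::prime_card mp set set"
  where "left_cosets m = (\<lambda>x. (\<lambda>k. x \<odot> k) ` full_preimage (K0 m)) ` Mp"

text \<open>The convolution \<open>(\<Phi> f)(g) = \<integral> \<Phi>(x) f(g x) dx\<close>, where the inverse image of \<open>K0 m\<close> has
  volume \<open>1\<close>. The functions \<open>\<Phi>\<close> and \<open>f\<close> transform on the right by inverse characters of that
  subgroup, so the integrand is constant on its left cosets and the integral is a finite sum over
  the left cosets in the support of \<open>\<Phi>\<close>. For \<open>\<V>\<close> below these are the cosets of
  \<open>(h(u), 1) (y(\<beta>p\<^sup>2\<^sup>n\<^sup>-\<^sup>1), 1)\<close> for \<open>u \<in> \<int>\<^sub>p\<^sup>\<times>\<close> modulo the units with \<open>u\<^sup>2 \<in> 1 + p\<int>\<^sub>p\<close>, and \<open>\<Phi>\<close> has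
  the value \<open>\<eta>(u)\<close> there.\<close>

definition hecke_conv ::
  "nat \<Rightarrow> ('p::prime_card mp \<Rightarrow> complex) \<Rightarrow> ('p mp \<Rightarrow> complex) \<Rightarrow> 'p mp \<Rightarrow> complex"
  where "hecke_conv m \<Phi> f g =
    (\<Sum>C \<in> {C \<in> left_cosets m. \<exists>x\<in>C. \<Phi> x \<noteq> 0}. let x = (SOME x. x \<in> C) in \<Phi> x * f (g \<odot> x))"

text \<open>\<open>\<V> \<eta> n \<beta>\<close>, \<open>\<Y> \<eta> n \<lambda>\<close> and \<open>\<W> \<eta> n \<lambda>\<close> have index \<open>2n - 1\<close>.\<close>

definition \<V> ::
  "('p::prime_card padic \<Rightarrow> complex) \<Rightarrow> nat \<Rightarrow> 'p padic \<Rightarrow> ('p mp \<Rightarrow> complex) \<Rightarrow> 'p mp \<Rightarrow> complex"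
  where "\<V> \<eta> n \<beta> = hecke_conv (2 * n) (hecke_fun \<eta> (2 * n) (y_mat (\<beta> * \<pp> ^ (2 * n - 1)), 1))"

definition \<Y> ::
  "('p::prime_card padic \<Rightarrow> complex) \<Rightarrow> nat \<Rightarrow> 'p padic \<Rightarrow> ('p mp \<Rightarrow> complex) \<Rightarrow> 'p mp \<Rightarrow> complex"
  where "\<Y> \<eta> n lam f g = f g + \<V> \<eta> n 1 f g + \<V> \<eta> n lam f g"

definition \<W> ::
  "('p::prime_card padic \<Rightarrow> complex) \<Rightarrow> nat \<Rightarrow> 'p padic \<Rightarrow> ('p mp \<Rightarrow> complex) \<Rightarrow> 'p mp \<Rightarrow> complex"
  where "\<W> \<eta> n lam f g = \<V> \<eta> n 1 f g - \<V> \<eta> n lam f g"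

end

theory Submission
  imports Defs
begin

text \<open>
  A Hecke operator \<open>\<V>\<close> is a sum of right translations by \<open>y(w p\<^sup>2\<^sup>n\<^sup>-\<^sup>1)\<close>, where \<open>w\<close> runs through the
  residues mod \<open>p\<close> in the square class of \<open>\<beta>\<close>. Since \<open>n > 1\<close>, such a translation preserves the cell
  of \<open>y(\<kappa>p\<^sup>n)\<close>: writing \<open>\<kappa>p\<^sup>n + w p\<^sup>2\<^sup>n\<^sup>-\<^sup>1 = a\<^sup>2\<kappa>p\<^sup>n\<close> with \<open>a \<equiv> 1 (mod p)\<close>, it is the conjugation of
  \<open>y(\<kappa>p\<^sup>n)\<close> by \<open>h(a)\<close>, so it multiplies \<open>f\<^sub>\<kappa>\<close> by \<open>\<mu>(a)\<^sup>-\<^sup>1\<close>, where \<open>a \<equiv> 1 + p\<^sup>n\<^sup>-\<^sup>1 w / 2\<kappa> (mod p\<^sup>n)\<close>. As \<open>\<mu>\<close>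
  has conductor exponent \<open>n\<close>, this is a nontrivial additive character of \<open>w\<close> mod \<open>p\<close>, and its sum over
  a square class is \<open>(-1 \<plusminus> g)/2\<close> with a quadratic Gauss sum \<open>g\<close>. The Weil index of \<open>\<psi>\<close> scaled by \<open>p\<close> is the
  phase of such a Gauss sum too, which identifies \<open>g\<close> with \<open>\<plusminus>\<surd>p\<^sup>*\<close>.

  The matrices in these conjugations lie in \<open>K0 1\<close>, where the cocycle is trivial.
\<close>

text \<open>The Hilbert symbol is defined by solvability of an equation, so its bilinearity has to
  come from an explicit formula (\<open>hilbert_formula\<close>); associativity of the cover follows
  from bilinearity together with (a, 1 - a) = 1. The factor \<open>\<mu>_B\<close> is a character of
  \<open>Borel\<close> because the Weil index fails to be multiplicative by the same Hilbert symbol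
  that the cocycle contributes, and for this the Weil index is computed at all nonzero arguments.
  \<open>f_cell\<close> and \<open>hecke_fun\<close> are definite descriptions. For
  \<open>f_cell\<close> existence is the point: a Borel element stabilising the cell has diagonal
  congruent to 1 or -1 mod p^n, and \<mu>(-1) = \<eta>(-1) makes the prescribed values agree. Level
  p^(2n) goes with y(\<kappa>p^n), since the n remaining digits are what conductor exponent n can
  see. The sign s is a product of two Legendre symbols: that of 2, from the term w / 2\<kappa> of
  the square root, and that of the exponent which expresses the root of unity given by \<mu> as a
  power of \<psi>(1/p).\<close>

no_notation Module.module.smult (infixl \<open>\<odot>\<index>\<close> 70)

section \<open>Congruences in \<open>\<rat>\<^sub>p\<close>\<close>

lemma p_real_gt_1: "real CARD('p::prime_card) > 1"
  using p_gt_1[where 'p='p] by simp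

lemma prime_p_int: "prime (int CARD('p::prime_card))"
  using prime_card[where 'a='p] by simp

lemma padic_abs_nonneg [simp]: "padic_abs x \<ge> 0"
  by (simp add: padic_abs_def)

lemma padic_abs_0 [simp]: "padic_abs 0 = 0"
  by (simp add: padic_abs_def)

lemma padic_abs_eq_0 [simp]: "padic_abs (x::'p::prime_card padic) = 0 \<longleftrightarrow> x = 0"
  using p_gt_1[where 'p='p] by (simp add: padic_abs_def)

lemma padic_abs_mult: "padic_abs (x * y) = padic_abs x * padic_abs (y::'p::prime_card padic)"
  by (simp add: padic_abs_def padic_ord_mult power_int_add[symmetric])

lemma padic_abs_1 [simp]: "padic_abs (1::'p::prime_card padic) = 1"
  using padic_abs_mult[of 1 "1::'p padic"] padic_abs_eq_0[of "1::'p padic"] by simp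

lemma padic_abs_power: "padic_abs (x ^ k) = padic_abs (x::'p::prime_card padic) ^ k"
  by (induction k) (auto simp: padic_abs_mult)

lemma padic_abs_inverse: "padic_abs (inverse x) = inverse (padic_abs (x::'p::prime_card padic))"
proof (cases "x = 0")
  case False
  then show ?thesis using padic_abs_mult[of x "inverse x"] by (simp add: field_simps)
qed simp

lemma padic_abs_divide: "padic_abs (x / y) = padic_abs x / padic_abs (y::'p::prime_card padic)"
  by (simp add: divide_inverse padic_abs_mult padic_abs_inverse)

lemma padic_abs_diff: "padic_abs (x - y) \<le> max (padic_abs x) (padic_abs (y::'p::prime_card padic))"
  using padic_abs_add[of x "- y"] by (simp add: padic_abs_minus)

section \<open>Integers inside Z_p and Q_p\<close>

lemma Rep_zp_of_nat: "Rep_zp (of_nat k :: 'p::prime_card zp) n = int k mod int CARD('p) ^ n"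
proof (induction k)
  case (Suc k)
  then show ?case by (simp add: plus_zp.rep_eq one_zp.rep_eq mod_simps)
qed (simp add: zero_zp.rep_eq)

lemma Rep_zp_of_int: "Rep_zp (of_int k :: 'p::prime_card zp) n = k mod int CARD('p) ^ n"
  by (cases k rule: int_diff_cases)
    (simp add: minus_zp.rep_eq Rep_zp_of_nat mod_simps)

lemma of_zp_0 [simp]: "of_zp 0 = 0"
  by (simp add: of_zp_eq_0)

lemma of_zp_1 [simp]: "of_zp 1 = (1::'p::prime_card padic)"
  by (simp add: Rep_padic_inject[symmetric] one_padic.rep_eq Rep_of_zp One_fract_def)

lemma of_zp_minus: "of_zp (- a) = - of_zp a"
  using of_zp_add[of a "- a"] by (simp add: eq_neg_iff_add_eq_0 add.commute)

lemma of_zp_diff: "of_zp (a - b) = of_zp a - of_zp b"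
  using of_zp_add[of a "- b"] by (simp add: of_zp_minus)

lemma of_zp_of_nat: "of_zp (of_nat k) = of_nat k"
  by (induction k) (auto simp: of_zp_add)

lemma of_zp_of_int: "of_zp (of_int k) = of_int k"
  by (cases k rule: int_diff_cases) (simp add: of_zp_diff of_zp_of_nat)

lemma zord_1: "zord (1::'p::prime_card zp) = 0"
  using zord_mult[of "1::'p zp" 1] by simp

lemma padic_ord_of_zp: "a \<noteq> 0 \<Longrightarrow> padic_ord (of_zp a) = int (zord a)"
  using padic_ord_frac[of a 1] by (simp add: zord_1)

lemma p_nonzero [simp]: "\<pp> \<noteq> (0::'p::prime_card padic)" "of_nat CARD('p) \<noteq> (0 :: 'p zp)"
proof -
  \<comment> \<open>Modulo p the element vanishes; the component mod p^2 is the first to show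
    it.\<close>
  have "Rep_zp (of_nat CARD('p) :: 'p zp) 2 \<noteq> 0"
    using p_gt_1[where 'p='p] by (simp add: Rep_zp_of_nat mod_pos_pos_trivial power2_eq_square)
  then show 1: "of_nat CARD('p) \<noteq> (0 :: 'p zp)" by (metis zero_zp.rep_eq)
  show "\<pp> \<noteq> (0::'p padic)"
    using 1 of_zp_eq_0 of_zp_of_nat by metis
qed

lemma padic_ord_p [simp]: "padic_ord (\<pp>::'p::prime_card padic) = 1"
proof -
  let ?q = "of_nat CARD('p) :: 'p zp"
  have "Rep_zp ?q 2 \<noteq> 0" "Rep_zp ?q 1 = 0"
    using p_gt_1[where 'p='p] by (simp_all add: Rep_zp_of_nat mod_pos_pos_trivial power2_eq_square)
  then have "zord ?q = 1" by (simp add: Rep_zp_eq_0_iff)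
  then show ?thesis
    by (metis of_nat_1 of_zp_of_nat p_nonzero(2) padic_ord_of_zp)
qed

lemma padic_abs_p [simp]: "padic_abs (\<pp>::'p::prime_card padic) = 1 / real CARD('p)"
  by (simp add: padic_abs_def power_int_minus field_simps)

lemma p_characteristic_0: "of_int k = (0::'p::prime_card padic) \<longleftrightarrow> k = 0"
proof
  assume 0: "of_int k = (0::'p padic)"
  then have "(of_int k::'p zp) = 0" by (metis of_zp_eq_0 of_zp_of_int)
  then have "k mod int CARD('p) ^ n = 0" for n by (metis Rep_zp_of_int zero_zp.rep_eq)
  then have d: "int CARD('p) ^ n dvd k" for n by (simp add: dvd_eq_mod_eq_0)
  show "k = 0"
  proof (rule ccontr)
    assume "k \<noteq> 0"
    \<comment> \<open>Any exponent N with p^N > |k| gives a contradiction, and |k| is such an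
      exponent.\<close>
    then have "int CARD('p) ^ nat \<bar>k\<bar> \<le> \<bar>k\<bar>"
      using dvd_imp_le_int[OF \<open>k \<noteq> 0\<close> d[of "nat \<bar>k\<bar>"]] by simp
    moreover have "nat \<bar>k\<bar> < CARD('p) ^ nat \<bar>k\<bar>"
      using p_gt_1[where 'p='p] by (intro power_gt_expt) auto
    then have "\<bar>k\<bar> < int CARD('p) ^ nat \<bar>k\<bar>"
      by (metis abs_ge_zero nat_less_iff of_nat_power)
    ultimately show False by simp
  qed
qed simp

text \<open>The ideal p^N Z_p. Stated by division, its closure properties reduce to those of
  \<open>Zp\<close>; the form with a witness is \<open>p_ideal_iff\<close>.\<close>

definition p_ideal :: "nat \<Rightarrow> 'p::prime_card padic set"
  where "p_ideal N = {x. x / \<pp> ^ N \<in> Zp}"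

lemma Zp_closed:
  "0 \<in> (Zp :: 'p::prime_card padic set)" "1 \<in> (Zp :: 'p padic set)" "x \<in> Zp \<Longrightarrow> y \<in> Zp \<Longrightarrow> x + y \<in> Zp" "x \<in> Zp \<Longrightarrow> y \<in> Zp \<Longrightarrow> x - y \<in> Zp"
  "x \<in> Zp \<Longrightarrow> - x \<in> Zp" "x \<in> Zp \<Longrightarrow> y \<in> Zp \<Longrightarrow> x * y \<in> Zp" "x \<in> Zp \<Longrightarrow> x ^ k \<in> Zp"
  unfolding Zp_def using padic_abs_add[of x y] padic_abs_diff[of x y]
  by (auto simp: padic_abs_mult padic_abs_minus padic_abs_power mult_le_one power_le_one)

lemma of_nat_in_Zp: "of_nat k \<in> Zp"
  by (induction k) (auto intro: Zp_closed)

lemma of_int_in_Zp: "of_int k \<in> Zp"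
  by (cases k rule: int_diff_cases) (auto intro: Zp_closed of_nat_in_Zp)

lemma p_ideal_0: "p_ideal 0 = Zp"
  by (simp add: p_ideal_def)

lemma p_ideal_closed:
  "0 \<in> p_ideal N" "x \<in> p_ideal N \<Longrightarrow> y \<in> p_ideal N \<Longrightarrow> x + y \<in> p_ideal N"
  "x \<in> p_ideal N \<Longrightarrow> y \<in> p_ideal N \<Longrightarrow> x - y \<in> p_ideal N"
  "x \<in> p_ideal N \<Longrightarrow> - x \<in> p_ideal N"
  unfolding p_ideal_def
  using Zp_closed(3,4)[of "x / \<pp> ^ N" "y / \<pp> ^ N"] Zp_closed(5)[of "x / \<pp> ^ N"]
  by (auto simp: Zp_closed(1) add_divide_distrib diff_divide_distrib)

lemma p_ideal_mult:
  "x \<in> p_ideal i \<Longrightarrow> y \<in> p_ideal j \<Longrightarrow> k \<le> i + j \<Longrightarrow> x * y \<in> p_ideal k"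
proof -
  assume *: "x \<in> p_ideal i" "y \<in> p_ideal j" "k \<le> i + j"
  have "x * y / \<pp> ^ k = (x / \<pp> ^ i) * (y / \<pp> ^ j) * \<pp> ^ (i + j - k)"
    using *(3) by (simp add: power_diff power_add)
  also have "\<dots> \<in> Zp"
    using * by (intro Zp_closed of_nat_in_Zp) (auto simp: p_ideal_def)
  finally show ?thesis by (simp add: p_ideal_def)
qed

lemma p_ideal_mult_Zp:
  "x \<in> p_ideal i \<Longrightarrow> y \<in> Zp \<Longrightarrow> x * y \<in> p_ideal i" "x \<in> p_ideal i \<Longrightarrow> y \<in> Zp \<Longrightarrow> y * x \<in> p_ideal i"
  using p_ideal_mult[of x i y 0 i] by (auto simp: p_ideal_0 mult.commute)

lemma p_power_in_p_ideal: "\<pp> ^ k \<in> p_ideal k" "x \<in> Zp \<Longrightarrow> x * \<pp> ^ k \<in> p_ideal k"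
  "x \<in> Zp \<Longrightarrow> \<pp> ^ k * x \<in> p_ideal k"
  by (auto simp: p_ideal_def Zp_closed)

lemma p_ideal_iff: "x \<in> p_ideal k \<longleftrightarrow> (\<exists>z\<in>Zp. x = \<pp> ^ k * z)"
proof
  assume "x \<in> p_ideal k"
  then show "\<exists>z\<in>Zp. x = \<pp> ^ k * z" by (intro bexI[of _ "x / \<pp> ^ k"]) (auto simp: p_ideal_def)
qed (auto intro: p_power_in_p_ideal)

lemma p_ideal_mono: "x \<in> p_ideal i \<Longrightarrow> k \<le> i \<Longrightarrow> x \<in> p_ideal k"
  using p_ideal_mult[of x i 1 0 k] by (auto simp: p_ideal_0 Zp_closed)

lemma p_ideal_subset_Zp: "x \<in> p_ideal i \<Longrightarrow> x \<in> Zp"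
  using p_ideal_mono[of x i 0] by (simp add: p_ideal_0)

lemma p_ideal_abs: "x \<in> p_ideal N \<longleftrightarrow> padic_abs (x::'p::prime_card padic) \<le> 1 / real CARD('p) ^ N"
  by (simp add: p_ideal_def Zp_def padic_abs_divide padic_abs_power field_simps)

lemma in_all_p_ideals: "(\<And>N. x \<in> p_ideal N) \<Longrightarrow> x = (0::'p::prime_card padic)"
proof (rule ccontr)
  assume *: "\<And>N. x \<in> p_ideal N" and "x \<noteq> 0"
  then have pos: "padic_abs x > 0" by (simp add: order_less_le)
  obtain N where "1 / padic_abs x < real CARD('p) ^ N"
    using real_arch_pow p_real_gt_1 by blast
  then show False using *[of N] pos p_real_gt_1[where 'p='p] by (simp add: p_ideal_abs field_simps)
qed

lemma Zp_units_closed: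
  "1 \<in> (Zp_units :: 'p::prime_card padic set)" "- 1 \<in> (Zp_units :: 'p padic set)"
  "x \<in> Zp_units \<Longrightarrow> y \<in> Zp_units \<Longrightarrow> x * y \<in> Zp_units"
  "x \<in> Zp_units \<Longrightarrow> inverse x \<in> Zp_units" "x \<in> Zp_units \<Longrightarrow> y \<in> Zp_units \<Longrightarrow> x / y \<in> Zp_units"
  "x \<in> Zp_units \<Longrightarrow> - x \<in> Zp_units" "x \<in> Zp_units \<Longrightarrow> x ^ k \<in> Zp_units"
  by (auto simp: Zp_units_def padic_abs_mult padic_abs_inverse padic_abs_divide padic_abs_minus padic_abs_power)

lemma Zp_units_in_Zp: "x \<in> Zp_units \<Longrightarrow> x \<in> Zp"
  by (auto simp: Zp_units_def Zp_def)

lemma Zp_units_nonzero: "x \<in> Zp_units \<Longrightarrow> x \<noteq> 0"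
  by (auto simp: Zp_units_def)

lemma Zp_units_ord: "x \<in> Zp_units \<longleftrightarrow> x \<noteq> 0 \<and> padic_ord (x::'p::prime_card padic) = 0"
proof -
  have "real CARD('p) powi k = 1 \<longleftrightarrow> k = 0" for k
    using p_real_gt_1[where 'p='p] one_less_power_int[of "real CARD('p)" k]
      one_less_power_int[of "real CARD('p)" "- k"]
    by (cases k "0::int" rule: linorder_cases) (auto simp: power_int_minus)
  then show ?thesis by (auto simp: Zp_units_def padic_abs_def)
qed

lemma Zp_iff_ord: "x \<in> Zp \<longleftrightarrow> x = 0 \<or> padic_ord (x::'p::prime_card padic) \<ge> 0"
proof -
  have "real CARD('p) powi k \<le> 1 \<longleftrightarrow> k \<le> 0" for k
    using p_real_gt_1[where 'p='p] one_less_power_int[of "real CARD('p)" k]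
      one_le_power_int[of "real CARD('p)" "- k"]
    by (cases "k > 0") (auto simp: power_int_minus one_le_inverse_iff)
  then show ?thesis by (auto simp: Zp_def padic_abs_def)
qed

lemma padic_ord_1 [simp]: "padic_ord (1::'p::prime_card padic) = 0"
  using Zp_units_closed(1)[where 'p='p] by (simp add: Zp_units_ord)

lemma padic_ord_power: "x \<noteq> 0 \<Longrightarrow> padic_ord ((x::'p::prime_card padic) ^ k) = int k * padic_ord x"
  by (induction k) (auto simp: padic_ord_mult algebra_simps)

lemma padic_ord_inverse: "x \<noteq> 0 \<Longrightarrow> padic_ord (inverse (x::'p::prime_card padic)) = - padic_ord x"
  using padic_ord_mult[of x "inverse x"] by simp

lemma padic_ord_divide: "x \<noteq> 0 \<Longrightarrow> y \<noteq> 0 \<Longrightarrow> padic_ord (x / (y::'p::prime_card padic)) = padic_ord x - padic_ord y"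
  by (simp add: divide_inverse padic_ord_mult padic_ord_inverse)

lemma padic_ord_power_int: "x \<noteq> 0 \<Longrightarrow> padic_ord ((x::'p::prime_card padic) powi k) = k * padic_ord x"
  by (simp add: power_int_def padic_ord_power padic_ord_inverse)

lemma p_ideal_ord: "x \<in> p_ideal N \<longleftrightarrow> x = 0 \<or> padic_ord (x::'p::prime_card padic) \<ge> int N"
  by (cases "x = 0") (auto simp: p_ideal_def Zp_iff_ord padic_ord_divide padic_ord_power)

lemma Zp_cases: "x \<in> Zp \<Longrightarrow> x \<in> p_ideal 1 \<or> x \<in> Zp_units"
  by (auto simp: p_ideal_ord Zp_iff_ord Zp_units_ord)

lemma Zp_units_not_p_ideal: "x \<in> Zp_units \<Longrightarrow> x \<notin> p_ideal 1"
  by (auto simp: p_ideal_ord Zp_units_ord)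

lemma Zp_units_cong:
  assumes "x \<in> Zp_units" "y - x \<in> p_ideal 1"
  shows "y \<in> Zp_units"
proof -
  have "y \<in> Zp" using Zp_closed(3)[of x "y - x"] Zp_units_in_Zp p_ideal_subset_Zp assms by force
  moreover have "y \<notin> p_ideal 1"
    using p_ideal_closed(3)[of y 1 "y - x"] assms Zp_units_not_p_ideal by force
  ultimately show ?thesis using Zp_cases by blast
qed

lemma p_ideal_unit_mult: "u \<in> Zp_units \<Longrightarrow> u * x \<in> p_ideal N \<longleftrightarrow> x \<in> p_ideal N"
  by (simp add: p_ideal_abs padic_abs_mult Zp_units_def)

lemma p_ideal_Suc_mult: "\<pp> ^ k * x \<in> p_ideal (k + j) \<longleftrightarrow> x \<in> p_ideal j"
  by (simp add: p_ideal_def power_add)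

lemma of_int_p_ideal: "(of_int k :: 'p::prime_card padic) \<in> p_ideal N \<longleftrightarrow> int CARD('p) ^ N dvd k"
proof
  assume "int CARD('p) ^ N dvd k"
  then obtain j where "k = int CARD('p) ^ N * j" by (elim dvdE)
  then have "(of_int k :: 'p padic) = \<pp> ^ N * of_int j" by simp
  then show "(of_int k :: 'p padic) \<in> p_ideal N"
    by (auto simp: p_ideal_iff intro: of_int_in_Zp)
next
  assume *: "(of_int k :: 'p padic) \<in> p_ideal N"
  show "int CARD('p) ^ N dvd k"
  proof (cases "k = 0")
    case False
    then have nz: "(of_int k :: 'p padic) \<noteq> 0" "(of_int k :: 'p zp) \<noteq> 0"
      using p_characteristic_0 of_zp_of_int of_zp_0 by metis+
    then have "N \<le> zord (of_int k :: 'p zp)"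
      using * padic_ord_of_zp[of "of_int k :: 'p zp"] by (simp add: p_ideal_ord of_zp_of_int)
    then have "Rep_zp (of_int k :: 'p zp) N = 0" using nz by (simp add: Rep_zp_eq_0_iff)
    then show ?thesis by (simp add: Rep_zp_of_int dvd_eq_mod_eq_0)
  qed simp
qed

section \<open>Approximation by integers and completeness\<close>

lemma of_zp_p_ideal: "of_zp (a::'p::prime_card zp) \<in> p_ideal N \<longleftrightarrow> Rep_zp a N = 0"
proof (cases "a = 0")
  case False
  then show ?thesis by (simp add: p_ideal_ord padic_ord_of_zp Rep_zp_eq_0_iff of_zp_eq_0)
qed (simp add: zero_zp.rep_eq p_ideal_closed)

lemma of_zp_approx: "of_zp (a::'p::prime_card zp) - of_int (Rep_zp a N) \<in> p_ideal N"
proof -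
  have "of_zp a - of_int (Rep_zp a N) = of_zp (a - of_int (Rep_zp a N))"
    by (simp add: of_zp_diff of_zp_of_int)
  then show ?thesis
    by (simp add: of_zp_p_ideal minus_zp.rep_eq Rep_zp_of_int mod_simps)
qed

text \<open>With the common power of p removed, the denominator of a fraction in Z_p is prime to p
  to the relevant precision, and can be inverted mod p^N.\<close>

lemma int_dense:
  assumes "x \<in> Zp"
  shows "\<exists>j. x - of_int j \<in> p_ideal N"
proof -
  obtain a b where ab: "b \<noteq> 0" "x = of_zp a / of_zp b" using padic_cases by blast
  let ?P = "int CARD('a)"
  show ?thesis
  proof (cases "a = 0")
    case True
    then show ?thesis using ab by (intro exI[of _ 0]) (simp add: p_ideal_closed)
  next
    case False
    let ?k = "zord b"
    \<comment> \<open>Dividing by \<open>b\<close> costs \<open>?k\<close> digits, and precision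
      \<open>?k + 1\<close> is needed to see that p^(k+1) does not divide \<open>b\<close>.\<close>
    let ?M = "N + ?k + 1"
    have "?k \<le> zord a" using assms ab False by (simp add: Zp_iff_ord padic_ord_frac of_zp_eq_0)
    then have "?P ^ ?k dvd Rep_zp a ?M" "?P ^ ?k dvd Rep_zp b ?M" "\<not> ?P ^ Suc ?k dvd Rep_zp b ?M"
      using False ab(1) by (auto simp: Rep_zp_dvd Rep_zp_eq_0_iff simp del: power_Suc)
    then obtain a' b' where a': "Rep_zp a ?M = ?P ^ ?k * a'" and b': "Rep_zp b ?M = ?P ^ ?k * b'"
      by (elim dvdE)
    have "\<not> ?P dvd b'" using \<open>\<not> ?P ^ Suc ?k dvd Rep_zp b ?M\<close> b' by (auto simp: mult.commute)
    then have "coprime b' (?P ^ N)"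
      using prime_p_int[where 'p='a] prime_imp_coprime coprime_commute coprime_power_right_iff by metis
    then obtain c where c: "[b' * c = 1] (mod ?P ^ N)" using cong_solve_coprime_int by blast
    let ?j = "a' * c"
    have "?P ^ N dvd a' - ?j * b'"
    proof -
      have "[a' * (b' * c) = a' * 1] (mod ?P ^ N)" using c cong_scalar_left by blast
      then show ?thesis by (simp add: cong_iff_dvd_diff algebra_simps dvd_diff_commute)
    qed
    moreover have e: "Rep_zp a ?M - ?j * Rep_zp b ?M = ?P ^ ?k * (a' - ?j * b')"
      by (simp only: a' b') (simp add: algebra_simps)
    ultimately have d: "of_int (Rep_zp a ?M - ?j * Rep_zp b ?M) \<in> (p_ideal (?k + N) :: 'a padic set)"
      unfolding of_int_p_ideal e power_add by (simp only: mult_dvd_mono dvd_refl)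
    have "of_zp a - of_int ?j * of_zp b =
      of_int (Rep_zp a ?M - ?j * Rep_zp b ?M) + ((of_zp a - of_int (Rep_zp a ?M))
        - of_int ?j * (of_zp b - of_int (Rep_zp b ?M)))"
      by (simp add: algebra_simps)
    also have "\<dots> \<in> p_ideal (?k + N)"
      by (rule p_ideal_closed(2)[OF d p_ideal_closed(3)[OF p_ideal_mono[OF of_zp_approx]
          p_ideal_mult_Zp(2)[OF p_ideal_mono[OF of_zp_approx] of_int_in_Zp]]]) auto
    finally have *: "of_zp a - of_int ?j * of_zp b \<in> p_ideal (?k + N)" .
    have "x - of_int ?j = (of_zp a - of_int ?j * of_zp b) / of_zp b"
      using ab by (simp add: of_zp_eq_0 field_simps)
    also have "\<dots> \<in> p_ideal N"
    proof (cases "of_zp a - of_int ?j * of_zp b = 0")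
      case True
      then show ?thesis by (simp only: True) (simp add: p_ideal_closed)
    next
      case False
      then show ?thesis using * ab(1)
        by (simp add: p_ideal_ord of_zp_eq_0 padic_ord_divide padic_ord_of_zp)
    qed
    finally show ?thesis by blast
  qed
qed

text \<open>Completeness of Z_p in the form that Hensel lifting needs: the reductions of
  \<open>r\<close> form a compatible family, which is an element of the inverse limit.\<close>

lemma zp_limit:
  fixes r :: "nat \<Rightarrow> int"
  assumes "\<And>n. [r (Suc n) = r n] (mod int CARD('p::prime_card) ^ n)"
  shows "\<exists>z\<in>Zp. \<forall>n. z - of_int (r n) \<in> (p_ideal n :: 'p padic set)"
proof -
  define z :: "'p zp" where "z = Abs_zp (\<lambda>n. r n mod int CARD('p) ^ n)"
  have "Rep_zp z = (\<lambda>n. r n mod int CARD('p) ^ n)"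
    unfolding z_def using assms
    by (intro Abs_zp_inverse) (simp add: mod_Suc_power cong_def del: power_Suc)
  then have "of_zp z - of_int (r n mod int CARD('p) ^ n) \<in> p_ideal n" for n
    using of_zp_approx[of z n] by simp
  moreover have "(of_int (r n mod int CARD('p) ^ n - r n) :: 'p padic) \<in> p_ideal n" for n
    unfolding of_int_p_ideal by (simp add: mod_eq_dvd_iff[symmetric])
  ultimately have "of_zp z - of_int (r n) \<in> p_ideal n" for n
    using p_ideal_closed(2)[of "of_zp z - of_int (r n mod int CARD('p) ^ n)" n
        "of_int (r n mod int CARD('p) ^ n - r n)"] by simp
  moreover have "of_zp z \<in> Zp" using of_zp_p_ideal[of z 0] Rep_zp_0 by (simp add: p_ideal_0)
  ultimately show ?thesis by blast
qed

section \<open>Square units and the Hilbert symbol\<close>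

lemma p_ideal_1_abs: "x \<in> p_ideal 1 \<longleftrightarrow> padic_abs (x::'p::prime_card padic) < 1"
proof
  assume "x \<in> p_ideal 1"
  then have "padic_abs x \<le> 1 / real CARD('p)" by (simp add: p_ideal_abs)
  also have "\<dots> < 1" using p_real_gt_1[where 'p='p] by simp
  finally show "padic_abs x < 1" .
next
  assume "padic_abs x < 1"
  then show "x \<in> p_ideal 1" using Zp_cases[of x] by (auto simp: Zp_def Zp_units_def)
qed

lemma residue_p_unique:
  assumes "a \<in> {0..<int CARD('p)}" "x - of_int a \<in> (p_ideal 1 :: 'p::prime_card padic set)"
  shows "residue_p x = a"
  unfolding residue_p_def p_ideal_1_abs[symmetric]
proof (rule the_equality)
  fix b assume b: "b \<in> {0..<int CARD('p)} \<and> x - of_int b \<in> p_ideal 1"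
  then have "of_int (a - b) \<in> (p_ideal 1 :: 'p padic set)"
    using p_ideal_closed(3)[of "x - of_int b" 1 "x - of_int a"] assms by simp
  then have "int CARD('p) dvd a - b" unfolding of_int_p_ideal by simp
  then have "a mod int CARD('p) = b mod int CARD('p)" by (simp add: mod_eq_dvd_iff)
  then show "b = a" using assms(1) b by simp
qed (use assms in blast)

lemma residue_p:
  assumes "x \<in> Zp"
  shows "residue_p x \<in> {0..<int CARD('p)}"
    "x - of_int (residue_p x) \<in> (p_ideal 1 :: 'p::prime_card padic set)"
proof -
  obtain j where j: "x - of_int j \<in> p_ideal 1" using int_dense assms by blast
  let ?a = "j mod int CARD('p)"
  have a: "?a \<in> {0..<int CARD('p)}" using p_gt_1[where 'p='p] by simp
  have "of_int (j - ?a) \<in> (p_ideal 1 :: 'p padic set)"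
    unfolding of_int_p_ideal by (simp add: minus_mod_eq_mult_div)
  then have b: "x - of_int ?a \<in> p_ideal 1" using j p_ideal_closed(2)[OF j, of "of_int (j - ?a)"] by simp
  show "residue_p x \<in> {0..<int CARD('p)}" "x - of_int (residue_p x) \<in> p_ideal 1"
    using residue_p_unique[OF a b] a b by simp_all
qed

lemma residue_p_of_int: "residue_p (of_int k :: 'p::prime_card padic) = k mod int CARD('p)"
proof (rule residue_p_unique)
  show "of_int k - of_int (k mod int CARD('p)) \<in> (p_ideal 1 :: 'p padic set)"
    unfolding of_int_diff[symmetric] of_int_p_ideal by (simp add: minus_mod_eq_mult_div)
qed (use p_gt_1[where 'p='p] in simp)

lemma residue_p_cong:
  assumes "x - y \<in> p_ideal 1" "y \<in> Zp"
  shows "residue_p x = residue_p (y::'p::prime_card padic)"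
  using residue_p_unique[OF residue_p(1)[OF assms(2)]]
    p_ideal_closed(2)[OF assms(1) residue_p(2)[OF assms(2)]] by simp

section \<open>The Legendre symbol on p-adic integers and square roots of units\<close>

lemma Legendre_cong: "[a = b] (mod p) \<Longrightarrow> Legendre a p = Legendre b p"
  by (simp add: Legendre_def QuadRes_def cong_def)

lemma Legendre_values: "Legendre a p \<in> {-1, 0, 1}"
  by (simp add: Legendre_def)

lemma Legendre_mult:
  assumes "prime p" "2 < p"
  shows "Legendre (a * b) (int p) = Legendre a (int p) * Legendre b (int p)"
proof -
  let ?L = "\<lambda>a. Legendre a (int p)"
  have "[?L a * ?L b = a ^ ((p - 1) div 2) * b ^ ((p - 1) div 2)] (mod p)"
    by (intro cong_mult euler_criterion assms)
  then have "[?L (a * b) = ?L a * ?L b] (mod p)"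
    using euler_criterion[OF assms, of "a * b"] unfolding power_mult_distrib by (metis cong_def)
  then have d: "int p dvd ?L (a * b) - ?L a * ?L b" by (simp add: cong_iff_dvd_diff)
  \<comment> \<open>Euler's criterion gives the identity only mod p; both sides lie in {-1, 0, 1}
    and p > 2, so the congruence is an equality.\<close>
  have "\<bar>?L (a * b) - ?L a * ?L b\<bar> \<le> 2"
    using Legendre_values[of a p] Legendre_values[of b p] Legendre_values[of "a * b" p] by auto
  then have "\<bar>?L (a * b) - ?L a * ?L b\<bar> < int p" using assms(2) by linarith
  then have "?L (a * b) - ?L a * ?L b = 0" using d dvd_imp_le_int[of "?L (a * b) - ?L a * ?L b" "int p"] by force
  then show ?thesis by simp
qed

lemma legendre_p_eq_Legendre:
  assumes "x - of_int k \<in> p_ideal 1"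
  shows "legendre_p (x::'p::prime_card padic) = Legendre k (int CARD('p))"
  unfolding legendre_p_def residue_p_cong[OF assms of_int_in_Zp] residue_p_of_int
  by (rule Legendre_cong) simp

lemma legendre_p_of_int: "legendre_p (of_int k :: 'p::prime_card padic) = Legendre k (int CARD('p))"
  by (rule legendre_p_eq_Legendre) (simp add: p_ideal_closed)

lemma legendre_p_cong:
  "x - y \<in> p_ideal 1 \<Longrightarrow> y \<in> Zp \<Longrightarrow> legendre_p x = legendre_p (y::'p::prime_card padic)"
  by (simp add: legendre_p_def residue_p_cong)

lemma p_gt_2: "odd CARD('p::prime_card) \<Longrightarrow> 2 < CARD('p)"
  using p_gt_1[where 'p='p] by (cases "CARD('p) = 2") auto

lemma legendre_p_mult:
  assumes "odd CARD('p)" "x \<in> Zp" "y \<in> Zp"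
  shows "legendre_p (x * y) = legendre_p x * legendre_p (y::'p::prime_card padic)"
proof -
  let ?a = "residue_p x" and ?b = "residue_p y"
  have "x * y - of_int (?a * ?b) = (x - of_int ?a) * y + of_int ?a * (y - of_int ?b)"
    by (simp add: algebra_simps)
  also have "\<dots> \<in> p_ideal 1"
    by (intro p_ideal_closed(2) p_ideal_mult_Zp(1)[OF residue_p(2)] p_ideal_mult_Zp(2)[OF residue_p(2)]
        of_int_in_Zp assms)
  finally have "legendre_p (x * y) = Legendre (?a * ?b) (int CARD('p))"
    by (rule legendre_p_eq_Legendre)
  then show ?thesis
    using Legendre_mult[OF prime_card p_gt_2[OF assms(1)]] by (simp add: legendre_p_def)
qed

lemma legendre_p_unit:
  assumes "u \<in> Zp_units"
  shows "legendre_p (u::'p::prime_card padic) \<in> {1, -1}"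
proof -
  have "\<not> [residue_p u = 0] (mod int CARD('p))"
  proof
    assume "[residue_p u = 0] (mod int CARD('p))"
    then have "(of_int (residue_p u) :: 'p padic) \<in> p_ideal 1"
      unfolding of_int_p_ideal by (simp add: cong_0_iff)
    then have "u \<in> p_ideal 1"
      using residue_p(2)[OF Zp_units_in_Zp[OF assms]] p_ideal_closed(2) by fastforce
    then show False using assms Zp_units_not_p_ideal by blast
  qed
  then show ?thesis by (simp add: legendre_p_def Legendre_def)
qed

lemma of_int_unit: "(of_int k :: 'p::prime_card padic) \<in> Zp_units \<longleftrightarrow> \<not> int CARD('p) dvd k"
  using Zp_cases[OF of_int_in_Zp, of k] Zp_units_not_p_ideal of_int_p_ideal[of k 1] by auto

lemma two_unit: "odd CARD('p) \<Longrightarrow> (2 :: 'p::prime_card padic) \<in> Zp_units"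
  using of_int_unit[of 2, where 'p='p] p_gt_2[where 'p='p] by (auto dest: zdvd_imp_le)

lemma legendre_p_squares:
  assumes "odd CARD('p)" "u \<in> Zp_units"
  shows "legendre_p (u\<^sup>2) = 1" "legendre_p (u::'p::prime_card padic) ^ 2 = 1"
  using legendre_p_mult[OF assms(1), of u u] legendre_p_unit[OF assms(2)] Zp_units_in_Zp[OF assms(2)]
  by (auto simp: power2_eq_square)

lemma square_unit_iff: "u\<^sup>2 \<in> Zp_units \<longleftrightarrow> u \<in> Zp_units"
proof -
  have "padic_abs u \<noteq> - 1" using padic_abs_nonneg[of u] by linarith
  then show ?thesis by (auto simp: Zp_units_def padic_abs_power power2_eq_1_iff)
qed

text \<open>Hensel's lemma for x^2 = u; the derivative 2 r0 is a unit because p is odd. That the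
  root stays near \<open>r0\<close> is used in \<open>cell_shift\<close> to obtain a root congruent
  to 1.\<close>

lemma square_unit_lift:
  assumes odd: "odd CARD('p)" and u: "u \<in> Zp_units" and r0: "u - (of_int r0)\<^sup>2 \<in> p_ideal 1"
  shows "\<exists>v\<in>Zp_units. u = v\<^sup>2 \<and> v - of_int r0 \<in> (p_ideal 1 :: 'p::prime_card padic set)"
proof -
  let ?P = "\<lambda>n r. u - (of_int r)\<^sup>2 \<in> (p_ideal (Suc n) :: 'p padic set)"
  have step: "\<exists>r'. ?P (Suc n) r' \<and> [r' = r] (mod int CARD('p) ^ Suc n)" if r: "?P n r" for n :: nat and r :: int
  proof -
    let ?r = "of_int r :: 'p padic"
    obtain z where z: "z \<in> Zp" "u - ?r\<^sup>2 = \<pp> ^ Suc n * z" using r by (auto simp: p_ideal_iff simp del: power_Suc)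
    have "?r\<^sup>2 - u \<in> p_ideal 1"
      using p_ideal_closed(4)[OF r] by (auto intro: p_ideal_mono simp del: power_Suc)
    then have ru: "?r \<in> Zp_units" using Zp_units_cong[OF u] square_unit_iff by blast
    then have ru2: "2 * ?r \<in> Zp_units" using two_unit[OF odd] by (intro Zp_units_closed)
    then have "z / (2 * ?r) \<in> Zp"
      using z(1) Zp_units_closed(4) Zp_units_in_Zp Zp_closed(6) by (metis divide_inverse)
    \<comment> \<open>Newton correction: \<open>t\<close> solves z = 2 r t mod p, so adding p^(n+1)
      t to \<open>r\<close> gains one digit of precision.\<close>
    then obtain t where "z / (2 * ?r) - of_int t \<in> p_ideal 1" using int_dense by blast
    then have "(2 * ?r) * (z / (2 * ?r) - of_int t) \<in> p_ideal 1"
      using ru2 by (simp only: p_ideal_unit_mult)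
    then have t: "z - 2 * ?r * of_int t \<in> p_ideal 1"
      using Zp_units_nonzero[OF ru2] by (simp add: algebra_simps)
    let ?r' = "r + int CARD('p) ^ Suc n * t"
    have "u - (of_int ?r')\<^sup>2 = (u - ?r\<^sup>2) - 2 * ?r * \<pp> ^ Suc n * of_int t
       - (\<pp> ^ Suc n)\<^sup>2 * (of_int t)\<^sup>2"
      by (simp add: power2_eq_square algebra_simps)
    also have "\<dots> = \<pp> ^ Suc n * ((z - 2 * ?r * of_int t) - \<pp> ^ 1 * (\<pp> ^ n * (of_int t)\<^sup>2))"
      unfolding z(2) by (simp add: power2_eq_square algebra_simps)
    also have "\<dots> \<in> p_ideal (Suc n + 1)"
      unfolding p_ideal_Suc_mult
      by (intro p_ideal_closed t p_power_in_p_ideal Zp_closed of_nat_in_Zp of_int_in_Zp)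
    finally have "?P (Suc n) ?r'" by simp
    moreover have "[?r' = r] (mod int CARD('p) ^ Suc n)" by (simp add: cong_iff_dvd_diff)
    ultimately show ?thesis by blast
  qed
  \<comment> \<open>The conjunct for \<open>n = 0\<close> carries the starting value
    \<open>r0\<close> through the dependent choice.\<close>
  have "\<exists>r. \<forall>n. (?P n (r n) \<and> (n = 0 \<longrightarrow> r n = r0)) \<and> [r (Suc n) = r n] (mod int CARD('p) ^ Suc n)"
  proof (rule dependent_nat_choice)
    show "\<exists>r. ?P 0 r \<and> (0 = (0::nat) \<longrightarrow> r = r0)" using r0 by auto
  next
    fix r n assume "?P n r \<and> (n = 0 \<longrightarrow> r = r0)"
    then show "\<exists>y. (?P (Suc n) y \<and> (Suc n = 0 \<longrightarrow> y = r0)) \<and> [y = r] (mod int CARD('p) ^ Suc n)"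
      using step[of r n] by auto
  qed
  then obtain r where r: "\<And>n. ?P n (r n)" "r 0 = r0"
    "\<And>n. [r (Suc n) = r n] (mod int CARD('p) ^ Suc n)" by blast
  have "[r (Suc n) = r n] (mod int CARD('p) ^ n)" for n
    using r(3)[of n] by (rule cong_dvd_modulus) (simp add: le_imp_power_dvd)
  then obtain z where z: "z \<in> Zp" "\<And>n. z - of_int (r n) \<in> (p_ideal n :: 'p padic set)"
    using zp_limit[of r] by blast
  have "u - z\<^sup>2 \<in> p_ideal n" for n
  proof -
    have "u - z\<^sup>2 = (u - (of_int (r n))\<^sup>2) - (z - of_int (r n)) * (z + of_int (r n))"
      by (simp add: power2_eq_square algebra_simps)
    also have "\<dots> \<in> p_ideal n"
      by (rule p_ideal_closed(3)[OF p_ideal_mono[OF r(1)] p_ideal_mult_Zp(1)[OF z(2)]])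
        (simp_all add: Zp_closed of_int_in_Zp z(1))
    finally show ?thesis .
  qed
  then have "u = z\<^sup>2" using in_all_p_ideals by force
  moreover have "z - of_int r0 \<in> p_ideal 1"
  proof -
    have "(of_int (r 1 - r 0) :: 'p padic) \<in> p_ideal 1"
      unfolding of_int_p_ideal using r(3)[of 0] by (simp add: cong_iff_dvd_diff)
    then show ?thesis using p_ideal_closed(2)[OF z(2)[of 1], of "of_int (r 1 - r 0)"] r(2) by simp
  qed
  ultimately show ?thesis using u square_unit_iff by blast
qed

lemma legendre_p_eq_1_iff:
  assumes odd: "odd CARD('p)" and u: "u \<in> Zp_units"
  shows "legendre_p u = 1 \<longleftrightarrow> (\<exists>v\<in>Zp_units. u = (v::'p::prime_card padic)\<^sup>2)"
proof
  assume "legendre_p u = 1"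
  then have "QuadRes (int CARD('p)) (residue_p u)"
    by (auto simp: legendre_p_def Legendre_def split: if_splits)
  then obtain r where "[r\<^sup>2 = residue_p u] (mod int CARD('p))" by (auto simp: QuadRes_def)
  then have "(of_int (residue_p u - r\<^sup>2) :: 'p padic) \<in> p_ideal 1"
    unfolding of_int_p_ideal by (simp add: cong_iff_dvd_diff dvd_diff_commute)
  then have "u - (of_int r)\<^sup>2 \<in> p_ideal 1"
    using p_ideal_closed(2)[OF residue_p(2)[OF Zp_units_in_Zp[OF u]]] by fastforce
  then show "\<exists>v\<in>Zp_units. u = v\<^sup>2" using square_unit_lift[OF odd u] by blast
qed (auto simp: legendre_p_squares odd)

lemma padic_ord_minus: "padic_ord (- x) = padic_ord (x::'p::prime_card padic)"
  using padic_ord_mult[of "-1" x] Zp_units_closed(2)[where 'p='p] by (cases "x = 0") (auto simp: Zp_units_ord)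

lemma padic_ord_add_less:
  assumes "x \<noteq> 0" "y \<noteq> (0::'p::prime_card padic)" "padic_ord x < padic_ord y"
  shows "x + y \<noteq> 0" "padic_ord (x + y) = padic_ord x"
proof -
  show nz: "x + y \<noteq> 0"
    using assms(3) padic_ord_minus[of y] by (metis add_eq_0_iff2 less_irrefl)
  show "padic_ord (x + y) = padic_ord x"
    using padic_ord_add[OF assms(1,2) nz] padic_ord_add[of "x + y" "- y"] assms nz
    by (auto simp: padic_ord_minus)
qed

section \<open>The Hilbert symbol\<close>

abbreviation hil :: "'p::prime_card padic \<Rightarrow> 'p padic \<Rightarrow> int" where "hil \<equiv> hilbert_symbol"

lemma hilbert_values: "hil a b \<in> {1, -1}"
  by (simp add: hilbert_symbol_def)

lemma hilbert_1I: "z\<^sup>2 = a * x\<^sup>2 + b * y\<^sup>2 \<Longrightarrow> x \<noteq> 0 \<or> y \<noteq> 0 \<or> z \<noteq> 0 \<Longrightarrow> hil a b = 1"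
  by (auto simp: hilbert_symbol_def)

lemma hilbert_commute: "hil a b = hil b a"
proof -
  have "hil b a = 1" if "hil a b = 1" for a b :: "'p::prime_card padic"
  proof -
    obtain x y z where "(x, y, z) \<noteq> (0, 0, 0)" "z\<^sup>2 = a * x\<^sup>2 + b * y\<^sup>2"
      using \<open>hil a b = 1\<close> by (auto simp: hilbert_symbol_def split: if_splits)
    then show ?thesis by (intro hilbert_1I[of z b y a x]) (auto simp: add.commute)
  qed
  then show ?thesis using hilbert_values[of a b] hilbert_values[of b a] by force
qed

lemma hilbert_square_left:
  assumes "c \<noteq> 0" shows "hil (c\<^sup>2 * a) b = hil a b"
proof -
  have *: "hil (c\<^sup>2 * a) b = 1" if "hil a b = 1" "c \<noteq> 0" for a b c :: "'p::prime_card padic"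
  proof -
    obtain x y z where "(x, y, z) \<noteq> (0, 0, 0)" "z\<^sup>2 = a * x\<^sup>2 + b * y\<^sup>2"
      using \<open>hil a b = 1\<close> by (auto simp: hilbert_symbol_def split: if_splits)
    then show ?thesis using that(2)
      by (intro hilbert_1I[of z _ "x / c" b y]) (auto simp: power_divide)
  qed
  have "hil (c\<^sup>2 * a) b = 1 \<longleftrightarrow> hil a b = 1"
    using *[of a b c] *[of "c\<^sup>2 * a" b "1 / c"] assms by (auto simp: power_divide)
  then show ?thesis using hilbert_values[of a b] hilbert_values[of "c\<^sup>2 * a" b] by force
qed

lemma hilbert_square_right: "c \<noteq> 0 \<Longrightarrow> hil a (c\<^sup>2 * b) = hil a b"
  by (metis hilbert_commute hilbert_square_left)

lemma hilbert_square [simp]: "hil (a\<^sup>2) b = 1"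
  by (rule hilbert_1I[of a _ 1 _ 0]) auto

lemma hilbert_neg [simp]: "hil a (- a) = 1"
  by (rule hilbert_1I[of 0 _ 1 _ 1]) auto

lemma hilbert_sum_1: "a + b = 1 \<Longrightarrow> hil a b = 1"
  by (rule hilbert_1I[of 1 _ 1 _ 1]) auto

text \<open>For fixed \<open>a\<close>, the symbol detects norms from the extension by a square root of \<open>a\<close>,
  and \<open>- a\<close> is such a norm.\<close>

lemma hilbert_norm_shift:
  assumes "a \<noteq> 0" shows "hil a (- (a * b)) = hil a b"
proof -
  have *: "hil a (- (a * b)) = 1" if "hil a b = 1" "a \<noteq> 0" for a b :: "'p::prime_card padic"
  proof -
    obtain x y z where "(x, y, z) \<noteq> (0, 0, 0)" "z\<^sup>2 = a * x\<^sup>2 + b * y\<^sup>2"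
      using \<open>hil a b = 1\<close> by (auto simp: hilbert_symbol_def split: if_splits)
    then show ?thesis using that(2)
      by (intro hilbert_1I[of "a * x" _ z _ y]) (auto simp: power2_eq_square algebra_simps)
  qed
  have "hil a (- (a * b)) = 1 \<longleftrightarrow> hil a b = 1"
    using *[of a b] *[of a "- (a * b)"] hilbert_square_right[of a a b] assms
    by (auto simp: power2_eq_square mult.assoc)
  then show ?thesis using hilbert_values[of a b] hilbert_values[of a "- (a * b)"] by force
qed

lemma square_of_equal_legendre:
  assumes odd: "odd CARD('p)" and "u \<in> Zp_units" "v \<in> Zp_units" "legendre_p u = legendre_p v"
  shows "\<exists>s\<in>Zp_units. u = s\<^sup>2 * (v::'p::prime_card padic)"
proof -
  have uv: "u / v \<in> Zp_units" using assms by (intro Zp_units_closed)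
  have "legendre_p (u / v) * legendre_p v = legendre_p u"
    using legendre_p_mult[OF odd Zp_units_in_Zp Zp_units_in_Zp, OF uv assms(3)] Zp_units_nonzero[OF assms(3)] by simp
  then have "legendre_p (u / v) = 1" using assms(4) legendre_p_unit[OF assms(3)] by auto
  then obtain s where "s \<in> Zp_units" "u / v = s\<^sup>2" using legendre_p_eq_1_iff[OF odd uv] by blast
  then show ?thesis using Zp_units_nonzero[OF assms(3)] by (auto simp: field_simps)
qed

text \<open>If \<open>u\<close> and \<open>v\<close> are both nonsquares, they lie in the square class of the least nonresidue \<open>k\<close>, and
  \<open>k\<^sup>2 = k (k - 1) + k\<close> is a solution because \<open>k - 1\<close> is a square.\<close>

lemma hilbert_units:
  assumes odd: "odd CARD('p)" and u: "u \<in> Zp_units" and v: "v \<in> Zp_units"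
  shows "hil u (v::'p::prime_card padic) = 1"
proof (cases "legendre_p u = 1 \<or> legendre_p v = 1")
  case True
  then show ?thesis
    using legendre_p_eq_1_iff[OF odd] u v hilbert_square hilbert_commute by metis
next
  case False
  let ?N = "\<lambda>k. 0 < k \<and> Legendre (int k) (int CARD('p)) = -1"
  define k where "k = (LEAST k. ?N k)"
  have L: "legendre_p u = -1" "legendre_p v = -1"
    using False legendre_p_unit u v by auto
  have "residue_p u \<noteq> 0" using L(1) by (auto simp: legendre_p_def Legendre_def)
  then have "?N (nat (residue_p u))"
    using L(1) residue_p(1)[OF Zp_units_in_Zp[OF u]] by (auto simp: legendre_p_def)
  then have kN: "?N k" and kle: "k \<le> nat (residue_p u)"
    unfolding k_def by (rule LeastI, rule Least_le)
  then have kp: "k < CARD('p)" using residue_p(1)[OF Zp_units_in_Zp[OF u]] by auto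
  have nd: "\<not> int CARD('p) dvd int j" if "0 < j" "j < CARD('p)" for j
    using that by (auto dest: nat_dvd_not_less)
  have "k \<noteq> 1"
  proof
    assume "k = 1"
    then have "Legendre 1 (int CARD('p)) = -1" using kN by simp
    moreover have "QuadRes (int CARD('p)) 1" by (auto simp: QuadRes_def intro!: exI[of _ 1])
    ultimately show False by (auto simp: Legendre_def split: if_splits)
  qed
  then have k1: "0 < k - 1" "k - 1 < k" using kN by auto
  then have "Legendre (int (k - 1)) (int CARD('p)) \<noteq> -1"
    using not_less_Least[of "k - 1" ?N] unfolding k_def[symmetric] by blast
  moreover have "(of_int (int (k - 1)) :: 'p padic) \<in> Zp_units"
    using nd[of "k - 1"] k1 kp unfolding of_int_unit by simp
  ultimately have "legendre_p (of_int (int (k - 1)) :: 'p padic) = 1"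
    using legendre_p_unit legendre_p_of_int by (metis insert_iff singletonD)
  then obtain r :: "'p padic" where r: "of_int (int (k - 1)) = r\<^sup>2"
    using legendre_p_eq_1_iff[OF odd] \<open>of_int (int (k - 1)) \<in> Zp_units\<close> by blast
  have kk: "(of_int (int k) :: 'p padic) \<in> Zp_units"
    unfolding of_int_unit using nd kN kp by blast
  have kL: "legendre_p (of_int (int k) :: 'p padic) = -1"
    unfolding legendre_p_of_int using kN by blast
  obtain s t where st: "s \<in> Zp_units" "u = s\<^sup>2 * of_int (int k)" "t \<in> Zp_units" "v = t\<^sup>2 * of_int (int k)"
    using square_of_equal_legendre[OF odd u kk] square_of_equal_legendre[OF odd v kk] L kL by metis
  have "of_int (int k) = r\<^sup>2 + 1" using r k1 by (simp add: of_nat_diff algebra_simps)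
  then have "(of_int (int k))\<^sup>2 = of_int (int k) * r\<^sup>2 + of_int (int k) * 1\<^sup>2"
    by (metis distrib_left one_power2 mult.right_neutral power2_eq_square)
  then have "hil (of_int (int k)) (of_int (int k) :: 'p padic) = 1" by (rule hilbert_1I) simp
  then show ?thesis using st by (simp add: hilbert_square_left hilbert_square_right Zp_units_nonzero)
qed

text \<open>For a nonsquare u, a solution scaled to x = 1 reads w^2 = u + p v q^2. If q is integral,
  reduction mod p makes u a square; otherwise the right side has odd valuation. Solutions with x = 0
  fail by the same parity.\<close>

lemma hilbert_unit_p:
  assumes odd: "odd CARD('p)" and u: "u \<in> Zp_units" and v: "v \<in> Zp_units"
  shows "hil u (\<pp> * v) = legendre_p (u::'p::prime_card padic)"
proof (cases "legendre_p u = 1")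
  case True
  then show ?thesis using legendre_p_eq_1_iff[OF odd u] by auto
next
  case False
  note u0 = Zp_units_nonzero[OF u] and v0 = Zp_units_nonzero[OF v]
  have "False" if h: "hil u (\<pp> * v) = 1"
  proof -
    obtain x y z where nz: "(x, y, z) \<noteq> (0, 0, 0)" and e: "z\<^sup>2 = u * x\<^sup>2 + \<pp> * v * y\<^sup>2"
      using h by (auto simp: hilbert_symbol_def split: if_splits)
    have ordv: "padic_ord (\<pp> * v * c\<^sup>2) = 1 + 2 * padic_ord c" if "c \<noteq> 0" for c
      using v v0 that by (simp add: padic_ord_mult padic_ord_power Zp_units_ord)
    have parity: "w\<^sup>2 \<noteq> \<pp> * v * c\<^sup>2" if "c \<noteq> 0" for c w
    proof
      assume e: "w\<^sup>2 = \<pp> * v * c\<^sup>2"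
      then have "w \<noteq> 0" using that v0 by auto
      then have "2 * padic_ord w = 1 + 2 * padic_ord c"
        using ordv[OF that] e padic_ord_power[of w 2] by simp
      then show False by presburger
    qed
    show False
    proof (cases "x = 0")
      case True
      then show False using nz e parity[of y z] by (cases "y = 0") auto
    next
      case x: False
      define w q where "w = z / x" and "q = y / x"
      have wq: "w\<^sup>2 = u + \<pp> * v * q\<^sup>2"
        using e x by (simp add: w_def q_def power_divide field_simps)
      show False
      proof (cases "q \<in> Zp")
        case True
        then have m: "\<pp> * v * q\<^sup>2 \<in> p_ideal 1"
          using v p_power_in_p_ideal(3)[of "v * q\<^sup>2" 1]
          by (simp add: Zp_closed Zp_units_in_Zp mult.assoc)
        then have "w\<^sup>2 \<in> Zp_units" using Zp_units_cong[OF u, of "w\<^sup>2"] wq by simp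
        then have "w \<in> Zp_units" by (simp add: square_unit_iff)
        moreover have "legendre_p (w\<^sup>2) = legendre_p u"
          using m u wq by (intro legendre_p_cong) (auto simp: Zp_units_in_Zp)
        ultimately show False using \<open>legendre_p u \<noteq> 1\<close> legendre_p_squares(1)[OF odd] by metis
      next
        case q: False
        then have q0: "q \<noteq> 0" "padic_ord q < 0" by (auto simp: Zp_iff_ord)
        let ?c = "\<pp> * v * q\<^sup>2"
        have c: "?c \<noteq> 0" "padic_ord ?c < padic_ord u"
          using q0 v0 ordv[OF q0(1)] u by (auto simp: Zp_units_ord)
        have "padic_ord (w\<^sup>2) = 1 + 2 * padic_ord q" "w\<^sup>2 \<noteq> 0"
          using padic_ord_add_less[OF c(1) u0 c(2)] wq ordv[OF q0(1)] by (auto simp: add.commute)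
        then have "2 * padic_ord w = 1 + 2 * padic_ord q" using padic_ord_power[of w 2] by simp
        then show False by presburger
      qed
    qed
  qed
  then have "hil u (\<pp> * v) = -1" using hilbert_values by blast
  then show ?thesis using False legendre_p_unit[OF u] by auto
qed

definition unit_part :: "'p::prime_card padic \<Rightarrow> 'p padic"
  where "unit_part x = x / \<pp> powi padic_ord x"

text \<open>The Legendre symbol extended to all nonzero arguments by the value 1 at
  \<open>\<pp>\<close>, hence dependent on this choice of uniformiser.\<close>

definition unit_char :: "'p::prime_card padic \<Rightarrow> int"
  where "unit_char x = legendre_p (unit_part x)"

lemma unit_part_unit: "x \<noteq> 0 \<Longrightarrow> unit_part x \<in> Zp_units"
  by (simp add: unit_part_def Zp_units_ord padic_ord_divide padic_ord_power_int)

lemma unit_part_decomp: "x = \<pp> powi padic_ord x * unit_part (x::'p::prime_card padic)"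
  by (simp add: unit_part_def)

lemma unit_part_mult: "x \<noteq> 0 \<Longrightarrow> y \<noteq> 0 \<Longrightarrow> unit_part (x * y) = unit_part x * unit_part (y::'p::prime_card padic)"
  by (simp add: unit_part_def padic_ord_mult power_int_add)

lemma unit_char_mult:
  "odd CARD('p) \<Longrightarrow> x \<noteq> 0 \<Longrightarrow> y \<noteq> 0 \<Longrightarrow> unit_char (x * y) = unit_char x * unit_char (y::'p::prime_card padic)"
  by (simp add: unit_char_def unit_part_mult legendre_p_mult Zp_units_in_Zp unit_part_unit)

lemma unit_char_values: "x \<noteq> 0 \<Longrightarrow> unit_char (x::'p::prime_card padic) \<in> {1, -1}"
  unfolding unit_char_def by (intro legendre_p_unit unit_part_unit)

lemma unit_char_unit: "u \<in> Zp_units \<Longrightarrow> unit_char u = legendre_p u"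
  by (simp add: unit_char_def unit_part_def Zp_units_ord)

lemma square_class_rep:
  assumes "x \<noteq> (0::'p::prime_card padic)"
  obtains c where "c \<noteq> 0" "x = c\<^sup>2 * (if odd (padic_ord x) then \<pp> * unit_part x else unit_part x)"
proof -
  let ?k = "padic_ord x div 2"
  have "x = (\<pp> powi ?k)\<^sup>2 * (if odd (padic_ord x) then \<pp> * unit_part x else unit_part x)"
  proof -
    have "padic_ord x = (if odd (padic_ord x) then ?k + ?k + 1 else ?k + ?k)" by presburger
    then have "\<pp> powi padic_ord x = (\<pp> powi ?k)\<^sup>2 * (if odd (padic_ord x) then \<pp> else (1::'p padic))"
      by (smt (verit) mult.right_neutral p_nonzero(1) power2_eq_square power_int_add power_int_add_1)
    then show ?thesis using unit_part_decomp[of x] by (auto simp: mult.assoc split: if_splits)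
  qed
  then show ?thesis using that[of "\<pp> powi ?k"] by simp
qed

text \<open>The tame symbol. Up to squares each argument is a unit or p times a unit. When p occurs
  on both sides, (a, b) = (a, -ab) turns one argument into a unit times a square, so the case with a
  single p applies.\<close>

lemma hilbert_formula:
  assumes odd: "odd CARD('p)" and x: "x \<noteq> 0" and y: "y \<noteq> (0::'p::prime_card padic)"
  shows "hil x y = (if odd (padic_ord x) then unit_char y else 1) *
    (if odd (padic_ord y) then unit_char x else 1) *
    (if odd (padic_ord x) \<and> odd (padic_ord y) then unit_char (-1 :: 'p padic) else 1)"
proof -
  let ?u = "unit_part x" and ?v = "unit_part y"
  have u: "?u \<in> Zp_units" and v: "?v \<in> Zp_units" using x y by (auto intro: unit_part_unit)
  note nz = Zp_units_nonzero[OF u] Zp_units_nonzero[OF v]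
  have pp: "hil (\<pp> * ?u) (\<pp> * ?v) = legendre_p ?u * legendre_p ?v * legendre_p (-1 :: 'p padic)"
  proof -
    have "- (\<pp> * ?u * (\<pp> * ?v)) = \<pp>\<^sup>2 * (- (?u * ?v))" by (simp add: power2_eq_square)
    then have "hil (\<pp> * ?u) (\<pp> * ?v) = hil (\<pp> * ?u) (- (?u * ?v))"
      using hilbert_norm_shift[of "\<pp> * ?u" "\<pp> * ?v"] hilbert_square_right[of \<pp> "\<pp> * ?u" "- (?u * ?v)"] nz
      by (metis mult_eq_0_iff p_nonzero(1))
    also have "\<dots> = legendre_p (- (?u * ?v))"
      using hilbert_unit_p[OF odd Zp_units_closed(6)[OF Zp_units_closed(3)[OF u v]] u] hilbert_commute by metis
    also have "\<dots> = legendre_p ?u * legendre_p ?v * legendre_p (-1 :: 'p padic)"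
      using legendre_p_mult[OF odd, of "-1" "?u * ?v"] legendre_p_mult[OF odd, of ?u ?v] u v
      by (simp add: Zp_units_in_Zp Zp_units_closed Zp_closed)
    finally show ?thesis .
  qed
  obtain c where c: "c \<noteq> 0" "x = c\<^sup>2 * (if odd (padic_ord x) then \<pp> * unit_part x else unit_part x)"
    using square_class_rep[OF x] .
  obtain d where d: "d \<noteq> 0" "y = d\<^sup>2 * (if odd (padic_ord y) then \<pp> * unit_part y else unit_part y)"
    using square_class_rep[OF y] .
  have "hil x y = hil (if odd (padic_ord x) then \<pp> * ?u else ?u) (if odd (padic_ord y) then \<pp> * ?v else ?v)"
    using hilbert_square_left[OF c(1)] hilbert_square_right[OF d(1)] c(2) d(2) by metis
  then show ?thesis
    using pp hilbert_units[OF odd u v] hilbert_unit_p[OF odd u v] hilbert_unit_p[OF odd v u]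
      hilbert_commute[of "\<pp> * ?u" ?v] unit_char_unit[OF Zp_units_closed(2)[where 'p='p]]
    by (simp add: unit_char_def[of x] unit_char_def[of y])
qed

text \<open>Bilinearity is invisible in the defining equation but can be read off the tame formula,
  whose factors are multiplicative signs switched on and off by the parity of the
  valuations.\<close>

lemma hilbert_mult_left:
  assumes odd: "odd CARD('p)" and "x \<noteq> 0" "y \<noteq> 0" "z \<noteq> (0::'p::prime_card padic)"
  shows "hil (x * y) z = hil x z * hil y z"
proof -
  have 1: "unit_char a * unit_char a = 1" if "a \<noteq> 0" for a :: "'p padic"
    using unit_char_values[OF that] by auto
  then have 2: "unit_char a * (unit_char a * k) = k" if "a \<noteq> 0" for a :: "'p padic" and k
    using that by (metis mult.assoc mult_1)
  show ?thesis
    using assms by (auto simp: hilbert_formula padic_ord_mult unit_char_mult 1 2 mult.assoc mult.commute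
        mult.left_commute)
qed

lemma hilbert_mult_right:
  assumes odd: "odd CARD('p)" and "x \<noteq> 0" "y \<noteq> 0" "z \<noteq> (0::'p::prime_card padic)"
  shows "hil z (x * y) = hil z x * hil z y"
  using hilbert_mult_left[OF assms] by (metis hilbert_commute)

section \<open>The metaplectic group\<close>

lemma mat2_mult_entries:
  fixes A B :: "'p::prime_card mat2"
  shows "(A ** B) $ 1 $ 1 = A $ 1 $ 1 * B $ 1 $ 1 + A $ 1 $ 2 * B $ 2 $ 1"
    "(A ** B) $ 1 $ 2 = A $ 1 $ 1 * B $ 1 $ 2 + A $ 1 $ 2 * B $ 2 $ 2"
    "(A ** B) $ 2 $ 1 = A $ 2 $ 1 * B $ 1 $ 1 + A $ 2 $ 2 * B $ 2 $ 1"
    "(A ** B) $ 2 $ 2 = A $ 2 $ 1 * B $ 1 $ 2 + A $ 2 $ 2 * B $ 2 $ 2"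
  by (simp_all add: matrix_matrix_mult_def sum_2)

lemma mat2_entries [simp]:
  "mat2 a b c d $ 1 $ 1 = a" "mat2 a b c d $ 1 $ 2 = b" "mat2 a b c d $ 2 $ 1 = c" "mat2 a b c d $ 2 $ 2 = d"
  by (simp_all add: mat2_def vector_2)

lemma mat_1_entries [simp]:
  "(mat 1 :: 'p::prime_card mat2) $ 1 $ 1 = 1" "(mat 1 :: 'p mat2) $ 1 $ 2 = 0"
  "(mat 1 :: 'p mat2) $ 2 $ 1 = 0" "(mat 1 :: 'p mat2) $ 2 $ 2 = 1"
  by (simp_all add: mat_def)

lemma mat2_eqI:
  fixes A B :: "'p::prime_card mat2"
  assumes "A $ 1 $ 1 = B $ 1 $ 1" "A $ 1 $ 2 = B $ 1 $ 2" "A $ 2 $ 1 = B $ 2 $ 1" "A $ 2 $ 2 = B $ 2 $ 2"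
  shows "A = B"
  using assms by (simp add: vec_eq_iff forall_2)

lemma SL2_iff: "A \<in> SL2 \<longleftrightarrow> A $ 1 $ 1 * A $ 2 $ 2 - A $ 1 $ 2 * A $ 2 $ 1 = 1"
  by (simp add: SL2_def det_2)

lemma SL2_mult: "A \<in> SL2 \<Longrightarrow> B \<in> SL2 \<Longrightarrow> A ** B \<in> SL2"
  by (simp add: SL2_def det_mul)

lemma SL2_one: "mat 1 \<in> SL2"
  by (simp add: SL2_def)

definition adj2 :: "'p::prime_card mat2 \<Rightarrow> 'p mat2"
  where "adj2 A = mat2 (A $ 2 $ 2) (- A $ 1 $ 2) (- A $ 2 $ 1) (A $ 1 $ 1)"

lemma adj2_entries [simp]:
  "adj2 A $ 1 $ 1 = A $ 2 $ 2" "adj2 A $ 1 $ 2 = - A $ 1 $ 2"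
  "adj2 A $ 2 $ 1 = - A $ 2 $ 1" "adj2 A $ 2 $ 2 = A $ 1 $ 1"
  by (simp_all add: adj2_def)

lemma adj2_SL2: "A \<in> SL2 \<Longrightarrow> adj2 A \<in> SL2"
  by (simp add: SL2_iff algebra_simps)

lemma adj2_inverse: "A \<in> SL2 \<Longrightarrow> A ** adj2 A = mat 1" "A \<in> SL2 \<Longrightarrow> adj2 A ** A = mat 1"
  by (auto intro!: mat2_eqI simp: SL2_iff mat2_mult_entries algebra_simps)

lemma \<tau>_nonzero: "A \<in> SL2 \<Longrightarrow> \<tau> A \<noteq> 0"
  by (auto simp: \<tau>_def SL2_iff)

lemma SL2_Borel: "A \<in> SL2 \<Longrightarrow> A $ 2 $ 1 = 0 \<Longrightarrow> A $ 2 $ 2 \<noteq> 0 \<and> A $ 1 $ 1 = 1 / A $ 2 $ 2"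
proof -
  assume "A \<in> SL2" "A $ 2 $ 1 = 0"
  then have *: "A $ 1 $ 1 * A $ 2 $ 2 = 1" by (simp add: SL2_iff)
  then have "A $ 2 $ 2 \<noteq> 0" by auto
  with * show ?thesis by (simp add: nonzero_eq_divide_eq)
qed

lemma \<tau>_Borel_left:
  "A \<in> SL2 \<Longrightarrow> A $ 2 $ 1 = 0 \<Longrightarrow> \<tau> (A ** B) = A $ 2 $ 2 * \<tau> B"
  using SL2_Borel[of A] by (simp add: \<tau>_def mat2_mult_entries)

text \<open>A nonzero lower left entry of \<open>A\<close> is multiplied by
  \<open>B $ 1 $ 1\<close>; if it is 0, the lower right entry is multiplied by
  \<open>B $ 2 $ 2\<close>, the inverse of that. The two outcomes agree modulo squares, and the
  Hilbert symbol sees no more.\<close>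

lemma \<tau>_Borel_right:
  assumes "B \<in> SL2" "B $ 2 $ 1 = 0"
  shows "\<tau> (A ** B) = \<tau> A * B $ 2 $ 2 \<or> \<tau> (A ** B) = \<tau> A / B $ 2 $ 2"
  using SL2_Borel[OF assms] assms by (auto simp: \<tau>_def mat2_mult_entries)

lemma bottom_right_mult:
  fixes A B :: "'p::prime_card mat2"
  assumes "B \<in> SL2"
  shows "(A ** B) $ 2 $ 2 * B $ 2 $ 1 = B $ 2 $ 2 * (A ** B) $ 2 $ 1 - A $ 2 $ 1"
proof -
  have "B $ 2 $ 2 * (A ** B) $ 2 $ 1 - (A ** B) $ 2 $ 2 * B $ 2 $ 1
    = A $ 2 $ 1 * (B $ 1 $ 1 * B $ 2 $ 2 - B $ 1 $ 2 * B $ 2 $ 1)"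
    by (simp add: mat2_mult_entries algebra_simps)
  also have "\<dots> = A $ 2 $ 1" using assms by (simp add: SL2_iff)
  finally show ?thesis by (simp add: algebra_simps)
qed

lemma \<tau>_mult_zero:
  assumes "B \<in> SL2" "B $ 2 $ 1 \<noteq> 0" "(A ** B) $ 2 $ 1 = 0"
  shows "\<tau> (A ** B) = - 1 * A $ 2 $ 1 / B $ 2 $ 1"
  using bottom_right_mult[OF assms(1), of A] assms by (simp add: \<tau>_def field_simps)

section \<open>The cocycle identity\<close>

lemma hilbert_cancel [simp]: "hil x y * hil x y = 1" "hil x y * (hil x y * z) = z"
  using hilbert_values[of x y] by auto

text \<open>The cocycle before its modification by the coboundary of \<open>s_p\<close>; the
  substance of the cocycle identity lies in this part.\<close>

definition kubota :: "'p::prime_card mat2 \<Rightarrow> 'p mat2 \<Rightarrow> int"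
  where "kubota g h = hil (\<tau> (g ** h) * \<tau> g) (\<tau> (g ** h) * \<tau> h)"

context
  assumes odd: "odd CARD('p::prime_card)"
begin

lemma hilbert_inverse_left: "x \<noteq> 0 \<Longrightarrow> hil (inverse x) y = hil x (y :: 'p padic)"
  using hilbert_square_left[of "inverse x" x y] by (simp add: power2_eq_square mult.assoc)

lemma hilbert_divide:
  assumes "x \<noteq> 0" "y \<noteq> 0" "z \<noteq> (0::'p padic)"
  shows "hil (x / y) z = hil x z * hil y z" "hil z (x / y) = hil z x * hil z y"
proof -
  show *: "hil (x / y) z = hil x z * hil y z"
    using assms by (simp add: divide_inverse hilbert_mult_left[OF odd] hilbert_inverse_left)
  then show "hil z (x / y) = hil z x * hil z y" by (metis hilbert_commute)
qed

lemma hilbert_self: "x \<noteq> 0 \<Longrightarrow> hil x x = hil x (- 1 :: 'p padic)"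
  using hilbert_norm_shift[of x "-1"] by simp

text \<open>Rewriting with these turns a symbol of products into a sorted product of symbols of
  atoms, from which \<open>hilbert_cancel\<close> removes the squares. Two such products are then
  compared by their normal forms.\<close>

lemmas hilbert_expand = hilbert_mult_left[OF odd] hilbert_mult_right[OF odd] hilbert_divide
  mult.assoc mult.commute mult.left_commute hilbert_commute

text \<open>The lower left entries of the products are \<open>c1 c2 u\<close>, \<open>c2 c3 v\<close> and \<open>c1 c2 c3 w\<close> with
  \<open>c2\<^sup>2 u v - c2\<^sup>2 w = 1\<close>; when none of them vanishes, the triviality of the symbol of \<open>u v\<close> and \<open>- w\<close> is all
  that is needed beyond bilinearity.\<close>

lemma kubota_cocycle_big_cell:
  assumes g: "g1 \<in> SL2" "g2 \<in> SL2" "(g3 :: 'p mat2) \<in> SL2"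
    and c: "g1 $ 2 $ 1 \<noteq> 0" "g2 $ 2 $ 1 \<noteq> 0" "g3 $ 2 $ 1 \<noteq> 0"
  shows "kubota g1 g2 * kubota (g1 ** g2) g3 = kubota g2 g3 * kubota g1 (g2 ** g3)"
proof -
  define c1 c2 c3 where cdef: "c1 = g1 $ 2 $ 1" "c2 = g2 $ 2 $ 1" "c3 = g3 $ 2 $ 1"
  note nz = c[folded cdef]
  define u where "u = (g1 ** g2) $ 2 $ 1 / (c1 * c2)"
  define v where "v = (g2 ** g3) $ 2 $ 1 / (c2 * c3)"
  define w where "w = u * v - 1 / c2\<^sup>2"
  \<comment> \<open>Naming -1 keeps it an ordinary factor for the bilinear expansion; as a numeral
    it would be absorbed into unary minus.\<close>
  define m :: "'p padic" where "m = - 1"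
  have m: "m \<noteq> 0" "m * m = 1" by (auto simp: m_def)
  have \<tau>: "\<tau> g1 = c1" "\<tau> g2 = c2" "\<tau> g3 = c3" using c by (simp_all add: \<tau>_def cdef)
  have c12: "(g1 ** g2) $ 2 $ 1 = c1 * c2 * u" using nz by (simp add: u_def)
  have c23: "(g2 ** g3) $ 2 $ 1 = c2 * c3 * v" using nz by (simp add: v_def)
  have c123: "(g1 ** (g2 ** g3)) $ 2 $ 1 = c1 * c2 * c3 * w"
  proof -
    \<comment> \<open>Multiplying by \<open>c2\<close> isolates the determinant of
      \<open>g2\<close>, so the entry of the triple product is expressed by those of the two double
      products.\<close>
    have "c2 * (g1 ** (g2 ** g3)) $ 2 $ 1
        = (g1 ** g2) $ 2 $ 1 * (g2 ** g3) $ 2 $ 1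
          - c1 * c3 * (g2 $ 1 $ 1 * g2 $ 2 $ 2 - g2 $ 1 $ 2 * g2 $ 2 $ 1)"
      by (simp add: mat2_mult_entries cdef algebra_simps)
    then have "c2 * (g1 ** (g2 ** g3)) $ 2 $ 1 = c1 * c2 * u * (c2 * c3 * v) - c1 * c3"
      using g(2) c12 c23 by (simp add: SL2_iff)
    moreover have "c2 * (c2 * w) = c2 * c2 * u * v - 1"
      using nz by (simp add: w_def right_diff_distrib power2_eq_square)
    then have "c1 * c3 * (c2 * (c2 * w)) = c1 * c3 * (c2 * c2 * u * v - 1)" by simp
    then have "c2 * (c1 * c2 * c3 * w) = c1 * c2 * u * (c2 * c3 * v) - c1 * c3"
      by (simp add: algebra_simps)
    ultimately show ?thesis using nz by (metis mult_left_cancel)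
  qed
  have t12: "\<tau> (g1 ** g2) = (if u = 0 then m * c1 / c2 else c1 * c2 * u)"
    using \<tau>_mult_zero[OF g(2) c(2), of g1] c12 nz by (simp add: \<tau>_def cdef[symmetric] m_def)
  have t23: "\<tau> (g2 ** g3) = (if v = 0 then m * c2 / c3 else c2 * c3 * v)"
    using \<tau>_mult_zero[OF g(3) c(3), of g2] c23 nz by (simp add: \<tau>_def cdef[symmetric] m_def)
  have t123: "\<tau> (g1 ** (g2 ** g3)) = (if w = 0 then m * (c1 * c2 * u) / c3 else c1 * c2 * c3 * w)"
    using \<tau>_mult_zero[OF g(3) c(3), of "g1 ** g2"] c123 c12 nz
    by (simp add: \<tau>_def cdef[symmetric] m_def matrix_mul_assoc)
  have k: "kubota g1 g2 = hil (\<tau> (g1 ** g2) * c1) (\<tau> (g1 ** g2) * c2)"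
    "kubota g2 g3 = hil (\<tau> (g2 ** g3) * c2) (\<tau> (g2 ** g3) * c3)"
    "kubota (g1 ** g2) g3 = hil (\<tau> (g1 ** (g2 ** g3)) * \<tau> (g1 ** g2)) (\<tau> (g1 ** (g2 ** g3)) * c3)"
    "kubota g1 (g2 ** g3) = hil (\<tau> (g1 ** (g2 ** g3)) * c1) (\<tau> (g1 ** (g2 ** g3)) * \<tau> (g2 ** g3))"
    by (simp_all add: kubota_def \<tau> matrix_mul_assoc)
  note hs = hilbert_expand[folded m_def]
    hilbert_self[OF nz(1), folded m_def] hilbert_self[OF nz(2), folded m_def] hilbert_self[OF nz(3), folded m_def]
    hilbert_self[of u, folded m_def] hilbert_self[of v, folded m_def] hilbert_self[of w, folded m_def]
  consider "u = 0" "v = 0" | "u = 0" "v \<noteq> 0" | "u \<noteq> 0" "v = 0" | "u \<noteq> 0" "v \<noteq> 0" "w = 0"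
    | "u \<noteq> 0" "v \<noteq> 0" "w \<noteq> 0" by blast
  then show ?thesis
  proof cases
    case 1
    then have w: "w = m / (c2 * c2)" by (simp add: w_def m_def power2_eq_square)
    then show ?thesis using nz m 1 unfolding k t12 t23 t123 w by (simp add: hs)
  next
    case 2
    then have w: "w = m / (c2 * c2)" by (simp add: w_def m_def power2_eq_square)
    then show ?thesis using nz m 2 unfolding k t12 t23 t123 w by (simp add: hs)
  next
    case 3
    then have w: "w = m / (c2 * c2)" by (simp add: w_def m_def power2_eq_square)
    then show ?thesis using nz m 3 unfolding k t12 t23 t123 w by (simp add: hs)
  next
    case 4
    then have v: "v = 1 / u / c2 / c2" using nz by (simp add: w_def field_simps power2_eq_square)
    have "hil 1 z = 1" "hil z 1 = 1" for z :: "'p padic"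
      using hilbert_square[of 1 z] hilbert_commute[of z 1] by auto
    then show ?thesis using nz m 4 unfolding k t12 t23 t123 v by (simp add: hs)
  next
    case 5
    have "hil (c2\<^sup>2 * (u * v)) (c2\<^sup>2 * (m * w)) = 1"
      using nz by (intro hilbert_sum_1) (simp add: w_def m_def algebra_simps)
    then have "hil (u * v) (m * w) = 1"
      using nz by (simp add: hilbert_square_left hilbert_square_right)
    then have "hil u m * hil u w * (hil v m * hil v w) = 1" using 5 m
      by (simp add: hilbert_mult_left[OF odd] hilbert_mult_right[OF odd] mult_ac)
    then have *: "hil u m * hil u w = hil v m * hil v w"
      using hilbert_values[of u m] hilbert_values[of u w] hilbert_values[of v m] hilbert_values[of v w] by auto
    \<comment> \<open>After expansion the two sides share every factor except the last one, and the
      relation just proved identifies those.\<close>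
    have "kubota g1 g2 * kubota (g1 ** g2) g3 =
        hil c1 c2 * hil c1 c3 * hil c2 c3 * hil c3 w * hil c1 w * hil c2 w * hil w w * (hil u m * hil u w)"
      using nz m 5 unfolding k t12 t23 t123 by (simp add: hs)
    moreover have "kubota g2 g3 * kubota g1 (g2 ** g3) =
        hil c1 c2 * hil c1 c3 * hil c2 c3 * hil c3 w * hil c1 w * hil c2 w * hil w w * (hil v m * hil v w)"
      using nz m 5 unfolding k t12 t23 t123 by (simp add: hs)
    ultimately show ?thesis unfolding * by simp
  qed
qed

text \<open>Multiplication by a Borel element changes \<tau> only by a diagonal entry, up to
  squares, so if one factor lies in the Borel subgroup bilinearity alone gives the identity. What
  remains is the big cell.\<close>

lemma kubota_cocycle:
  assumes g: "g1 \<in> SL2" "g2 \<in> SL2" "(g3 :: 'p mat2) \<in> SL2"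
  shows "kubota g1 g2 * kubota (g1 ** g2) g3 = kubota g2 g3 * kubota g1 (g2 ** g3)"
proof -
  note nz = \<tau>_nonzero[OF g(1)] \<tau>_nonzero[OF g(2)] \<tau>_nonzero[OF g(3)]
    \<tau>_nonzero[OF SL2_mult[OF g(1,2)]] \<tau>_nonzero[OF SL2_mult[OF g(2,3)]]
    \<tau>_nonzero[OF SL2_mult[OF g(1) SL2_mult[OF g(2,3)]]]
  note hs = hilbert_expand nz[THEN hilbert_self]
  consider "g1 $ 2 $ 1 = 0" | "g2 $ 2 $ 1 = 0" | "g3 $ 2 $ 1 = 0" | "g1 $ 2 $ 1 \<noteq> 0" "g2 $ 2 $ 1 \<noteq> 0" "g3 $ 2 $ 1 \<noteq> 0"
    by blast
  then show ?thesis
  proof cases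
    case 1
    have d: "g1 $ 2 $ 2 \<noteq> 0" and \<tau>1: "\<tau> g1 = g1 $ 2 $ 2" using SL2_Borel[OF g(1) 1] 1 by (auto simp: \<tau>_def)
    show ?thesis
      unfolding kubota_def matrix_mul_assoc[symmetric] \<tau>_Borel_left[OF g(1) 1] \<tau>1
      using nz d by (simp add: hs hilbert_self[OF d])
  next
    case 2
    have d: "g2 $ 2 $ 2 \<noteq> 0" and \<tau>2: "\<tau> g2 = g2 $ 2 $ 2" using SL2_Borel[OF g(2) 2] 2 by (auto simp: \<tau>_def)
    show ?thesis
      using \<tau>_Borel_right[OF g(2) 2, of g1]
      unfolding kubota_def matrix_mul_assoc[symmetric] \<tau>_Borel_left[OF g(2) 2] \<tau>2
      using nz d by (elim disjE) (simp_all add: hs hilbert_self[OF d])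
  next
    case 3
    have d: "g3 $ 2 $ 2 \<noteq> 0" and \<tau>3: "\<tau> g3 = g3 $ 2 $ 2" using SL2_Borel[OF g(3) 3] 3 by (auto simp: \<tau>_def)
    show ?thesis
      using \<tau>_Borel_right[OF g(3) 3, of g2] \<tau>_Borel_right[OF g(3) 3, of "g1 ** g2"]
      unfolding kubota_def matrix_mul_assoc[symmetric] \<tau>3
      using nz d by (elim disjE) (simp_all add: hs hilbert_self[OF d])
  next
    case 4
    then show ?thesis using kubota_cocycle_big_cell[OF g] by blast
  qed
qed


end

lemma cocycle_kubota: "cocycle g h = kubota g h * s_p g * s_p h * s_p (g ** h)"
  by (simp add: cocycle_def kubota_def)

lemma s_p_values: "s_p g \<in> {1, -1}"
  using hilbert_values by (auto simp: s_p_def)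

lemma s_p_cancel [simp]: "s_p g * s_p g = 1" "s_p g * (s_p g * z) = z"
  using s_p_values[of g] by auto

lemma cocycle_values: "cocycle g h \<in> {1, -1}"
  using hilbert_values[of "\<tau> (g ** h) * \<tau> g" "\<tau> (g ** h) * \<tau> h"]
    s_p_values[of g] s_p_values[of h] s_p_values[of "g ** h"]
  unfolding cocycle_def by auto

text \<open>A coboundary does not disturb the identity: the sign of \<open>g1 ** g2\<close> occurs
  twice on the left, that of \<open>g2 ** g3\<close> twice on the right.\<close>

lemma cocycle_identity:
  assumes odd: "odd CARD('p)" and g: "g1 \<in> SL2" "g2 \<in> SL2" "g3 \<in> (SL2 :: 'p::prime_card mat2 set)"
  shows "cocycle g1 g2 * cocycle (g1 ** g2) g3 = cocycle g2 g3 * cocycle g1 (g2 ** g3)"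
proof -
  have "cocycle g1 g2 * cocycle (g1 ** g2) g3 =
      (kubota g1 g2 * kubota (g1 ** g2) g3) * s_p g1 * s_p g2 * s_p g3 * s_p (g1 ** g2 ** g3)"
    by (simp add: cocycle_kubota mult.assoc mult.commute mult.left_commute)
  also have "\<dots> = cocycle g2 g3 * cocycle g1 (g2 ** g3)"
    unfolding kubota_cocycle[OF odd g]
    by (simp add: cocycle_kubota mult.assoc mult.commute mult.left_commute matrix_mul_assoc)
  finally show ?thesis .
qed

lemma cocycle_one [simp]: "cocycle (mat 1) g = 1" "cocycle g (mat 1) = 1"
proof -
  have "\<tau> (mat 1 :: 'a mat2) = 1" "s_p (mat 1 :: 'a mat2) = 1" by (simp_all add: \<tau>_def s_p_def)
  moreover have "hil (\<tau> g) (\<tau> g * \<tau> g) = 1" "hil (\<tau> g * \<tau> g) (\<tau> g) = 1"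
    using hilbert_square[of "\<tau> g" "\<tau> g"] hilbert_commute[of "\<tau> g" "(\<tau> g)\<^sup>2"] by (simp_all add: power2_eq_square)
  ultimately show "cocycle (mat 1) g = 1" "cocycle g (mat 1) = 1"
    by (simp_all add: cocycle_def)
qed

text \<open>Makes \<open>mp_inv\<close> an inverse on both sides. Both products are the identity
  matrix, and the Hilbert symbol is symmetric.\<close>

lemma cocycle_adj2: "A \<in> SL2 \<Longrightarrow> cocycle (adj2 A) A = cocycle A (adj2 A)"
  by (simp add: cocycle_def adj2_inverse hilbert_commute mult.commute)

section \<open>Group structure of the cover\<close>

definition mp_one :: "'p::prime_card mp" where "mp_one = (mat 1, 1)"

definition mp_inv :: "'p::prime_card mp \<Rightarrow> 'p mp"
  where "mp_inv x = (adj2 (fst x), snd x * cocycle (fst x) (adj2 (fst x)))"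

lemma full_preimage_iff: "x \<in> full_preimage S \<longleftrightarrow> fst x \<in> S \<and> snd x \<in> {1, -1}"
  by (cases x) (auto simp: full_preimage_def)

lemma mp_mult_sign: "snd x \<in> {1, -1} \<Longrightarrow> snd y \<in> {1, -1} \<Longrightarrow> snd (x \<odot> y) \<in> {1, -1}"
  using cocycle_values[of "fst x" "fst y"] by (auto simp: mp_mult_def)

lemma mp_inv_sign: "snd x \<in> {1, -1} \<Longrightarrow> snd (mp_inv x) \<in> {1, -1}"
  using cocycle_values[of "fst x" "adj2 (fst x)"] by (auto simp: mp_inv_def)

lemma Mp_iff: "x \<in> Mp \<longleftrightarrow> fst x \<in> SL2 \<and> snd x \<in> {1, -1}"
  by (simp add: Mp_def full_preimage_iff)

lemma Mp_closed:
  "mp_one \<in> Mp" "x \<in> Mp \<Longrightarrow> y \<in> Mp \<Longrightarrow> x \<odot> y \<in> Mp" "x \<in> Mp \<Longrightarrow> mp_inv x \<in> Mp"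
proof -
  show "x \<in> Mp \<Longrightarrow> y \<in> Mp \<Longrightarrow> x \<odot> y \<in> Mp"
    using mp_mult_sign[of x y] by (simp add: Mp_iff mp_mult_def SL2_mult)
  show "x \<in> Mp \<Longrightarrow> mp_inv x \<in> Mp"
    using mp_inv_sign[of x] by (simp add: Mp_iff mp_inv_def adj2_SL2)
qed (simp add: Mp_iff mp_one_def SL2_one)

lemma mp_assoc:
  assumes odd: "odd CARD('p)" and "x \<in> Mp" "y \<in> Mp" "z \<in> (Mp :: 'p::prime_card mp set)"
  shows "x \<odot> y \<odot> z = x \<odot> (y \<odot> z)"
  using cocycle_identity[OF odd, of "fst x" "fst y" "fst z"] assms
  by (simp add: mp_mult_def Mp_iff matrix_mul_assoc mult.assoc mult.left_commute)

lemma mp_one_mult [simp]: "mp_one \<odot> x = x" "x \<odot> mp_one = x"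
  by (simp_all add: mp_mult_def mp_one_def)

lemma mp_inv_mult:
  assumes "x \<in> Mp" shows "x \<odot> mp_inv x = mp_one" "mp_inv x \<odot> x = mp_one"
  using assms cocycle_values[of "fst x" "adj2 (fst x)"]
  by (auto simp: mp_mult_def mp_one_def mp_inv_def Mp_iff adj2_inverse cocycle_adj2)

lemma mp_cancel:
  assumes odd: "odd CARD('p)" and x: "x \<in> Mp" and y: "y \<in> (Mp :: 'p::prime_card mp set)"
  shows "mp_inv x \<odot> (x \<odot> y) = y" "x \<odot> (mp_inv x \<odot> y) = y" "y \<odot> x \<odot> mp_inv x = y" "y \<odot> mp_inv x \<odot> x = y"
  using mp_assoc[OF odd, symmetric, OF Mp_closed(3)[OF x] x y] mp_assoc[OF odd, symmetric, OF x Mp_closed(3)[OF x] y]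
    mp_assoc[OF odd y x Mp_closed(3)[OF x]] mp_assoc[OF odd y Mp_closed(3)[OF x] x] mp_inv_mult[OF x]
  by simp_all

definition mp_subgroup :: "'p::prime_card mp set \<Rightarrow> bool"
  where "mp_subgroup S \<longleftrightarrow> S \<subseteq> Mp \<and> mp_one \<in> S \<and> (\<forall>x\<in>S. \<forall>y\<in>S. x \<odot> y \<in> S) \<and> (\<forall>x\<in>S. mp_inv x \<in> S)"

lemma mp_subgroupD:
  assumes "mp_subgroup S"
  shows "x \<in> S \<Longrightarrow> x \<in> Mp" "mp_one \<in> S" "x \<in> S \<Longrightarrow> y \<in> S \<Longrightarrow> x \<odot> y \<in> S" "x \<in> S \<Longrightarrow> mp_inv x \<in> S"
  using assms by (auto simp: mp_subgroup_def)

lemma mp_subgroup_full_preimage: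
  assumes "S \<subseteq> SL2" "mat 1 \<in> S" "\<And>A B. A \<in> S \<Longrightarrow> B \<in> S \<Longrightarrow> A ** B \<in> S" "\<And>A. A \<in> S \<Longrightarrow> adj2 A \<in> S"
  shows "mp_subgroup (full_preimage S)"
  unfolding mp_subgroup_def
proof (intro conjI ballI)
  fix x y assume "x \<in> full_preimage S" "y \<in> full_preimage S"
  then show "x \<odot> y \<in> full_preimage S"
    using mp_mult_sign[of x y] assms(3) by (simp add: full_preimage_iff mp_mult_def)
next
  fix x assume "x \<in> full_preimage S"
  then show "mp_inv x \<in> full_preimage S"
    using mp_inv_sign[of x] assms(4) by (simp add: full_preimage_iff mp_inv_def)
qed (use assms(1,2) in \<open>auto simp: full_preimage_iff Mp_iff mp_one_def\<close>)

lemma Borel_subgroup: "mp_subgroup Borel"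
  unfolding Borel_def
  by (rule mp_subgroup_full_preimage) (auto simp: SL2_one SL2_mult mat2_mult_entries adj2_SL2)

lemma Borel_iff: "b \<in> Borel \<longleftrightarrow> fst b \<in> SL2 \<and> fst b $ 2 $ 1 = 0 \<and> snd b \<in> {1, -1}"
  by (auto simp: Borel_def full_preimage_iff)

section \<open>The groups K0 and the splitting of the cover over them\<close>

lemma K0_iff:
  "A \<in> K0 m \<longleftrightarrow> A \<in> SL2 \<and> A $ 1 $ 1 \<in> Zp \<and> A $ 1 $ 2 \<in> Zp \<and> A $ 2 $ 2 \<in> Zp \<and> A $ 2 $ 1 \<in> p_ideal m"
  using p_ideal_subset_Zp[of "A $ 2 $ 1" m] by (auto simp: K0_def SL2_Zp_def forall_2 p_ideal_iff)

lemma K0_subset_SL2: "A \<in> K0 m \<Longrightarrow> A \<in> SL2"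
  by (simp add: K0_iff)

lemma K0_mono: "A \<in> K0 m \<Longrightarrow> k \<le> m \<Longrightarrow> A \<in> K0 k"
  by (auto simp: K0_iff intro: p_ideal_mono)

lemma K0_mult: "A \<in> K0 m \<Longrightarrow> B \<in> K0 m \<Longrightarrow> A ** B \<in> K0 m"
  using p_ideal_subset_Zp[of "A $ 2 $ 1" m] p_ideal_subset_Zp[of "B $ 2 $ 1" m]
  by (auto simp: K0_iff SL2_mult mat2_mult_entries intro!: Zp_closed
      p_ideal_closed(2)[OF p_ideal_mult_Zp(1) p_ideal_mult_Zp(2)])

lemma K0_adj2: "A \<in> K0 m \<Longrightarrow> adj2 A \<in> K0 m"
  by (auto simp: K0_iff adj2_SL2 intro: Zp_closed p_ideal_closed)

lemma K0_subgroup: "mp_subgroup (full_preimage (K0 m))"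
  by (rule mp_subgroup_full_preimage)
    (auto simp: K0_mult K0_adj2 K0_subset_SL2, auto simp: K0_iff SL2_one Zp_closed p_ideal_closed)

lemma unit_of_product:
  assumes "x \<in> Zp" "y \<in> Zp" "x * y \<in> Zp_units"
  shows "x \<in> Zp_units"
proof (rule ccontr)
  assume "x \<notin> Zp_units"
  then have "x * y \<in> p_ideal 1" using assms Zp_cases p_ideal_mult_Zp by blast
  then show False using assms(3) Zp_units_not_p_ideal by blast
qed

lemma K0_diagonal:
  assumes "A \<in> K0 m" "m \<ge> 1"
  shows "A $ 1 $ 1 * A $ 2 $ 2 - 1 \<in> p_ideal m" "A $ 1 $ 1 \<in> Zp_units" "A $ 2 $ 2 \<in> Zp_units"
proof -
  have A: "A $ 1 $ 1 * A $ 2 $ 2 - 1 = A $ 1 $ 2 * A $ 2 $ 1" using assms by (simp add: K0_iff SL2_iff algebra_simps)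
  then show *: "A $ 1 $ 1 * A $ 2 $ 2 - 1 \<in> p_ideal m"
    using assms by (simp add: K0_iff p_ideal_mult_Zp)
  then have "A $ 1 $ 1 * A $ 2 $ 2 \<in> Zp_units"
    using assms(2) by (intro Zp_units_cong[OF Zp_units_closed(1)]) (auto intro: p_ideal_mono)
  then show "A $ 1 $ 1 \<in> Zp_units" "A $ 2 $ 2 \<in> Zp_units"
    using unit_of_product[of "A $ 1 $ 1" "A $ 2 $ 2"] unit_of_product[of "A $ 2 $ 2" "A $ 1 $ 1"] assms
    by (auto simp: K0_iff mult.commute)
qed

lemma hilbert_unit_legendre:
  assumes odd: "odd CARD('p)" and "u \<in> Zp_units" "v \<in> Zp_units" "legendre_p u = legendre_p v"
  shows "hil u z = hil v (z :: 'p::prime_card padic)" "hil z u = hil z v"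
proof -
  obtain s where "s \<in> Zp_units" "u = s\<^sup>2 * v" using square_of_equal_legendre[OF assms] by blast
  then show "hil u z = hil v z" by (simp add: hilbert_square_left Zp_units_nonzero)
  then show "hil z u = hil z v" by (metis hilbert_commute)
qed

lemma K0_legendre:
  assumes odd: "odd CARD('p)" and A: "A \<in> K0 m" "m \<ge> 1"
  shows "legendre_p (A $ 1 $ 1) = legendre_p ((A :: 'p::prime_card mat2) $ 2 $ 2)"
proof -
  note d = K0_diagonal[OF A]
  have "legendre_p (A $ 1 $ 1 * A $ 2 $ 2) = legendre_p (1\<^sup>2 :: 'p padic)"
    using p_ideal_mono[OF d(1) A(2)] by (intro legendre_p_cong) (auto simp: Zp_closed)
  also have "\<dots> = 1" by (rule legendre_p_squares[OF odd Zp_units_closed(1)])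
  finally have "legendre_p (A $ 1 $ 1) * legendre_p (A $ 2 $ 2) = 1"
    using legendre_p_mult[OF odd] d by (simp add: Zp_units_in_Zp)
  then show ?thesis using legendre_p_unit[OF d(2)] legendre_p_unit[OF d(3)] by auto
qed

text \<open>Removes the parity condition from \<open>s_p\<close>. As d is a unit, (c, d) = 1 when c
  has even valuation; and (d, d) = 1 covers c = 0, where \<tau> is d.\<close>

lemma K0_s_p:
  assumes odd: "odd CARD('p)" and A: "(A :: 'p::prime_card mat2) \<in> K0 m" "m \<ge> 1"
  shows "s_p A = hil (\<tau> A) (A $ 2 $ 2)"
proof (cases "A $ 2 $ 1 = 0")
  case True
  note d = K0_diagonal(3)[OF A]
  show ?thesis using True hilbert_units[OF odd d d] by (simp add: s_p_def \<tau>_def)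
next
  case False
  note d = K0_diagonal(3)[OF A]
  have "padic_ord (A $ 2 $ 2) = 0" using d by (simp add: Zp_units_ord)
  then show ?thesis using False Zp_units_nonzero[OF d] hilbert_formula[OF odd False, of "A $ 2 $ 2"]
    by (auto simp: s_p_def \<tau>_def)
qed

lemma K0_bottom_right:
  assumes "A \<in> K0 m" "B \<in> K0 m"
  shows "(A ** B) $ 2 $ 2 - A $ 2 $ 2 * B $ 2 $ 2 \<in> p_ideal m"
  using assms by (auto simp: K0_iff mat2_mult_entries intro: p_ideal_mult_Zp)

text \<open>The sign functions combine with the Hilbert symbol into the single symbol (t12 t1 d2,
  t12 t2 d1). Here d2 may be replaced by the upper left entry a2 of \<open>B\<close>, which lies in
  the same square class. In the generic case c12 = c1 a2 + d1 c2 then says that the two arguments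
  sum to the square of c12, so the symbol is 1.\<close>

lemma K0_splitting:
  assumes odd: "odd CARD('p)" and A: "(A :: 'p::prime_card mat2) \<in> K0 m" "B \<in> K0 m" and m: "m \<ge> 1"
  shows "cocycle A B = 1"
proof -
  note AB = K0_mult[OF A]
  let ?d1 = "A $ 2 $ 2" and ?d2 = "B $ 2 $ 2" and ?d12 = "(A ** B) $ 2 $ 2"
  let ?t1 = "\<tau> A" and ?t2 = "\<tau> B" and ?t12 = "\<tau> (A ** B)"
  note d = K0_diagonal(3)[OF A(1) m] K0_diagonal(3)[OF A(2) m] K0_diagonal(3)[OF AB m]
  note dnz = Zp_units_nonzero[OF d(1)] Zp_units_nonzero[OF d(2)] Zp_units_nonzero[OF d(3)]
  note tnz = \<tau>_nonzero[OF K0_subset_SL2[OF A(1)]] \<tau>_nonzero[OF K0_subset_SL2[OF A(2)]]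
    \<tau>_nonzero[OF K0_subset_SL2[OF AB]]
  have L: "legendre_p ?d12 = legendre_p (?d1 * ?d2)"
    using p_ideal_mono[OF K0_bottom_right[OF A] m] d by (intro legendre_p_cong) (auto simp: Zp_closed Zp_units_in_Zp)
  have s12: "s_p (A ** B) = hil ?t12 (?d1 * ?d2)"
    unfolding K0_s_p[OF odd AB m]
    by (rule hilbert_unit_legendre(2)[OF odd d(3) Zp_units_closed(3)[OF d(1,2)] L])
  have "cocycle A B = hil (?t12 * ?t1) (?t12 * ?t2) * hil ?t1 ?d1 * hil ?t2 ?d2 * hil ?t12 (?d1 * ?d2)"
    unfolding cocycle_def s12 K0_s_p[OF odd A(1) m] K0_s_p[OF odd A(2) m] ..
  also have "\<dots> = hil (?t12 * ?t1 * ?d2) (?t12 * ?t2 * ?d1) * hil ?d1 ?d2"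
    using dnz tnz by (simp add: hilbert_expand[OF odd])
  also have "hil ?d1 ?d2 = 1" using hilbert_units[OF odd] d by blast
  also have "hil (?t12 * ?t1 * ?d2) (?t12 * ?t2 * ?d1) = 1"
  proof -
    note hs = hilbert_unit_legendre[OF odd K0_diagonal(2,3)[OF A(2) m] K0_legendre[OF odd A(2) m]]
    note a2 = Zp_units_nonzero[OF K0_diagonal(2)[OF A(2) m]]
    let ?a2 = "B $ 1 $ 1"
    let ?c1 = "A $ 2 $ 1" and ?c2 = "B $ 2 $ 1" and ?c12 = "(A ** B) $ 2 $ 1"
    have a: "hil (x * ?d2) z = hil (x * ?a2) z" if "x \<noteq> 0" "z \<noteq> 0" for x z
      using hs hilbert_mult_left[OF odd] dnz a2 that by metis
    have c12: "?c12 = ?c1 * ?a2 + ?d1 * ?c2" by (simp add: mat2_mult_entries)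
    consider "?c1 = 0" | "?c2 = 0" | "?c1 \<noteq> 0" "?c2 \<noteq> 0" "?c12 = 0" | "?c1 \<noteq> 0" "?c2 \<noteq> 0" "?c12 \<noteq> 0" by blast
    then show ?thesis
    proof cases
      case 1
      then have "?t12 = ?d1 * ?t2" using \<tau>_Borel_left K0_subset_SL2[OF A(1)] by blast
      then have "?t12 * ?t2 * ?d1 = (?d1 * ?t2)\<^sup>2" by (simp add: power2_eq_square)
      then show ?thesis by (metis hilbert_square hilbert_commute)
    next
      case 2
      have "hil (?t1 * ?t1 * (?d2 * ?d2)) z = 1" "hil (?t1 * ?t1) z = 1" for z
        using hilbert_square[of "?t1 * ?d2" z] hilbert_square[of ?t1 z] by (auto simp: power2_eq_square mult_ac)
      then show ?thesis
        using \<tau>_Borel_right[OF K0_subset_SL2[OF A(2)] 2, of A] dnz by (auto simp: mult_ac)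
    next
      case 3
      then have "?t12 = ?d12" "?t1 = ?c1" "?t2 = ?c2" by (simp_all add: \<tau>_def)
      then have "hil (?t12 * ?t1 * ?d2) (?t12 * ?t2 * ?d1) = hil (?d12 * (?c1 * ?a2)) (?d12 * (?d1 * ?c2))"
        using a[of "?t12 * ?t1" "?t12 * ?t2 * ?d1"] tnz dnz by (simp add: mult_ac)
      \<comment> \<open>Since c12 = 0, the two summands are opposite, and (x, -x) = 1 takes the
        place of the sum relation.\<close>
      also have "?d12 * (?d1 * ?c2) = - (?d12 * (?c1 * ?a2))"
        using c12 3 by (simp add: eq_neg_iff_add_eq_0 add.commute flip: distrib_left)
      finally show ?thesis by simp
    next
      case 4
      then have "?t12 = ?c12" "?t1 = ?c1" "?t2 = ?c2" by (simp_all add: \<tau>_def)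
      then have "hil (?t12 * ?t1 * ?d2) (?t12 * ?t2 * ?d1) = hil (?c12 * (?c1 * ?a2)) (?c12 * (?d1 * ?c2))"
        using a[of "?t12 * ?t1" "?t12 * ?t2 * ?d1"] tnz dnz by (simp add: mult_ac)
      also have "\<dots> = hil (?c12\<^sup>2 * (?c1 * ?a2 / ?c12)) (?c12\<^sup>2 * (?d1 * ?c2 / ?c12))"
        using 4 by (simp add: power2_eq_square)
      also have "\<dots> = hil (?c1 * ?a2 / ?c12) (?d1 * ?c2 / ?c12)"
        using 4 by (simp only: hilbert_square_left hilbert_square_right not_False_eq_True)
      also have "\<dots> = 1"
        using 4(3) c12 by (intro hilbert_sum_1) (simp flip: add_divide_distrib)
      finally show ?thesis .
    qed
  qed
  finally show ?thesis by simp
qed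

lemma K0_mp_mult:
  assumes "odd CARD('p)" "x \<in> full_preimage (K0 m)" "y \<in> full_preimage (K0 m)" "m \<ge> 1"
  shows "x \<odot> y = (fst x ** fst y, snd x * (snd (y :: 'p::prime_card mp)))"
  using K0_splitting[OF assms(1), of "fst x" m "fst y"] assms by (simp add: mp_mult_def full_preimage_iff)

section \<open>The genuine character\<close>

definition quadratic_char :: "('p::prime_card padic \<Rightarrow> complex) \<Rightarrow> bool"
  where "quadratic_char \<eta> \<longleftrightarrow> (\<forall>u\<in>Zp_units. \<eta> u = 1) \<or> (\<forall>u\<in>Zp_units. \<eta> u = of_int (legendre_p u))"

lemma quadratic_char_mult:
  assumes "odd CARD('p)" "quadratic_char \<eta>" "u \<in> Zp_units" "v \<in> (Zp_units :: 'p::prime_card padic set)"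
  shows "\<eta> (u * v) = \<eta> u * \<eta> v"
  using assms Zp_units_closed(3)[OF assms(3,4)] legendre_p_mult[OF assms(1)]
  by (auto simp: quadratic_char_def Zp_units_in_Zp)

lemma quadratic_char_cong:
  assumes "quadratic_char \<eta>" "u \<in> Zp_units" "v - u \<in> (p_ideal 1 :: 'p::prime_card padic set)"
  shows "\<eta> v = \<eta> u"
  using assms Zp_units_cong[OF assms(2,3)] legendre_p_cong[OF assms(3) Zp_units_in_Zp[OF assms(2)]]
  by (auto simp: quadratic_char_def)

lemma quadratic_char_values:
  assumes "quadratic_char \<eta>" "u \<in> Zp_units"
  shows "\<eta> u \<in> {1, -1}"
  using assms legendre_p_unit[OF assms(2)] by (auto simp: quadratic_char_def)

lemma quadratic_char_one:
  assumes "odd CARD('p)" "quadratic_char \<eta>" shows "\<eta> (1 :: 'p::prime_card padic) = 1"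
  using assms Zp_units_closed(1)[where 'p='p] legendre_p_squares(1)[OF assms(1) Zp_units_closed(1)]
  by (auto simp: quadratic_char_def)

text \<open>Lower right entries multiply modulo p^m and \<open>\<eta>\<close> sees only residues mod
  p, so every m >= 1 will do. The case m = 1 is the one applied later, because y(\<kappa>p^n) lies
  in \<open>K0 1\<close> but not in \<open>K0 (2 * n)\<close>.\<close>

lemma genuine_mult:
  assumes odd: "odd CARD('p)" and \<eta>: "quadratic_char \<eta>"
    and x: "x \<in> full_preimage (K0 m)" and y: "(y :: 'p::prime_card mp) \<in> full_preimage (K0 m)" and m: "m \<ge> 1"
  shows "genuine \<eta> (x \<odot> y) = genuine \<eta> x * genuine \<eta> y"
proof -
  have K: "fst x \<in> K0 m" "fst y \<in> K0 m" using x y by (auto simp: full_preimage_iff)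
  note d = K0_diagonal(3)[OF K(1) m] K0_diagonal(3)[OF K(2) m]
  have "\<eta> ((fst x ** fst y) $ 2 $ 2) = \<eta> (fst x $ 2 $ 2 * fst y $ 2 $ 2)"
    by (rule quadratic_char_cong[OF \<eta> Zp_units_closed(3)[OF d] p_ideal_mono[OF K0_bottom_right[OF K] m]])
  then show ?thesis
    using quadratic_char_mult[OF odd \<eta> d] by (simp add: genuine_def K0_mp_mult[OF odd x y m])
qed

lemma genuine_values:
  assumes "quadratic_char \<eta>" "x \<in> full_preimage (K0 m)" "m \<ge> 1"
  shows "genuine \<eta> x \<in> {1, -1}"
  using quadratic_char_values[OF assms(1) K0_diagonal(3)[of "fst x" m]] assms
  by (auto simp: genuine_def full_preimage_iff)

section \<open>Gauss sums and the Weil index\<close>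

lemma sum_lessThan_add:
  "(\<Sum>j<a + b. f j) = (\<Sum>j<a. f j) + (\<Sum>j<b. f (a + j :: nat) :: 'a::comm_monoid_add)"
  by (induction b) (auto simp: add.assoc)

lemma sum_lessThan_mult:
  "(\<Sum>j<q * s. f j) = (\<Sum>l<s. \<Sum>i<q. f (i + q * l :: nat) :: 'a::comm_monoid_add)"
proof (induction s)
  case (Suc s)
  have "q * Suc s = q * s + q" by simp
  then show ?case by (simp only: sum_lessThan_add sum.lessThan_Suc Suc.IH) (simp add: add.commute)
qed simp

lemma root_power_mod: "\<zeta> ^ p = (1 :: 'a::monoid_mult) \<Longrightarrow> \<zeta> ^ (k mod p) = \<zeta> ^ k"
proof -
  assume "\<zeta> ^ p = 1"
  then have "\<zeta> ^ (p * (k div p) + k mod p) = \<zeta> ^ (k mod p)" by (simp only: power_add power_mult) simp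
  then show ?thesis by simp
qed

section \<open>Gauss sums over the residues mod p\<close>

locale odd_prime =
  fixes p :: nat
  assumes p: "prime p" "2 < p"
begin

lemma p_gt_0: "0 < p" using p by simp

abbreviation "Leg t \<equiv> Legendre (int t) (int p)"

lemma Leg_mod: "Leg (t mod p) = Leg t"
  by (rule Legendre_cong) (simp add: zmod_int cong_def)

lemma Leg_zero_iff: "Leg t = 0 \<longleftrightarrow> p dvd t"
  by (auto simp: Legendre_def cong_0_iff)

lemma Leg_mult: "Leg (a * b) = Leg a * Leg b"
  using Legendre_mult[OF p] by simp

lemma Leg_square: "\<not> p dvd a \<Longrightarrow> Leg a * Leg a = 1"
  using Leg_zero_iff[of a] Legendre_values[of "int a" "int p"] by auto

lemma sum_mult_mod:
  assumes "\<not> p dvd a" "\<And>t. F (t mod p) = (F t :: complex)"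
  shows "(\<Sum>t<p. F (a * t)) = (\<Sum>t<p. F t)"
proof -
  let ?g = "\<lambda>t. a * t mod p"
  have "inj_on ?g {..<p}"
  proof (rule inj_onI)
    fix x y assume *: "x \<in> {..<p}" "y \<in> {..<p}" "?g x = ?g y"
    have "coprime a p" using assms(1) p(1) prime_imp_coprime coprime_commute by metis
    then have "[x = y] (mod p)" using *(3) cong_mult_lcancel_nat[of a p x y] by (simp add: cong_def)
    then show "x = y" using * by (simp add: cong_def)
  qed
  moreover have "?g ` {..<p} \<subseteq> {..<p}" using p by auto
  ultimately have "bij_betw ?g {..<p} {..<p}"
    by (simp add: bij_betw_def endo_inj_surj)
  then have "(\<Sum>t<p. F (?g t)) = (\<Sum>t<p. F t)" by (rule sum.reindex_bij_betw)
  then show ?thesis by (simp add: assms(2))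
qed

text \<open>Group the j by their squares: x^2 = t has 1 + (t/p) solutions mod p, which is also right
  for t = 0.\<close>

lemma sum_squares_mod:
  assumes "\<And>t. F (t mod p) = (F t :: complex)"
  shows "(\<Sum>j<p. F (j\<^sup>2)) = (\<Sum>t<p. (1 + of_int (Leg t)) * F t)"
proof -
  let ?S = "\<lambda>t. {j. j \<in> {..<p} \<and> j\<^sup>2 mod p = t}"
  have c: "of_nat (card (?S t)) = (1 + of_int (Leg t) :: complex)" if t: "t < p" for t
  proof (cases "p dvd t")
    case True
    then have "t = 0" using t by (auto dest: dvd_imp_le)
    have "j = 0" if "j < p" "j\<^sup>2 mod p = 0" for j
    proof -
      have "p dvd j" using that p(1) prime_dvd_power[of p j 2] by (auto simp: dvd_eq_mod_eq_0)
      then show "j = 0" using that by (auto dest: dvd_imp_le)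
    qed
    then have "j = 0" if "j \<in> ?S t" for j using that unfolding \<open>t = 0\<close> by simp
    moreover have "0 \<in> ?S t" using \<open>t = 0\<close> p by simp
    ultimately have "?S t = {0}" by (intro subset_antisym subsetI) (simp_all only: singleton_iff)
    then show ?thesis using Leg_zero_iff[of t] True by simp
  next
    case nd: False
    show ?thesis
    proof (cases "?S t = {}")
      case True
      have "\<not> QuadRes (int p) (int t)"
      proof
        assume "QuadRes (int p) (int t)"
        then obtain y where y: "[y\<^sup>2 = int t] (mod int p)" by (auto simp: QuadRes_def)
        let ?j = "nat (y mod int p)"
        have "int (?j\<^sup>2 mod p) = int t"
          using y t p by (simp add: zmod_int cong_def power_mod)
        moreover have "?j < p" using p by (simp add: nat_less_iff)
        ultimately show False using True by auto
      qed
      then have "Leg t = -1" using nd by (auto simp: Legendre_def cong_0_iff)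
      then show ?thesis using True by (simp only:) simp
    next
      case False
      then obtain i where i: "i < p" "i\<^sup>2 mod p = t" by auto
      have i0: "i \<noteq> 0" using i nd by (auto simp: power2_eq_square intro!: Nat.gr0I)
      have "?S t = {i, p - i}"
      proof (intro subset_antisym subsetI)
        fix j assume "j \<in> ?S t"
        then have j: "j < p" "j\<^sup>2 mod p = i\<^sup>2 mod p" using i by auto
        then have "int p dvd (int j)\<^sup>2 - (int i)\<^sup>2"
          by (metis mod_eq_dvd_iff of_nat_power zmod_int)
        then have "int p dvd (int j - int i) * (int j + int i)"
          by (simp add: power2_eq_square algebra_simps)
        then consider "int p dvd int j - int i" | "int p dvd int j + int i"
          using p(1) by (auto simp: prime_dvd_mult_iff)
        then show "j \<in> {i, p - i}"
        proof cases
          case 1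
          then have "int j mod int p = int i mod int p" by (simp add: mod_eq_dvd_iff)
          then show ?thesis using j i by simp
        next
          case 2
          then have "p dvd j + i" by (metis of_nat_add of_nat_dvd_iff)
          then obtain k where k: "j + i = p * k" by (elim dvdE)
          have "p * k < p * 2" using k i(1) j(1) by linarith
          then have "k < 2" by (rule mult_less_cancel1[THEN iffD1, THEN conjunct2])
          moreover have "k \<noteq> 0" using k i0 by (auto intro: Nat.gr0I)
          ultimately have "k = 1" by simp
          then show ?thesis using k by auto
        qed
      next
        fix j assume j: "j \<in> {i, p - i}"
        have "int ((p - i)\<^sup>2 mod p) = int (i\<^sup>2 mod p)"
        proof -
          have "(int p - int i)\<^sup>2 - (int i)\<^sup>2 = int p * (int p - 2 * int i)"
            by (simp add: power2_eq_square algebra_simps)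
          then have "int p dvd (int p - int i)\<^sup>2 - (int i)\<^sup>2" by simp
          then show ?thesis using i(1) by (simp add: zmod_int mod_eq_dvd_iff of_nat_diff)
        qed
        then have "(p - i)\<^sup>2 mod p = t" using i by simp
        then show "j \<in> ?S t" using j i i0 by auto
      qed
      moreover have "i \<noteq> p - i"
      proof
        assume "i = p - i"
        then have "p = 2 * i" using i by simp
        then show False using p by (metis dvd_triv_left less_irrefl prime_nat_iff numeral_eq_one_iff semiring_norm(85))
      qed
      ultimately have "card (?S t) = 2" by simp
      moreover have "Leg t = 1"
      proof -
        have "[(int i)\<^sup>2 = int t] (mod int p)"
          using i(2) by (auto simp: cong_def zmod_int)
        then have "QuadRes (int p) (int t)" by (auto simp: QuadRes_def)
        then show ?thesis using nd by (simp add: Legendre_def cong_0_iff)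
      qed
      ultimately show ?thesis by simp
    qed
  qed
  have "(\<Sum>j<p. F (j\<^sup>2)) = (\<Sum>t<p. \<Sum>j\<in>?S t. F (j\<^sup>2))"
    using p by (intro sum.group[symmetric]) auto
  also have "\<dots> = (\<Sum>t<p. of_nat (card (?S t)) * F t)"
  proof (rule sum.cong[OF refl])
    fix t
    have "(\<Sum>j\<in>?S t. F (j\<^sup>2)) = (\<Sum>j\<in>?S t. F t)"
      by (rule sum.cong[OF refl]) (use assms in force)
    then show "(\<Sum>j\<in>?S t. F (j\<^sup>2)) = of_nat (card (?S t)) * F t" by simp
  qed
  also have "\<dots> = (\<Sum>t<p. (1 + of_int (Leg t)) * F t)"
    by (rule sum.cong[OF refl]) (use c in auto)
  finally show ?thesis .
qed

lemma sum_Leg: "(\<Sum>t<p. of_int (Leg t)) = (0 :: complex)"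
  using sum_squares_mod[of "\<lambda>_. 1"] by (simp add: sum.distrib)

definition gauss_sum :: "complex \<Rightarrow> complex"
  where "gauss_sum \<zeta> = (\<Sum>t<p. of_int (Leg t) * \<zeta> ^ t)"

lemma root_power_ne_1:
  assumes "\<zeta> ^ p = 1" "\<zeta> \<noteq> 1" "\<not> p dvd a" shows "\<zeta> ^ a \<noteq> (1 :: complex)"
proof
  assume 1: "\<zeta> ^ a = 1"
  have "coprime a p" using assms(3) p(1) prime_imp_coprime coprime_commute by metis
  from cong_solve_coprime_nat[OF this] obtain b where "(a * b) mod p = 1 mod p" by (auto simp: cong_def)
  then have "\<zeta> ^ (a * b) = \<zeta> ^ 1" by (metis root_power_mod[OF assms(1)])
  then show False using 1 assms(2) by (simp add: power_mult)
qed

lemma sum_root_powers: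
  assumes "\<zeta> ^ p = 1" "\<zeta> \<noteq> 1"
  shows "(\<Sum>t<p. (\<zeta> ^ a) ^ t) = (if p dvd a then of_nat p else 0 :: complex)"
proof (cases "p dvd a")
  case True
  then have "\<zeta> ^ a = 1" using assms(1) by (auto simp: power_mult)
  then show ?thesis using True by simp
next
  case False
  have "(\<zeta> ^ a) ^ p = 1" using assms(1) by (metis mult.commute power_mult power_one)
  then show ?thesis using False geometric_sum[OF root_power_ne_1[OF assms False], of p] by simp
qed

text \<open>Replacing t by a t permutes the residues, and \<open>Leg a\<close> is its own
  inverse.\<close>

lemma gauss_sum_power:
  assumes "\<zeta> ^ p = 1" "\<not> p dvd a"
  shows "gauss_sum (\<zeta> ^ a) = of_int (Leg a) * gauss_sum \<zeta>"
proof -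
  have "gauss_sum (\<zeta> ^ a) = (\<Sum>t<p. of_int (Leg a) * (of_int (Leg (a * t)) * \<zeta> ^ (a * t)))"
    unfolding gauss_sum_def
  proof (rule sum.cong[OF refl])
    fix t
    have "Leg t = Leg a * Leg (a * t)"
      unfolding Leg_mult mult.assoc[symmetric] Leg_square[OF assms(2)] by simp
    then have "of_int (Leg t) = of_int (Leg a) * (of_int (Leg (a * t)) :: complex)"
      by (metis of_int_mult)
    then show "of_int (Leg t) * (\<zeta> ^ a) ^ t = of_int (Leg a) * (of_int (Leg (a * t)) * \<zeta> ^ (a * t))"
      by (simp only: power_mult mult.assoc)
  qed
  also have "\<dots> = of_int (Leg a) * (\<Sum>t<p. of_int (Leg (a * t)) * \<zeta> ^ (a * t))"
    by (simp only: sum_distrib_left)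
  also have "(\<Sum>t<p. of_int (Leg (a * t)) * \<zeta> ^ (a * t)) = gauss_sum \<zeta>"
    unfolding gauss_sum_def
    by (rule sum_mult_mod[OF assms(2), of "\<lambda>t. of_int (Leg t) * \<zeta> ^ t"]) (simp add: Leg_mod root_power_mod[OF assms(1)])
  finally show ?thesis .
qed

lemma gauss_sum_squares:
  assumes "\<zeta> ^ p = 1" "\<zeta> \<noteq> 1"
  shows "(\<Sum>j<p. \<zeta> ^ (j\<^sup>2)) = gauss_sum \<zeta>"
  using sum_squares_mod[of "\<lambda>t. \<zeta> ^ t"] sum_root_powers[OF assms, of 1] prime_gt_1_nat[OF p(1)]
  by (simp add: root_power_mod[OF assms(1)] gauss_sum_def distrib_right sum.distrib)

text \<open>One factor is expanded and its Legendre symbols are absorbed into the other by changing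
  the root of unity. After the sums are exchanged, orthogonality leaves only the term t = -1 mod
  p.\<close>

lemma gauss_sum_square:
  assumes "\<zeta> ^ p = 1" "\<zeta> \<noteq> 1"
  shows "gauss_sum \<zeta> * gauss_sum \<zeta> = of_int (Leg (p - 1)) * of_nat p"
proof -
  \<comment> \<open>This includes b divisible by p: both sides are 0 because the Legendre symbols
    sum to 0.\<close>
  have g: "of_int (Leg b) * gauss_sum \<zeta> = gauss_sum (\<zeta> ^ b)" for b
  proof (cases "p dvd b")
    case True
    then have "\<zeta> ^ b = 1" using assms(1) by (auto simp: power_mult)
    then show ?thesis using True Leg_zero_iff[of b] sum_Leg by (simp add: gauss_sum_def)
  qed (simp add: gauss_sum_power[OF assms(1)])
  have "gauss_sum \<zeta> * gauss_sum \<zeta> = (\<Sum>b<p. \<zeta> ^ b * gauss_sum (\<zeta> ^ b))"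
  proof -
    have "gauss_sum \<zeta> * gauss_sum \<zeta> = (\<Sum>b<p. of_int (Leg b) * \<zeta> ^ b) * gauss_sum \<zeta>"
      by (simp only: gauss_sum_def)
    also have "\<dots> = (\<Sum>b<p. \<zeta> ^ b * gauss_sum (\<zeta> ^ b))"
      unfolding sum_distrib_right g[symmetric] by (intro sum.cong refl) (simp only: mult_ac)
    finally show ?thesis .
  qed
  also have "\<dots> = (\<Sum>b<p. \<Sum>t<p. of_int (Leg t) * (\<zeta> ^ (1 + t)) ^ b)"
    unfolding gauss_sum_def sum_distrib_left
    by (intro sum.cong refl) (simp add: power_add power_mult_distrib power_commutes mult_ac flip: power_mult)
  also have "\<dots> = (\<Sum>t<p. of_int (Leg t) * (\<Sum>b<p. (\<zeta> ^ (1 + t)) ^ b))"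
    by (subst sum.swap) (simp only: sum_distrib_left)
  also have "\<dots> = (\<Sum>t<p. if t = p - 1 then of_int (Leg (p - 1)) * of_nat p else 0)"
  proof (rule sum.cong[OF refl])
    fix t assume "t \<in> {..<p}"
    then have "p dvd 1 + t \<longleftrightarrow> t = p - 1" using p by (auto dest: dvd_imp_le)
    then show "of_int (Leg t) * (\<Sum>b<p. (\<zeta> ^ (1 + t)) ^ b)
        = (if t = p - 1 then of_int (Leg (p - 1)) * of_nat p else 0)"
      unfolding sum_root_powers[OF assms] by simp
  qed
  also have "\<dots> = of_int (Leg (p - 1)) * of_nat p" using p by simp
  finally show ?thesis .
qed

lemma sum_over_class:
  assumes "\<zeta> ^ p = 1" "\<zeta> \<noteq> 1" "\<not> p dvd r" "e = 1 \<or> e = -1"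
  shows "(\<Sum>w \<in> {w. w < p \<and> Leg w = e}. \<zeta> ^ (r * w)) = (- 1 + of_int (e * Leg r) * gauss_sum \<zeta>) / 2"
proof -
  have "(\<Sum>w \<in> {w. w < p \<and> Leg w = e}. \<zeta> ^ (r * w)) = (\<Sum>w \<in> {w. w < p \<and> Leg w = e}. (\<zeta> ^ r) ^ w)"
    by (simp add: power_mult)
  also have "\<dots> = (\<Sum>w<p. if Leg w = e then (\<zeta> ^ r) ^ w else 0)"
    by (simp add: sum.If_cases Int_def)
  \<comment> \<open>(1 + e (w/p)) / 2 is the indicator of the class except at w = 0, where it is
    1/2. This correction is the origin of the -1/2 in the eigenvalues.\<close>
  also have "\<dots> = (\<Sum>w<p. (1 + of_int e * of_int (Leg w)) / 2 * (\<zeta> ^ r) ^ w - (if w = 0 then 1 / 2 else 0))"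
  proof (rule sum.cong[OF refl])
    fix w assume w: "w \<in> {..<p}"
    then have "Leg w = 0 \<longleftrightarrow> w = 0" unfolding Leg_zero_iff by (auto dest: dvd_imp_le)
    then show "(if Leg w = e then (\<zeta> ^ r) ^ w else 0)
      = (1 + of_int e * of_int (Leg w)) / 2 * (\<zeta> ^ r) ^ w - (if w = 0 then 1 / 2 else 0)"
      using Legendre_values[of "int w" "int p"] assms(4) by auto
  qed
  also have "\<dots> = ((\<Sum>w<p. (\<zeta> ^ r) ^ w) + of_int e * gauss_sum (\<zeta> ^ r)) / 2 - 1 / 2"
  proof -
    have "(\<Sum>w<p. (if w = 0 then 1 / 2 else 0 :: complex)) = 1 / 2" using p by simp
    moreover have "(\<Sum>w<p. (1 + of_int e * of_int (Leg w)) / 2 * (\<zeta> ^ r) ^ w)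
       = ((\<Sum>w<p. (\<zeta> ^ r) ^ w) + of_int e * gauss_sum (\<zeta> ^ r)) / 2"
      unfolding gauss_sum_def sum_distrib_left sum.distrib[symmetric] sum_divide_distrib
      by (intro sum.cong refl) (simp add: algebra_simps)
    ultimately show ?thesis by (simp only: sum_subtractf)
  qed
  also have "\<dots> = (- 1 + of_int (e * Leg r) * gauss_sum \<zeta>) / 2"
    using sum_root_powers[OF assms(1,2), of r] assms(3) gauss_sum_power[OF assms(1,3)]
    by (simp add: field_simps)
  finally show ?thesis .
qed

end

lemma odd_prime_card: "odd CARD('p::prime_card) \<Longrightarrow> prime CARD('p) \<and> 2 < CARD('p)"
  using prime_card[where 'a='p] p_gt_2[where 'p='p] by blast

section \<open>The Weil index of the additive character\<close>

context
  fixes \<psi> :: "'p::prime_card padic \<Rightarrow> complex"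
  assumes odd: "odd CARD('p)" and \<psi>: "additive_character \<psi>" "additive_conductor_0 \<psi>"
begin

interpretation p_gt: odd_prime "CARD('p)" by standard (use odd_prime_card[OF odd] in auto)

lemma psi_add: "\<psi> (x + y) = \<psi> x * \<psi> y"
  using \<psi>(1) by (simp add: additive_character_def)

lemma psi_Zp: "x \<in> Zp \<Longrightarrow> \<psi> x = 1"
  using \<psi>(2) by (simp add: additive_conductor_0_def)

lemma psi_0: "\<psi> 0 = 1"
  by (simp add: psi_Zp Zp_closed)

lemma psi_cong: "x - y \<in> Zp \<Longrightarrow> \<psi> x = \<psi> y"
  using psi_add[of y "x - y"] psi_Zp[of "x - y"] by simp

lemma psi_nat: "\<psi> (of_nat k * x) = \<psi> x ^ k"
  by (induction k) (auto simp: psi_0 psi_add distrib_right)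

definition psi_root :: complex where "psi_root = \<psi> (1 / \<pp>)"

lemma psi_residue:
  assumes "x \<in> Zp" shows "\<psi> (x / \<pp>) = psi_root ^ nat (residue_p x)"
proof -
  note r = residue_p[OF assms]
  have "x / \<pp> - of_nat (nat (residue_p x)) * (1 / \<pp>) \<in> Zp"
    using r by (simp add: p_ideal_def diff_divide_distrib)
  then show ?thesis unfolding psi_root_def psi_nat[symmetric] by (rule psi_cong)
qed

lemma psi_root_power: "psi_root ^ CARD('p) = 1"
  unfolding psi_root_def psi_nat[symmetric] by (simp add: psi_Zp Zp_closed)

lemma psi_root_ne_1: "psi_root \<noteq> 1"
proof
  assume "psi_root = 1"
  then have "\<psi> (x / \<pp>) = 1" if "x \<in> Zp" for x using psi_residue[OF that] by simp
  then show False using \<psi>(2) by (auto simp: additive_conductor_0_def)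
qed

lemma legendre_p_residue: "p_gt.Leg (nat (residue_p x)) = legendre_p (x :: 'p padic)" if "x \<in> Zp"
  using residue_p(1)[OF that] by (simp add: legendre_p_def)

lemma residue_unit:
  assumes "u \<in> Zp_units" shows "\<not> CARD('p) dvd nat (residue_p (u :: 'p padic))"
  using legendre_p_unit[OF assms] legendre_p_residue[OF Zp_units_in_Zp[OF assms]]
  by (auto simp: p_gt.Leg_zero_iff[symmetric])

lemma psi_unit_root:
  assumes "u \<in> Zp_units"
  shows "\<psi> (u / \<pp>) ^ CARD('p) = 1" "\<psi> (u / \<pp>) \<noteq> 1"
    "p_gt.gauss_sum (\<psi> (u / \<pp>)) = of_int (legendre_p u) * p_gt.gauss_sum psi_root"
proof -
  note u = psi_residue[OF Zp_units_in_Zp[OF assms]] and r = residue_unit[OF assms]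
  show "\<psi> (u / \<pp>) ^ CARD('p) = 1"
    unfolding u by (metis mult.commute power_mult power_one psi_root_power)
  show "\<psi> (u / \<pp>) \<noteq> 1"
    unfolding u by (rule p_gt.root_power_ne_1[OF psi_root_power psi_root_ne_1 r])
  show "p_gt.gauss_sum (\<psi> (u / \<pp>)) = of_int (legendre_p u) * p_gt.gauss_sum psi_root"
    unfolding u p_gt.gauss_sum_power[OF psi_root_power r] legendre_p_residue[OF Zp_units_in_Zp[OF assms]] ..
qed

text \<open>The quadratic Gauss sum modulo p^M. Up to a positive factor it is the integral of
  \<psi>(a x^2) over p^(-m) Z_p, where u is the unit part of a and M = 2m - ord(a).\<close>

definition quad_sum :: "'p padic \<Rightarrow> nat \<Rightarrow> complex"
  where "quad_sum u M = (\<Sum>j<CARD('p) ^ M. \<psi> (u * (of_nat j)\<^sup>2 / \<pp> ^ M))"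

lemma quad_sum_0: "quad_sum u 0 = 1"
  by (simp add: quad_sum_def psi_0)

lemma quad_sum_1:
  assumes "u \<in> Zp_units"
  shows "quad_sum u 1 = of_int (legendre_p u) * p_gt.gauss_sum psi_root"
proof -
  have "quad_sum u 1 = (\<Sum>j<CARD('p). \<psi> (u / \<pp>) ^ (j\<^sup>2))"
    unfolding quad_sum_def psi_nat[symmetric] by (simp add: mult.commute)
  then show ?thesis
    using p_gt.gauss_sum_squares[OF psi_unit_root(1,2)[OF assms]] psi_unit_root(3)[OF assms] by simp
qed

text \<open>In the square of j = i + p^(M+1) l, the term with l^2 contributes an element of Z_p, and
  the cross term gives a root of unity to the power i l. Its sum over l vanishes unless p divides i,
  and the surviving i form the sum of level M.\<close>

lemma quad_sum_step:
  assumes u: "u \<in> Zp_units"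
  shows "quad_sum u (M + 2) = of_nat CARD('p) * quad_sum u M"
proof -
  let ?p = "CARD('p)" and ?q = "CARD('p) ^ (M + 1)"
  let ?\<xi> = "\<psi> (2 * u / \<pp>)"
  have u2: "2 * u \<in> Zp_units" using two_unit[OF odd] u by (rule Zp_units_closed)
  note \<xi> = psi_unit_root(1,2)[OF u2]
  have t: "\<psi> (u * (of_nat (i + ?q * l))\<^sup>2 / \<pp> ^ (M + 2)) = \<psi> (u * (of_nat i)\<^sup>2 / \<pp> ^ (M + 2)) * (?\<xi> ^ i) ^ l" for i l
  proof -
    have "u * (of_nat (i + ?q * l))\<^sup>2 / \<pp> ^ (M + 2)
        - (u * (of_nat i)\<^sup>2 / \<pp> ^ (M + 2) + of_nat (i * l) * (2 * u / \<pp>)) = u * \<pp> ^ M * (of_nat l)\<^sup>2"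
      by (simp add: field_simps power2_eq_square)
    also have "\<dots> \<in> Zp" using u by (intro Zp_closed of_nat_in_Zp Zp_units_in_Zp)
    finally have "\<psi> (u * (of_nat (i + ?q * l))\<^sup>2 / \<pp> ^ (M + 2)) =
        \<psi> (u * (of_nat i)\<^sup>2 / \<pp> ^ (M + 2) + of_nat (i * l) * (2 * u / \<pp>))"
      by (rule psi_cong)
    then show ?thesis unfolding psi_add psi_nat power_mult .
  qed
  have "quad_sum u (M + 2) = (\<Sum>j<?q * ?p. \<psi> (u * (of_nat j)\<^sup>2 / \<pp> ^ (M + 2)))"
    unfolding quad_sum_def by (simp add: mult.commute)
  also have "\<dots> = (\<Sum>l<?p. \<Sum>i<?q. \<psi> (u * (of_nat i)\<^sup>2 / \<pp> ^ (M + 2)) * (?\<xi> ^ i) ^ l)"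
    unfolding sum_lessThan_mult t ..
  also have "\<dots> = (\<Sum>i<?q. \<psi> (u * (of_nat i)\<^sup>2 / \<pp> ^ (M + 2)) * (\<Sum>l<?p. (?\<xi> ^ i) ^ l))"
    by (subst sum.swap) (simp only: sum_distrib_left)
  also have "\<dots> = (\<Sum>i<?p * ?p ^ M. \<psi> (u * (of_nat i)\<^sup>2 / \<pp> ^ (M + 2)) * (if ?p dvd i then of_nat ?p else 0))"
    unfolding p_gt.sum_root_powers[OF \<xi>] by simp
  also have "\<dots> = (\<Sum>l<?p ^ M. \<Sum>i<?p. if i = 0 then of_nat ?p * \<psi> (u * (of_nat l)\<^sup>2 / \<pp> ^ M) else 0)"
    unfolding sum_lessThan_mult
  proof (intro sum.cong refl)
    fix l i assume i: "i \<in> {..<?p}"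
    have "?p dvd i + ?p * l \<longleftrightarrow> i = 0" using i by (auto simp: dvd_add_left_iff dest: dvd_imp_le)
    moreover have "u * (of_nat (?p * l))\<^sup>2 / \<pp> ^ (M + 2) = u * (of_nat l)\<^sup>2 / \<pp> ^ M"
      by (simp add: power_add power2_eq_square)
    ultimately show "\<psi> (u * (of_nat (i + ?p * l))\<^sup>2 / \<pp> ^ (M + 2)) * (if ?p dvd i + ?p * l then of_nat ?p else 0)
      = (if i = 0 then of_nat ?p * \<psi> (u * (of_nat l)\<^sup>2 / \<pp> ^ M) else 0)"
      by (simp only: mult.commute split: if_split) simp
  qed
  also have "\<dots> = of_nat ?p * quad_sum u M"
    using p_gt.p_gt_0 by (simp add: quad_sum_def sum_distrib_left)
  finally show ?thesis .
qed

lemma quad_sum_eq: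
  assumes "u \<in> Zp_units"
  shows "quad_sum u M = of_nat (CARD('p) ^ (M div 2)) * quad_sum u (M mod 2)"
proof (induction M rule: nat_less_induct)
  case (1 M)
  show ?case
  proof (cases "M < 2")
    case False
    define k where "k = M - 2"
    have k: "M = k + 2" using False by (simp add: k_def)
    have "k < M" using k by simp
    then have "quad_sum u k = of_nat (CARD('p) ^ (k div 2)) * quad_sum u (k mod 2)" using 1 by blast
    then show ?thesis unfolding k quad_sum_step[OF assms] by simp
  qed simp
qed

lemma sgn_quad_sum:
  assumes "u \<in> Zp_units"
  shows "sgn (quad_sum u M) = (if odd M then of_int (legendre_p u) * sgn (p_gt.gauss_sum psi_root) else 1)"
proof -
  have "sgn (of_nat (CARD('p) ^ (M div 2)) :: complex) = 1"
    using sgn_of_real[of "real (CARD('p) ^ (M div 2))", where 'a=complex] p_gt.p_gt_0 by simp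
  then have "sgn (quad_sum u M) = sgn (quad_sum u (M mod 2))"
    using quad_sum_eq[OF assms, of M] by (simp only: sgn_mult mult_1)
  also have "\<dots> = (if odd M then of_int (legendre_p u) * sgn (p_gt.gauss_sum psi_root) else 1)"
    using quad_sum_0 quad_sum_1[OF assms] legendre_p_unit[OF assms]
    by (cases "odd M") (auto simp: sgn_mult sgn_minus odd_iff_mod_2_eq_one even_iff_mod_2_eq_zero)
  finally show ?thesis .
qed

text \<open>The summand has period p^M in j, where M = 2m - k, so the Riemann sums are constant from
  N = M on. The positive constant disappears in the phase taken by
  \<open>weil_index\<close>.\<close>

lemma ball_integral_psi:
  assumes u: "u \<in> Zp_units" and k: "k \<le> 2 * int m"
  shows "\<exists>c > 0. ball_integral m (\<lambda>x. \<psi> (\<pp> powi k * u * x\<^sup>2)) = of_real c * quad_sum u (nat (2 * int m - k))"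
proof -
  let ?M = "nat (2 * int m - k)" and ?p = "CARD('p)"
  have e: "\<pp> powi k * u * (of_nat j / \<pp> ^ m)\<^sup>2 = u * (of_nat j)\<^sup>2 / \<pp> ^ ?M" for j
  proof -
    have "(\<pp> ^ m)\<^sup>2 = (\<pp> :: 'p padic) powi int (m * 2)"
      by (simp only: power_int_of_nat power_mult)
    then have "\<pp> powi k / (\<pp> ^ m)\<^sup>2 = (\<pp> :: 'p padic) powi (k - int (m * 2))"
      by (simp only: power_int_diff[OF disjI1[OF p_nonzero(1)]])
    also have "k - int (m * 2) = - int ?M" using k by simp
    also have "\<pp> powi (- int ?M) = 1 / (\<pp> :: 'p padic) ^ ?M"
      by (simp only: power_int_minus power_int_of_nat inverse_eq_divide)
    finally have "\<pp> powi k / (\<pp> ^ m)\<^sup>2 * (u * (of_nat j)\<^sup>2) = 1 / \<pp> ^ ?M * (u * (of_nat j)\<^sup>2)" by simp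
    then show ?thesis by (simp add: power_divide mult_ac)
  qed
  have per: "\<psi> (u * (of_nat (i + ?p ^ ?M * l))\<^sup>2 / \<pp> ^ ?M) = \<psi> (u * (of_nat i)\<^sup>2 / \<pp> ^ ?M)" for i l
  proof (rule psi_cong)
    have "u * (of_nat (i + ?p ^ ?M * l))\<^sup>2 / \<pp> ^ ?M - u * (of_nat i)\<^sup>2 / \<pp> ^ ?M
      = u * (2 * of_nat i * of_nat l + \<pp> ^ ?M * (of_nat l)\<^sup>2)"
      by (simp add: field_simps power2_eq_square)
    also have "\<dots> \<in> Zp"
      using u two_unit[OF odd] by (intro Zp_closed of_nat_in_Zp Zp_units_in_Zp)
    finally show "u * (of_nat (i + ?p ^ ?M * l))\<^sup>2 / \<pp> ^ ?M - u * (of_nat i)\<^sup>2 / \<pp> ^ ?M \<in> Zp" .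
  qed
  define c where "c = real ?p ^ m / real ?p ^ ?M"
  have "(\<Sum>j<?p ^ (m + N). \<psi> (\<pp> powi k * u * (of_nat j / \<pp> ^ m)\<^sup>2)) / of_nat (?p ^ N) = of_real c * quad_sum u ?M"
    if N: "N \<ge> ?M" for N
  proof -
    have q: "?p ^ (m + N) = ?p ^ ?M * ?p ^ (m + N - ?M)" using N by (simp flip: power_add)
    have "(\<Sum>j<?p ^ (m + N). \<psi> (\<pp> powi k * u * (of_nat j / \<pp> ^ m)\<^sup>2)) =
        (\<Sum>j<?p ^ ?M * ?p ^ (m + N - ?M). \<psi> (u * (of_nat j)\<^sup>2 / \<pp> ^ ?M))"
      unfolding e q ..
    also have "\<dots> = of_nat (?p ^ (m + N - ?M)) * quad_sum u ?M"
      unfolding sum_lessThan_mult per by (simp add: quad_sum_def)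
    finally have "(\<Sum>j<?p ^ (m + N). \<psi> (\<pp> powi k * u * (of_nat j / \<pp> ^ m)\<^sup>2)) = of_nat (?p ^ (m + N - ?M)) * quad_sum u ?M" .
    moreover have "of_nat (?p ^ (m + N - ?M)) / of_nat (?p ^ N) = (of_real c :: complex)"
    proof -
      have "real (?p ^ m * ?p ^ N) = real (?p ^ ?M * ?p ^ (m + N - ?M))" unfolding q[symmetric] power_add ..
      then have "real (?p ^ (m + N - ?M)) / real (?p ^ N) = c"
        using p_gt.p_gt_0 by (simp add: c_def frac_eq_eq mult.commute)
      then have "of_real (real (?p ^ (m + N - ?M)) / real (?p ^ N)) = (of_real c :: complex)" by (rule arg_cong)
      then show ?thesis by (simp only: of_real_divide of_real_of_nat_eq)
    qed
    ultimately show ?thesis by (simp only: times_divide_eq_left[symmetric])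
  qed
  then have "(\<lambda>N. (\<Sum>j<?p ^ (m + N). \<psi> (\<pp> powi k * u * (of_nat j / \<pp> ^ m)\<^sup>2)) / of_nat (?p ^ N))
      \<longlonglongrightarrow> of_real c * quad_sum u ?M"
    by (intro tendsto_eventually) (auto simp: eventually_sequentially)
  then have "ball_integral m (\<lambda>x. \<psi> (\<pp> powi k * u * x\<^sup>2)) = of_real c * quad_sum u ?M"
    unfolding ball_integral_def by (rule limI)
  moreover have "c > 0" using p_gt.p_gt_0 by (simp add: c_def)
  ultimately show ?thesis by blast
qed

text \<open>From m >= ord(a) on the phase is constant: M = 2m - ord(a) keeps the parity of ord(a),
  and raising M by 2 multiplies the Gauss sum by p.\<close>

lemma weil_index_psi:
  assumes a: "a \<noteq> 0"
  shows "weil_index (\<lambda>x. \<psi> (a * x)) =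
    (if odd (padic_ord a) then of_int (unit_char a) * sgn (p_gt.gauss_sum psi_root) else 1)"
proof -
  let ?u = "unit_part a" and ?k = "padic_ord a"
  note u = unit_part_unit[OF a]
  have "sgn (ball_integral m (\<lambda>x. \<psi> (a * x\<^sup>2))) =
      (if odd ?k then of_int (unit_char a) * sgn (p_gt.gauss_sum psi_root) else 1)" if m: "m \<ge> nat ?k" for m
  proof -
    have k: "?k \<le> 2 * int m" using m by linarith
    obtain c :: real where c: "c > 0" "ball_integral m (\<lambda>x. \<psi> (a * x\<^sup>2)) = of_real c * quad_sum ?u (nat (2 * int m - ?k))"
      using ball_integral_psi[OF u k] unit_part_decomp[of a] by auto
    have "sgn (of_real c :: complex) = 1" using c(1) sgn_of_real[of c, where 'a=complex] by simp
    moreover have "odd (nat (2 * int m - ?k)) \<longleftrightarrow> odd ?k" using k by (simp add: even_nat_iff)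
    ultimately show ?thesis by (simp add: c(2) sgn_mult sgn_quad_sum[OF u] unit_char_def)
  qed
  then have "(\<lambda>m. sgn (ball_integral m (\<lambda>x. \<psi> (a * x\<^sup>2)))) \<longlonglongrightarrow>
      (if odd ?k then of_int (unit_char a) * sgn (p_gt.gauss_sum psi_root) else 1)"
    by (intro tendsto_eventually eventually_sequentiallyI[of "nat ?k"])
  then show ?thesis unfolding weil_index_def by (rule limI)
qed

lemma weil_ratio_eq:
  assumes a: "a \<noteq> 0"
  shows "weil_ratio a \<psi> = (if odd (padic_ord a) then of_int (unit_char a) * sgn (p_gt.gauss_sum psi_root) else 1)"
  using weil_index_psi[OF a] weil_index_psi[of 1] by (simp add: weil_ratio_def)

lemma legendre_minus_1: "p_gt.Leg (CARD('p) - 1) = legendre_p (-1 :: 'p padic)"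
proof -
  have "[int (CARD('p) - 1) = -1] (mod int CARD('p))"
    using p_gt.p_gt_0 by (simp add: of_nat_diff cong_iff_dvd_diff)
  then have "p_gt.Leg (CARD('p) - 1) = Legendre (-1) (int CARD('p))" by (rule Legendre_cong)
  then show ?thesis using legendre_p_of_int[of "-1", where 'p='p] by simp
qed

lemma gauss_psi_square:
  "p_gt.gauss_sum psi_root * p_gt.gauss_sum psi_root = of_int (legendre_p (-1 :: 'p padic)) * of_nat CARD('p)"
  unfolding p_gt.gauss_sum_square[OF psi_root_power psi_root_ne_1] legendre_minus_1 ..

lemma norm_gauss_psi: "norm (p_gt.gauss_sum psi_root) = sqrt (real CARD('p))"
proof -
  have "norm (p_gt.gauss_sum psi_root) * norm (p_gt.gauss_sum psi_root) = real CARD('p)"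
    unfolding norm_mult[symmetric] gauss_psi_square
    using legendre_p_unit[OF Zp_units_closed(2)[where 'p='p]] by (auto simp: norm_mult)
  then show ?thesis by (metis norm_ge_zero real_sqrt_abs2 abs_of_nonneg)
qed

lemma sgn_gauss_psi_square:
  "sgn (p_gt.gauss_sum psi_root) * sgn (p_gt.gauss_sum psi_root) = of_int (legendre_p (-1 :: 'p padic))"
proof -
  have "sgn (p_gt.gauss_sum psi_root) * sgn (p_gt.gauss_sum psi_root) =
      p_gt.gauss_sum psi_root * p_gt.gauss_sum psi_root / of_real (norm (p_gt.gauss_sum psi_root) * norm (p_gt.gauss_sum psi_root))"
    by (simp add: sgn_eq)
  also have "\<dots> = of_int (legendre_p (-1 :: 'p padic))"
    unfolding gauss_psi_square norm_gauss_psi using p_gt.p_gt_0 by simp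
  finally show ?thesis .
qed

text \<open>When both valuations are odd, the square of the phase is the Legendre symbol of -1,
  which is the extra factor of the tame symbol.\<close>

lemma weil_ratio_mult:
  assumes "a \<noteq> 0" "b \<noteq> 0"
  shows "weil_ratio a \<psi> * weil_ratio b \<psi> = of_int (hil a b) * weil_ratio (a * b) \<psi>"
proof -
  let ?\<epsilon> = "sgn (p_gt.gauss_sum psi_root)"
  have 1: "unit_char (-1 :: 'p padic) = legendre_p (-1 :: 'p padic)"
    by (rule unit_char_unit[OF Zp_units_closed(2)])
  have "?\<epsilon> * (?\<epsilon> * z) = of_int (legendre_p (-1 :: 'p padic)) * z" for z
    using sgn_gauss_psi_square by (metis mult.assoc)
  moreover have "unit_char a * unit_char a = 1" "unit_char b * unit_char b = 1"
    using unit_char_values[OF assms(1)] unit_char_values[OF assms(2)] by auto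
  then have "complex_of_int (unit_char a) * (of_int (unit_char a) * z) = z"
    "complex_of_int (unit_char b) * (of_int (unit_char b) * z) = z"
    "complex_of_int (unit_char a) * of_int (unit_char a) = 1"
    "complex_of_int (unit_char b) * of_int (unit_char b) = 1" for z
    by (simp_all add: mult.assoc[symmetric] flip: of_int_mult)
  ultimately show ?thesis
    using assms by (auto simp: weil_ratio_eq hilbert_formula[OF odd] padic_ord_mult unit_char_mult[OF odd] 1
        sgn_gauss_psi_square mult_ac)
qed

lemma weil_ratio_unit: "u \<in> Zp_units \<Longrightarrow> weil_ratio u \<psi> = 1"
  by (simp add: weil_ratio_eq Zp_units_ord)

text \<open>\<gamma>(p, \<psi>) is the phase of the Gauss sum and sqrt p its absolute value, so the
  prescribed root is the Gauss sum itself.\<close>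

lemma sqrt_p_star_gauss: "sqrt_p_star \<psi> = p_gt.gauss_sum psi_root"
proof -
  have "unit_part \<pp> = (1 :: 'p padic)" by (simp add: unit_part_def)
  then have "unit_char (\<pp> :: 'p padic) = legendre_p (1\<^sup>2 :: 'p padic)" by (simp add: unit_char_def)
  also have "\<dots> = 1" by (rule legendre_p_squares[OF odd Zp_units_closed(1)])
  finally have "weil_ratio \<pp> \<psi> = sgn (p_gt.gauss_sum psi_root)" by (simp add: weil_ratio_eq)
  then show ?thesis unfolding sqrt_p_star_def norm_gauss_psi[symmetric]
    by (simp add: sgn_eq)
qed

end

section \<open>The principal series\<close>

lemma adj2_y_mat: "adj2 (y_mat s) = y_mat (- s)"
  by (rule mat2_eqI) (simp_all add: y_mat_def)

lemma y_mat_entries [simp]: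
  "y_mat s $ 1 $ 1 = 1" "y_mat s $ 1 $ 2 = 0" "y_mat s $ 2 $ 1 = s" "y_mat s $ 2 $ 2 = 1"
  by (simp_all add: y_mat_def)

lemma y_mat_K0: "s \<in> p_ideal m \<Longrightarrow> y_mat s \<in> K0 m"
  by (simp add: K0_iff SL2_iff Zp_closed)

lemma y_mat_add: "y_mat s ** y_mat t = y_mat (s + t)"
  by (rule mat2_eqI) (simp_all add: mat2_mult_entries)

definition diag :: "'p::prime_card padic \<Rightarrow> 'p mat2" where "diag a = mat2 a 0 0 (1 / a)"

lemma diag_K0: "a \<in> Zp_units \<Longrightarrow> diag a \<in> K0 m"
  using Zp_units_nonzero[of a] Zp_units_closed(4)[of a]
  by (simp add: diag_def K0_iff SL2_iff Zp_closed p_ideal_closed Zp_units_in_Zp inverse_eq_divide)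

lemma diag_conj: "a \<noteq> 0 \<Longrightarrow> diag (1 / a) ** y_mat s ** diag a = y_mat (a\<^sup>2 * s)"
  by (rule mat2_eqI) (simp_all add: mat2_mult_entries diag_def power2_eq_square)

definition lower :: "'p::prime_card padic \<Rightarrow> 'p mp" where "lower s = (y_mat s, 1)"

definition torus :: "'p::prime_card padic \<Rightarrow> 'p mp" where "torus a = (diag a, 1)"

lemma lower_in: "s \<in> p_ideal m \<Longrightarrow> lower s \<in> full_preimage (K0 m)"
  by (simp add: lower_def full_preimage_iff y_mat_K0)

lemma torus_in: "a \<in> Zp_units \<Longrightarrow> torus a \<in> full_preimage (K0 m)"
  by (simp add: torus_def full_preimage_iff diag_K0)

lemma torus_Borel: "a \<in> Zp_units \<Longrightarrow> torus a \<in> Borel"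
  using diag_K0[of a 0] K0_subset_SL2 by (auto simp: torus_def Borel_iff diag_def)

lemma full_preimage_K0_mono: "x \<in> full_preimage (K0 m) \<Longrightarrow> k \<le> m \<Longrightarrow> x \<in> full_preimage (K0 k)"
  by (auto simp: full_preimage_iff intro: K0_mono)

lemma lower_add:
  assumes odd: "odd CARD('p)" and "s \<in> p_ideal 1" "t \<in> (p_ideal 1 :: 'p::prime_card padic set)"
  shows "lower s \<odot> lower t = lower (s + t)"
  using K0_mp_mult[OF odd lower_in[OF assms(2)] lower_in[OF assms(3)]] by (simp add: lower_def y_mat_add)

lemma lower_0: "lower 0 = mp_one"
  by (auto simp: lower_def mp_one_def intro!: mat2_eqI)

lemma torus_conj:
  assumes odd: "odd CARD('p)" and s: "s \<in> p_ideal 1" and a: "a \<in> (Zp_units :: 'p::prime_card padic set)"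
  shows "torus (1 / a) \<odot> lower s \<odot> torus a = lower (a\<^sup>2 * s)"
proof -
  have a': "1 / a \<in> Zp_units" using a Zp_units_closed(1,5) by blast
  have K1: "torus (1 / a) \<odot> lower s \<in> full_preimage (K0 1)"
    by (intro mp_subgroupD(3)[OF K0_subgroup] torus_in lower_in a' s)
  show ?thesis
    using K0_mp_mult[OF odd K1 torus_in[OF a]] K0_mp_mult[OF odd torus_in[OF a'] lower_in[OF s]]
      diag_conj[OF Zp_units_nonzero[OF a], of s]
    by (simp add: torus_def lower_def)
qed

text \<open>On the Borel subgroup \<open>s_p\<close> is 1 and \<tau> is the lower right entry, which
  is multiplicative. Passing to the upper left entries inverts both arguments and changes nothing
  modulo squares.\<close>

lemma Borel_cocycle:
  assumes odd: "odd CARD('p)" and "A \<in> SL2" "A $ 2 $ 1 = 0" "B \<in> SL2" "(B :: 'p::prime_card mat2) $ 2 $ 1 = 0"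
  shows "cocycle A B = hil (A $ 1 $ 1) (B $ 1 $ 1)"
proof -
  note A = SL2_Borel[OF assms(2,3)] and B = SL2_Borel[OF assms(4,5)]
  have "cocycle A B = hil ((A $ 2 $ 2)\<^sup>2 * B $ 2 $ 2) ((B $ 2 $ 2)\<^sup>2 * A $ 2 $ 2)"
    using assms A B by (simp add: cocycle_def \<tau>_def s_p_def mat2_mult_entries power2_eq_square mult_ac)
  also have "\<dots> = hil (A $ 2 $ 2) (B $ 2 $ 2)"
    using A B by (simp add: hilbert_square_left hilbert_square_right hilbert_commute)
  also have "\<dots> = hil (1 / A $ 2 $ 2) (1 / B $ 2 $ 2)"
    using A B hilbert_square_left[of "1 / A $ 2 $ 2" "A $ 2 $ 2"] hilbert_square_right[of "1 / B $ 2 $ 2" _ "B $ 2 $ 2"]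
    by (simp add: power2_eq_square)
  finally show ?thesis using A B by simp
qed

section \<open>The functions supported on a single cell\<close>

locale ramified_data =
  fixes \<psi> \<mu> \<eta> :: "'p::prime_card padic \<Rightarrow> complex" and n :: nat
  assumes odd: "odd CARD('p)" and \<psi>: "additive_character \<psi>" "additive_conductor_0 \<psi>"
    and \<mu>: "mult_character \<mu>" "conductor_exponent \<mu> n" and n: "n > 1"
    and \<eta>: "quadratic_char \<eta>" and \<mu>\<eta>: "\<mu> (-1) = \<eta> (-1)"
begin

abbreviation K :: "'p mp set" where "K \<equiv> full_preimage (K0 (2 * n))"

abbreviation K1 :: "'p mp set" where "K1 \<equiv> full_preimage (K0 1)"

abbreviation gen :: "'p mp \<Rightarrow> complex" where "gen \<equiv> genuine \<eta>"

abbreviation muB :: "'p mp \<Rightarrow> complex" where "muB \<equiv> \<mu>_B \<psi> \<mu>"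

lemma mu_mult: "x \<noteq> 0 \<Longrightarrow> y \<noteq> 0 \<Longrightarrow> \<mu> (x * y) = \<mu> x * \<mu> y"
  using \<mu>(1) by (simp add: mult_character_def)

lemma mu_nonzero: "x \<noteq> 0 \<Longrightarrow> \<mu> x \<noteq> 0"
  using \<mu>(1) by (simp add: mult_character_def)

lemma mu_1: "\<mu> 1 = 1"
  using mu_mult[of 1 1] mu_nonzero[of 1] by simp

lemma mu_inverse: "x \<noteq> 0 \<Longrightarrow> \<mu> (1 / x) = inverse (\<mu> x)"
  using mu_mult[of x "1 / x"] mu_nonzero[of x] by (simp add: mu_1 field_simps)

lemma mu_cong:
  assumes u: "u \<in> Zp_units" and "v - u \<in> p_ideal n"
  shows "\<mu> v = \<mu> u"
proof -
  note u0 = Zp_units_nonzero[OF u]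
  have "v \<in> Zp_units" using Zp_units_cong[OF u] p_ideal_mono[OF assms(2)] n by simp
  then have v0: "v \<noteq> 0" by (rule Zp_units_nonzero)
  have "inverse u * (v - u) \<in> p_ideal n" using assms Zp_units_closed(4) p_ideal_unit_mult by blast
  then obtain z where z: "z \<in> Zp" "inverse u * (v - u) = \<pp> ^ n * z" using p_ideal_iff by blast
  have "v / u = 1 + \<pp> ^ n * z" unfolding z(2)[symmetric] using u0 by (simp add: field_simps)
  then have "v / u \<in> unit_subgroup n" using n z(1) by (auto simp: unit_subgroup_def)
  then have "\<mu> (v / u) = 1" using \<mu>(2) by (simp add: conductor_exponent_def)
  then show ?thesis using mu_mult[of "v / u" u] u0 v0 by simp
qed

text \<open>The sign (a, a') of the cover cancels against the one by which the Weil index fails to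
  be multiplicative.\<close>

lemma muB_mult:
  assumes b: "b \<in> Borel" and b': "b' \<in> Borel"
  shows "muB (b \<odot> b') = muB b * muB b'"
proof -
  let ?a = "fst b $ 1 $ 1" and ?a' = "fst b' $ 1 $ 1"
  have B: "fst b \<in> SL2" "fst b $ 2 $ 1 = 0" "fst b' \<in> SL2" "fst b' $ 2 $ 1 = 0"
    using b b' by (auto simp: Borel_iff)
  have nz: "?a \<noteq> 0" "?a' \<noteq> 0" using B by (auto simp: SL2_iff)
  have "hil ?a ?a' * hil ?a ?a' = 1" by simp
  then have h: "complex_of_int (hil ?a ?a') * of_int (hil ?a ?a') = 1" by (simp flip: of_int_mult)
  have w: "inverse (weil_ratio ?a \<psi>) * inverse (weil_ratio ?a' \<psi>) = of_int (hil ?a ?a') * inverse (weil_ratio (?a * ?a') \<psi>)"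
    using arg_cong[OF weil_ratio_mult[OF odd \<psi> nz], of inverse] inverse_unique[OF h] by simp
  have "(fst b ** fst b') $ 1 $ 1 = ?a * ?a'" using B by (simp add: mat2_mult_entries)
  then have "muB (b \<odot> b') = of_int (snd b) * of_int (snd b') * (of_real (padic_abs ?a) * of_real (padic_abs ?a')) *
      (\<mu> ?a * \<mu> ?a') * (of_int (hil ?a ?a') * inverse (weil_ratio (?a * ?a') \<psi>))"
    using mu_mult[OF nz] Borel_cocycle[OF odd B] by (simp add: \<mu>_B_def mp_mult_def padic_abs_mult)
  then show ?thesis unfolding w[symmetric] by (simp add: \<mu>_B_def Let_def)
qed

lemma muB_unit:
  assumes "fst b $ 1 $ 1 \<in> Zp_units" shows "muB b = of_int (snd b) * \<mu> (fst b $ 1 $ 1)"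
  using assms weil_ratio_unit[OF odd \<psi> assms] by (simp add: \<mu>_B_def Zp_units_def)

lemma K_sub: "mp_subgroup K" and K1_sub: "mp_subgroup K1"
  by (rule K0_subgroup)+

lemma K_K1: "x \<in> K \<Longrightarrow> x \<in> K1"
  using full_preimage_K0_mono[of x "2 * n" 1] n by simp

lemma Mp_I: "x \<in> Borel \<Longrightarrow> x \<in> Mp" "x \<in> K \<Longrightarrow> x \<in> Mp" "x \<in> K1 \<Longrightarrow> x \<in> Mp"
  using mp_subgroupD(1)[OF Borel_subgroup] mp_subgroupD(1)[OF K_sub] mp_subgroupD(1)[OF K1_sub] by blast+

lemmas gen_mult = genuine_mult[OF odd \<eta> _ _ order_refl]

lemma eta_1: "\<eta> 1 = 1"
  by (rule quadratic_char_one[OF odd \<eta>])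

lemma gen_K1_values: "x \<in> K1 \<Longrightarrow> gen x \<in> {1, -1}"
  by (rule genuine_values[OF \<eta> _ order_refl])

lemma gen_K1_square: "x \<in> K1 \<Longrightarrow> gen x * gen x = 1"
  using gen_K1_values[of x] by auto

lemma gen_lower: "gen (lower s) = 1"
  by (simp add: genuine_def lower_def eta_1)

lemma gen_one: "gen mp_one = 1"
  by (simp add: genuine_def mp_one_def eta_1)

lemma assoc: "(x :: 'p mp) \<in> Mp \<Longrightarrow> y \<in> Mp \<Longrightarrow> z \<in> Mp \<Longrightarrow> x \<odot> y \<odot> z = x \<odot> (y \<odot> z)"
  by (rule mp_assoc[OF odd])

text \<open>This makes \<open>f_cell\<close> well defined. Comparing entries gives d = a mod p^n for
  the diagonal of b, and a d = 1 forces a to be 1 or -1 mod p^n. The lower right entry of k has the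
  same residue, so the values agree trivially in one case and by \<open>\<mu>\<eta>\<close> in the
  other.\<close>

lemma cell_stabilizer:
  assumes \<kappa>: "\<kappa> \<in> Zp_units" and b: "b \<in> Borel" and k: "k \<in> K"
    and eq: "b \<odot> lower (\<kappa> * \<pp> ^ n) = lower (\<kappa> * \<pp> ^ n) \<odot> k"
  shows "muB b = gen k"
proof -
  let ?s = "\<kappa> * \<pp> ^ n"
  let ?A = "fst k $ 1 $ 1" and ?B = "fst k $ 1 $ 2" and ?C = "fst k $ 2 $ 1" and ?E = "fst k $ 2 $ 2"
  let ?a = "fst b $ 1 $ 1" and ?d = "fst b $ 2 $ 2"
  have s: "?s \<in> p_ideal n" using \<kappa> by (intro p_power_in_p_ideal Zp_units_in_Zp)
  then have s1: "?s \<in> p_ideal 1" using n by (auto intro: p_ideal_mono)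
  have kK: "fst k \<in> K0 (2 * n)" using k by (simp add: full_preimage_iff)
  have bB: "fst b \<in> SL2" "fst b $ 2 $ 1 = 0" "snd b \<in> {1, -1}" using b by (auto simp: Borel_iff)
  have m: "fst b ** y_mat ?s = y_mat ?s ** fst k"
    using arg_cong[OF eq, of fst] by (simp add: mp_mult_def lower_def)
  have e1: "?a + fst b $ 1 $ 2 * ?s = ?A" using arg_cong[OF m, of "\<lambda>M. M $ 1 $ 1"] by (simp add: mat2_mult_entries)
  have e2: "fst b $ 1 $ 2 = ?B" using arg_cong[OF m, of "\<lambda>M. M $ 1 $ 2"] by (simp add: mat2_mult_entries)
  have e3: "?d * ?s = ?s * ?A + ?C" using arg_cong[OF m, of "\<lambda>M. M $ 2 $ 1"] bB by (simp add: mat2_mult_entries)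
  have e4: "?d = ?s * ?B + ?E" using arg_cong[OF m, of "\<lambda>M. M $ 2 $ 2"] bB by (simp add: mat2_mult_entries)
  have kent: "?A \<in> Zp" "?B \<in> Zp" "?E \<in> Zp" "?C \<in> p_ideal (2 * n)" using kK by (auto simp: K0_iff)
  have Bs: "?B * ?s \<in> p_ideal n" by (rule p_ideal_mult_Zp[OF s kent(2)])
  have aZ: "?a \<in> Zp" using e1 e2 kent Bs p_ideal_subset_Zp Zp_closed(4)[of ?A "?B * ?s"]
    by (metis add_diff_cancel_right')
  have dZ: "?d \<in> Zp" using e4 kent Bs p_ideal_subset_Zp by (metis Zp_closed(3) mult.commute)
  have ad: "?a * ?d = 1" using bB by (simp add: SL2_iff)
  have bK1: "b \<in> K1" using bB aZ dZ kent(2) e2 by (simp add: full_preimage_iff K0_iff p_ideal_closed)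
  have sign: "snd b = snd k"
    using eq K0_mp_mult[OF odd bK1 lower_in[OF s1]] K0_mp_mult[OF odd lower_in[OF s1] K_K1[OF k]]
    by (simp add: lower_def)
  have au: "?a \<in> Zp_units" using unit_of_product[OF aZ dZ] ad Zp_units_closed(1) by simp
  \<comment> \<open>Cancelling the n powers of p in \<open>?s\<close> leaves a congruence mod p^n,
    the precision at which \<mu> is determined on units.\<close>
  have "?s * (?d - ?A) \<in> p_ideal (2 * n)" using e3 kent(4) by (simp add: algebra_simps)
  then have "\<kappa> * (\<pp> ^ n * (?d - ?A)) \<in> p_ideal (n + n)" by (simp add: mult.assoc mult_2)
  then have "?d - ?A \<in> p_ideal n"
    unfolding p_ideal_unit_mult[OF \<kappa>] p_ideal_Suc_mult .
  then have "?d - ?a \<in> p_ideal n"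
    using p_ideal_closed(2)[OF _ Bs, of "?d - ?A"] unfolding e1[symmetric] e2 by simp
  then have "?a * (?d - ?a) \<in> p_ideal n" using aZ p_ideal_mult_Zp by blast
  moreover have "?a * (?d - ?a) = - ((?a - 1) * (?a + 1))" using ad by (simp add: algebra_simps)
  ultimately have pr: "(?a - 1) * (?a + 1) \<in> p_ideal n" using p_ideal_closed(4) by fastforce
  \<comment> \<open>The two factors differ by the unit 2, so one of them is a unit and the other
    takes all n powers of p.\<close>
  have cases: "?a - 1 \<in> p_ideal n \<or> ?a - (-1) \<in> p_ideal n"
  proof (cases "?a - 1 \<in> p_ideal 1")
    case True
    have "(?a + 1) - 2 \<in> p_ideal 1" using True by simp
    then have "?a + 1 \<in> Zp_units" using Zp_units_cong[OF two_unit[OF odd]] by blast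
    then have "?a - 1 \<in> p_ideal n" using pr p_ideal_unit_mult[of "?a + 1" "?a - 1" n] by (simp add: mult.commute)
    then show ?thesis ..
  next
    case False
    then have "?a - 1 \<in> Zp_units" using Zp_cases[of "?a - 1"] aZ Zp_closed by blast
    then have "?a + 1 \<in> p_ideal n" using pr p_ideal_unit_mult by blast
    then show ?thesis by simp
  qed
  have Ea: "?E - c \<in> p_ideal 1" if c: "?a - c \<in> p_ideal n" for c
  proof -
    have "?E - c = (?d - ?a) + (?a - c) - ?B * ?s" using e4 by (simp add: algebra_simps)
    then have "?E - c \<in> p_ideal n"
      using p_ideal_closed(3)[OF p_ideal_closed(2)[OF \<open>?d - ?a \<in> p_ideal n\<close> c] Bs] by (simp only:)
    then show ?thesis using n by (auto intro: p_ideal_mono)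
  qed
  have "\<mu> ?a = \<eta> ?E"
    using cases
  proof
    assume "?a - 1 \<in> p_ideal n"
    then show ?thesis
      using mu_cong[OF Zp_units_closed(1)] quadratic_char_cong[OF \<eta> Zp_units_closed(1) Ea] mu_1 eta_1 by simp
  next
    assume "?a - (-1) \<in> p_ideal n"
    then show ?thesis
      using mu_cong[OF Zp_units_closed(2)] quadratic_char_cong[OF \<eta> Zp_units_closed(2) Ea] \<mu>\<eta> by simp
  qed
  then show ?thesis using sign by (simp add: muB_unit[OF au] genuine_def)
qed

definition cell :: "'p padic \<Rightarrow> 'p mp set"
  where "cell \<kappa> = {b \<odot> lower (\<kappa> * \<pp> ^ n) \<odot> k |b k. b \<in> Borel \<and> k \<in> K}"

lemma cell_lower_in:
  assumes "\<kappa> \<in> Zp_units" shows "\<kappa> * \<pp> ^ n \<in> p_ideal 1" "lower (\<kappa> * \<pp> ^ n) \<in> K1" "lower (\<kappa> * \<pp> ^ n) \<in> Mp"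
proof -
  show 1: "\<kappa> * \<pp> ^ n \<in> p_ideal 1"
    using p_power_in_p_ideal(2)[OF Zp_units_in_Zp[OF assms], of n] n by (auto intro: p_ideal_mono)
  show "lower (\<kappa> * \<pp> ^ n) \<in> K1" "lower (\<kappa> * \<pp> ^ n) \<in> Mp" using lower_in[OF 1] Mp_I by auto
qed

text \<open>Two decompositions of one point differ by a Borel element and an element of K that are
  conjugate under y(\<kappa>p^n), which is the situation of \<open>cell_stabilizer\<close>.\<close>

lemma cell_value_unique:
  assumes \<kappa>: "\<kappa> \<in> Zp_units" and b: "b \<in> Borel" "b' \<in> Borel" and k: "k \<in> K" "k' \<in> K"
    and eq: "b \<odot> lower (\<kappa> * \<pp> ^ n) \<odot> k = b' \<odot> lower (\<kappa> * \<pp> ^ n) \<odot> k'"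
  shows "muB b * gen k = muB b' * gen k'"
proof -
  let ?Y = "lower (\<kappa> * \<pp> ^ n)"
  note M = Mp_I(1)[OF b(1)] Mp_I(1)[OF b(2)] Mp_I(2)[OF k(1)] Mp_I(2)[OF k(2)] cell_lower_in(3)[OF \<kappa>]
  note Mi = M[THEN Mp_closed(3)]
  define \<beta> where "\<beta> = mp_inv b' \<odot> b"
  define l where "l = k' \<odot> mp_inv k"
  have \<beta>: "\<beta> \<in> Borel" unfolding \<beta>_def by (intro mp_subgroupD[OF Borel_subgroup] b)
  have l: "l \<in> K" unfolding l_def by (intro mp_subgroupD[OF K_sub] k)
  have "\<beta> \<odot> ?Y = mp_inv b' \<odot> (b \<odot> ?Y \<odot> k \<odot> mp_inv k)"
    unfolding \<beta>_def using M Mi by (simp add: assoc Mp_closed mp_cancel[OF odd] mp_inv_mult)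
  also have "\<dots> = ?Y \<odot> l"
    unfolding eq l_def using M Mi by (simp add: assoc Mp_closed mp_cancel[OF odd])
  finally have "muB \<beta> = gen l" using cell_stabilizer[OF \<kappa> \<beta> l] by blast
  moreover have "muB b = muB b' * muB \<beta>"
    using muB_mult[OF b(2) \<beta>] M by (simp add: \<beta>_def mp_cancel[OF odd])
  moreover have "gen k' = gen l * gen k"
    using gen_mult[OF K_K1[OF l] K_K1[OF k(1)]] M by (simp add: l_def mp_cancel[OF odd])
  ultimately show ?thesis using gen_K1_square[OF K_K1[OF l]] by (simp add: mult_ac)
qed

abbreviation fc :: "'p padic \<Rightarrow> 'p mp \<Rightarrow> complex" where "fc \<kappa> \<equiv> f_cell \<psi> \<mu> \<eta> n \<kappa>"

lemma f_cell_values: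
  assumes \<kappa>: "\<kappa> \<in> Zp_units"
  shows "b \<in> Borel \<Longrightarrow> k \<in> K \<Longrightarrow> fc \<kappa> (b \<odot> lower (\<kappa> * \<pp> ^ n) \<odot> k) = muB b * gen k"
    and "g \<notin> cell \<kappa> \<Longrightarrow> fc \<kappa> g = 0"
proof -
  let ?Y = "lower (\<kappa> * \<pp> ^ n)"
  let ?P = "\<lambda>f. (\<forall>b\<in>Borel. \<forall>k\<in>K. f (b \<odot> ?Y \<odot> k) = muB b * gen k) \<and>
    (\<forall>g. (\<nexists>b k. b \<in> Borel \<and> k \<in> K \<and> g = b \<odot> ?Y \<odot> k) \<longrightarrow> f g = 0)"
  \<comment> \<open>A witness for the definite description: the value is read off any decomposition
    of g, and \<open>cell_value_unique\<close> makes it independent of that choice.\<close>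
  define f where "f g = (if g \<in> cell \<kappa> then THE z. \<exists>b k. b \<in> Borel \<and> k \<in> K \<and> g = b \<odot> ?Y \<odot> k \<and> z = muB b * gen k else 0)" for g
  have f1: "f (b \<odot> ?Y \<odot> k) = muB b * gen k" if "b \<in> Borel" "k \<in> K" for b k
  proof -
    have "b \<odot> ?Y \<odot> k \<in> cell \<kappa>" using that unfolding cell_def by blast
    moreover have "(THE z. \<exists>b' k'. b' \<in> Borel \<and> k' \<in> K \<and> b \<odot> ?Y \<odot> k = b' \<odot> ?Y \<odot> k' \<and> z = muB b' * gen k') = muB b * gen k"
    proof (rule the_equality)
      fix z assume "\<exists>b' k'. b' \<in> Borel \<and> k' \<in> K \<and> b \<odot> ?Y \<odot> k = b' \<odot> ?Y \<odot> k' \<and> z = muB b' * gen k'"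
      then obtain b' k' where *: "b' \<in> Borel" "k' \<in> K" "b \<odot> ?Y \<odot> k = b' \<odot> ?Y \<odot> k'" "z = muB b' * gen k'"
        by (elim exE conjE)
      show "z = muB b * gen k"
        unfolding *(4) by (rule cell_value_unique[OF \<kappa> that(1) *(1) that(2) *(2,3), symmetric])
    qed (intro exI[of _ b] exI[of _ k] conjI refl that)
    ultimately show ?thesis by (simp add: f_def)
  qed
  have "?P f"
  proof (intro conjI ballI allI impI)
    fix g assume "\<nexists>b k. b \<in> Borel \<and> k \<in> K \<and> g = b \<odot> ?Y \<odot> k"
    then have "g \<notin> cell \<kappa>" by (auto simp: cell_def)
    then show "f g = 0" by (simp add: f_def)
  qed (rule f1)
  moreover have "f' = f" if f': "?P f'" for f'
  proof
    fix g
    show "f' g = f g"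
    proof (cases "g \<in> cell \<kappa>")
      case True
      then obtain b k where "b \<in> Borel" "k \<in> K" "g = b \<odot> ?Y \<odot> k" by (auto simp: cell_def)
      then show ?thesis using f' f1 by simp
    next
      case False
      then have "\<nexists>b k. b \<in> Borel \<and> k \<in> K \<and> g = b \<odot> ?Y \<odot> k" by (auto simp: cell_def)
      then have "f' g = 0" using f' by blast
      then show ?thesis using False by (simp add: f_def)
    qed
  qed
  ultimately have "fc \<kappa> = f"
    unfolding f_cell_def lower_def[symmetric] by (rule the_equality)
  then show "b \<in> Borel \<Longrightarrow> k \<in> K \<Longrightarrow> fc \<kappa> (b \<odot> ?Y \<odot> k) = muB b * gen k" "g \<notin> cell \<kappa> \<Longrightarrow> fc \<kappa> g = 0"
    using f1 by (simp_all add: f_def)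
qed

lemma cell_left:
  assumes \<kappa>: "\<kappa> \<in> Zp_units" and b: "b \<in> Borel" and g: "g \<in> Mp"
  shows "b \<odot> g \<in> cell \<kappa> \<longleftrightarrow> g \<in> cell \<kappa>"
proof -
  have *: "b \<odot> g \<in> cell \<kappa>" if b: "b \<in> Borel" and g: "g \<in> cell \<kappa>" for b g
  proof -
    obtain b' k where "b' \<in> Borel" "k \<in> K" "g = b' \<odot> lower (\<kappa> * \<pp> ^ n) \<odot> k" using g by (auto simp: cell_def)
    then show ?thesis unfolding cell_def mem_Collect_eq
      using b by (intro exI[of _ "b \<odot> b'"] exI[of _ k])
        (simp add: assoc Mp_closed Mp_I cell_lower_in(3)[OF \<kappa>] mp_subgroupD(3)[OF Borel_subgroup])
  qed
  show ?thesis
    using *[OF b] *[OF mp_subgroupD(4)[OF Borel_subgroup b], of "b \<odot> g"] mp_cancel[OF odd Mp_I(1)[OF b] g] by metis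
qed

lemma cell_right:
  assumes \<kappa>: "\<kappa> \<in> Zp_units" and k: "k \<in> K" and g: "g \<in> Mp"
  shows "g \<odot> k \<in> cell \<kappa> \<longleftrightarrow> g \<in> cell \<kappa>"
proof -
  have *: "g \<odot> k \<in> cell \<kappa>" if k: "k \<in> K" and g: "g \<in> cell \<kappa>" for k g
  proof -
    obtain b k' where "b \<in> Borel" "k' \<in> K" "g = b \<odot> lower (\<kappa> * \<pp> ^ n) \<odot> k'" using g by (auto simp: cell_def)
    then show ?thesis unfolding cell_def mem_Collect_eq
      using k by (intro exI[of _ b] exI[of _ "k' \<odot> k"])
        (simp add: assoc Mp_closed Mp_I cell_lower_in(3)[OF \<kappa>] mp_subgroupD(3)[OF K_sub])
  qed
  show ?thesis
    using *[OF k] *[OF mp_subgroupD(4)[OF K_sub k], of "g \<odot> k"] mp_cancel[OF odd Mp_I(2)[OF k] g] by metis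
qed

lemma f_cell_left:
  assumes \<kappa>: "\<kappa> \<in> Zp_units" and b: "b \<in> Borel" and g: "g \<in> Mp"
  shows "fc \<kappa> (b \<odot> g) = muB b * fc \<kappa> g"
proof (cases "g \<in> cell \<kappa>")
  case True
  then obtain b' k where g': "b' \<in> Borel" "k \<in> K" "g = b' \<odot> lower (\<kappa> * \<pp> ^ n) \<odot> k" by (auto simp: cell_def)
  have "b \<odot> g = (b \<odot> b') \<odot> lower (\<kappa> * \<pp> ^ n) \<odot> k"
    using b g' by (simp add: assoc Mp_closed Mp_I cell_lower_in(3)[OF \<kappa>])
  then show ?thesis
    using f_cell_values(1)[OF \<kappa> mp_subgroupD(3)[OF Borel_subgroup b g'(1)] g'(2)]
      f_cell_values(1)[OF \<kappa> g'(1,2)] g'(3) muB_mult[OF b g'(1)] by simp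
next
  case False
  then show ?thesis using cell_left[OF \<kappa> b g] f_cell_values(2)[OF \<kappa>] by simp
qed

lemma f_cell_right:
  assumes \<kappa>: "\<kappa> \<in> Zp_units" and k: "k \<in> K" and g: "g \<in> Mp"
  shows "fc \<kappa> (g \<odot> k) = fc \<kappa> g * gen k"
proof (cases "g \<in> cell \<kappa>")
  case True
  then obtain b k' where g': "b \<in> Borel" "k' \<in> K" "g = b \<odot> lower (\<kappa> * \<pp> ^ n) \<odot> k'" by (auto simp: cell_def)
  have "g \<odot> k = b \<odot> lower (\<kappa> * \<pp> ^ n) \<odot> (k' \<odot> k)"
    using k g' by (simp add: assoc Mp_closed Mp_I cell_lower_in(3)[OF \<kappa>])
  then show ?thesis
    using f_cell_values(1)[OF \<kappa> g'(1) mp_subgroupD(3)[OF K_sub g'(2) k]]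
      f_cell_values(1)[OF \<kappa> g'(1,2)] g'(3) gen_mult[OF K_K1[OF g'(2)] K_K1[OF k]] by simp
next
  case False
  then show ?thesis using cell_right[OF \<kappa> k g] f_cell_values(2)[OF \<kappa>] by simp
qed

lemma f_cell_locally_constant:
  assumes \<kappa>: "\<kappa> \<in> Zp_units" shows "locally_constant_mp (fc \<kappa>)"
  unfolding locally_constant_mp_def
proof (intro ballI exI conjI)
  fix g :: "'p mp" assume g: "g \<in> Mp"
  \<comment> \<open>Within this radius of 1, elements of \<open>SL2_Zp\<close> lie in
    \<open>K0 (2 * n)\<close> and have lower right entry 1 mod p, so the genuine character is 1 on
    them.\<close>
  let ?e = "1 / real CARD('p) ^ (2 * n)"
  let ?U = "ball (mat 1 :: 'p mat2) ?e"
  show "open ?U" by simp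
  show "mat 1 \<in> ?U" using p_real_gt_1[where 'p='p] by simp
  fix k assume k: "k \<in> ?U \<inter> SL2_Zp"
  have near: "k $ i $ j - (mat 1 :: 'p mat2) $ i $ j \<in> p_ideal (2 * n)" for i j
  proof -
    have "dist (k $ i $ j) ((mat 1 :: 'p mat2) $ i $ j) \<le> dist k (mat 1)"
      using dist_vec_nth_le[of "k $ i" j "mat 1 $ i"] dist_vec_nth_le[of k i "mat 1"] by linarith
    also have "\<dots> < ?e" using k by (simp add: dist_commute)
    finally show ?thesis by (simp add: dist_padic_def p_ideal_abs)
  qed
  have "k \<in> K0 (2 * n)" using k near[of 2 1] by (auto simp: K0_iff SL2_Zp_def)
  then have kK: "(k, 1) \<in> K" by (simp add: full_preimage_iff)
  have "k $ 2 $ 2 - 1 \<in> p_ideal 1" using near[of 2 2] n by (auto intro: p_ideal_mono)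
  then have "gen (k, 1) = 1"
    using quadratic_char_cong[OF \<eta> Zp_units_closed(1)] eta_1 by (simp add: genuine_def)
  then show "fc \<kappa> (g \<odot> (k, 1)) = fc \<kappa> g" using f_cell_right[OF \<kappa> kK g] by simp
qed

lemma f_cell_principal_series:
  assumes \<kappa>: "\<kappa> \<in> Zp_units" shows "fc \<kappa> \<in> principal_series_K \<psi> \<mu> \<eta> (2 * n)"
  using f_cell_locally_constant[OF \<kappa>] f_cell_left[OF \<kappa>] f_cell_right[OF \<kappa>]
  by (simp add: principal_series_K_def principal_series_def)

lemma f_cell_nonzero:
  assumes \<kappa>: "\<kappa> \<in> Zp_units" shows "\<exists>g\<in>Mp. fc \<kappa> g \<noteq> 0"
proof (rule bexI[OF _ cell_lower_in(3)[OF \<kappa>]])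
  have "muB mp_one = 1" by (subst muB_unit) (simp_all add: mp_one_def mu_1 Zp_units_closed)
  then show "fc \<kappa> (lower (\<kappa> * \<pp> ^ n)) \<noteq> 0"
    using f_cell_values(1)[OF \<kappa> mp_subgroupD(2)[OF Borel_subgroup] mp_subgroupD(2)[OF K_sub]] gen_one by simp
qed


section \<open>Translations by y(t p^(2n-1))\<close>

lemma lower_deep:
  assumes "t \<in> Zp"
  shows "t * \<pp> ^ (2 * n - 1) \<in> p_ideal (2 * n - 1)" "t * \<pp> ^ (2 * n - 1) \<in> p_ideal 1"
    "lower (t * \<pp> ^ (2 * n - 1)) \<in> K1" "lower (t * \<pp> ^ (2 * n - 1)) \<in> Mp"
proof -
  show 1: "t * \<pp> ^ (2 * n - 1) \<in> p_ideal (2 * n - 1)" using assms by (rule p_power_in_p_ideal)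
  show 2: "t * \<pp> ^ (2 * n - 1) \<in> p_ideal 1" using p_ideal_mono[OF 1] n by simp
  show "lower (t * \<pp> ^ (2 * n - 1)) \<in> K1" "lower (t * \<pp> ^ (2 * n - 1)) \<in> Mp"
    using lower_in[OF 2] Mp_I by auto
qed

abbreviation dlow :: "'p padic \<Rightarrow> 'p mp" where "dlow t \<equiv> lower (t * \<pp> ^ (2 * n - 1))"

lemma dlow_add: "s \<in> Zp \<Longrightarrow> t \<in> Zp \<Longrightarrow> dlow s \<odot> dlow t = dlow (s + t)"
  using lower_add[OF odd lower_deep(2) lower_deep(2)] by (simp add: distrib_right)

lemma dlow_in_K: "t \<in> p_ideal 1 \<Longrightarrow> dlow t \<in> K"
proof -
  assume "t \<in> p_ideal 1"
  then have "t * \<pp> ^ (2 * n - 1) \<in> p_ideal (2 * n)"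
    by (rule p_ideal_mult[OF _ p_power_in_p_ideal(1)]) simp
  then show ?thesis by (rule lower_in)
qed

text \<open>Up to an element of K, conjugating y(s) by k multiplies s by d^2: one has a d = 1 mod
  p^(2n), and s^2 lies in p^(2n) Z_p since 2(2n - 1) >= 2n. Only a square factor appears, so the
  square class of t survives.\<close>

lemma push_right:
  assumes k: "k \<in> K" and t: "t \<in> Zp"
  shows "\<exists>l\<in>K. k \<odot> dlow t = dlow ((fst k $ 2 $ 2)\<^sup>2 * t) \<odot> l \<and> gen l = gen k"
proof -
  let ?s = "t * \<pp> ^ (2 * n - 1)"
  let ?A = "fst k $ 1 $ 1" and ?B = "fst k $ 1 $ 2" and ?C = "fst k $ 2 $ 1" and ?d = "fst k $ 2 $ 2"
  have kK: "fst k \<in> K0 (2 * n)" using k by (simp add: full_preimage_iff)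
  then have ent: "?A \<in> Zp" "?B \<in> Zp" "?d \<in> Zp" "?C \<in> p_ideal (2 * n)" by (auto simp: K0_iff)
  have t': "?d\<^sup>2 * t \<in> Zp" using ent t by (intro Zp_closed)
  note s = lower_deep[OF t] and s' = lower_deep[OF t']
  have sZ: "?s \<in> Zp" using s(1) by (rule p_ideal_subset_Zp)
  have ss: "?s * ?s \<in> p_ideal (2 * n)" by (rule p_ideal_mult[OF s(1) s(1)]) (use n in simp)
  have ad: "- (?A * ?d - 1) \<in> p_ideal (2 * n)"
    using n by (intro p_ideal_closed(4) K0_diagonal(1)[OF kK]) simp
  define l where "l = mp_inv (dlow (?d\<^sup>2 * t)) \<odot> (k \<odot> dlow t)"
  have lK1: "l \<in> K1" unfolding l_def
    by (intro mp_subgroupD(3,4)[OF K1_sub] s s' K_K1 k)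
  have e: "k \<odot> dlow t = dlow (?d\<^sup>2 * t) \<odot> l"
    unfolding l_def using mp_cancel(2)[OF odd s'(4)] Mp_closed(2)[OF Mp_I(2)[OF k] s(4)] by simp
  have "fst l = y_mat (- (?d\<^sup>2 * ?s)) ** (fst k ** y_mat ?s)"
    by (simp add: l_def mp_mult_def mp_inv_def lower_def adj2_y_mat mult.assoc)
  then have "fst l $ 2 $ 1 = ?C + ?d * ?s * (1 - ?A * ?d) - ?d\<^sup>2 * ?B * (?s * ?s)"
    by (simp add: mat2_mult_entries algebra_simps power2_eq_square)
  also have "\<dots> = ?C + ?d * ?s * (- (?A * ?d - 1)) - ?d\<^sup>2 * ?B * (?s * ?s)" by simp
  also have "\<dots> \<in> p_ideal (2 * n)"
    by (rule p_ideal_closed(3)[OF p_ideal_closed(2)[OF ent(4) p_ideal_mult_Zp(2)[OF ad Zp_closed(6)[OF ent(3) sZ]]]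
          p_ideal_mult_Zp(2)[OF ss]]) (intro Zp_closed ent)
  finally have "fst l $ 2 $ 1 \<in> p_ideal (2 * n)" .
  then have lK: "l \<in> K" using lK1 by (simp add: full_preimage_iff K0_iff)
  have "gen k * gen (dlow t) = gen (dlow (?d\<^sup>2 * t)) * gen l"
    using gen_mult[OF K_K1[OF k] s(3)] gen_mult[OF s'(3) lK1] e by simp
  then have "gen l = gen k" by (simp add: gen_lower)
  then show ?thesis using lK e by blast
qed

text \<open>By \<open>theta_add\<close> and \<open>theta_p\<close> an additive character of Z_p / p.
  The inverse is taken because a translation puts h(1/a), not h(a), on the Borel side, with a = 1 +
  p^(n-1) x.\<close>

definition theta :: "'p padic \<Rightarrow> complex" where "theta x = inverse (\<mu> (1 + \<pp> ^ (n - 1) * x))"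

lemma theta_unit: "x \<in> Zp \<Longrightarrow> 1 + \<pp> ^ (n - 1) * x \<in> Zp_units"
  by (rule Zp_units_cong[OF Zp_units_closed(1)])
    (use p_power_in_p_ideal(3)[of x "n - 1"] n in \<open>auto intro: p_ideal_mono\<close>)

lemma theta_add: "x \<in> Zp \<Longrightarrow> y \<in> Zp \<Longrightarrow> theta (x + y) = theta x * theta y"
proof -
  assume x: "x \<in> Zp" and y: "y \<in> Zp"
  let ?q = "\<pp> ^ (n - 1) :: 'p padic"
  have "(1 + ?q * x) * (1 + ?q * y) - (1 + ?q * (x + y)) = ?q * ?q * (x * y)" by (simp add: algebra_simps)
  \<comment> \<open>Here n > 1 enters, as 2(n - 1) >= n: the product term is invisible to
    \<mu>.\<close>
  also have "\<dots> \<in> p_ideal n"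
    by (rule p_ideal_mult_Zp(1)[OF p_ideal_mult[OF p_power_in_p_ideal(1) p_power_in_p_ideal(1)] Zp_closed(6)[OF x y]])
      (use n in simp)
  finally have "\<mu> ((1 + ?q * x) * (1 + ?q * y)) = \<mu> (1 + ?q * (x + y))"
    by (rule mu_cong[OF theta_unit[OF Zp_closed(3)[OF x y]]])
  then show ?thesis
    using mu_mult[OF Zp_units_nonzero[OF theta_unit[OF x]] Zp_units_nonzero[OF theta_unit[OF y]]]
    by (simp add: theta_def)
qed

lemma theta_p: "x \<in> p_ideal 1 \<Longrightarrow> theta x = 1"
proof -
  assume "x \<in> p_ideal 1"
  then have "\<pp> ^ (n - 1) * x \<in> p_ideal n"
    by (rule p_ideal_mult[OF p_power_in_p_ideal(1)]) simp
  then show ?thesis using mu_cong[OF Zp_units_closed(1), of "1 + \<pp> ^ (n - 1) * x"] mu_1 by (simp add: theta_def)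
qed

lemma theta_cong: "x - y \<in> p_ideal 1 \<Longrightarrow> y \<in> Zp \<Longrightarrow> theta x = theta y"
  using theta_add[of y "x - y"] theta_p[of "x - y"] p_ideal_subset_Zp[of "x - y" 1] by simp

lemma theta_nat: "x \<in> Zp \<Longrightarrow> theta (of_nat k * x) = theta x ^ k"
  by (induction k) (simp_all add: theta_p p_ideal_closed distrib_right theta_add Zp_closed of_nat_in_Zp)

lemma theta_residue: "x \<in> Zp \<Longrightarrow> theta x = theta 1 ^ nat (residue_p x)"
proof -
  assume x: "x \<in> Zp"
  have "x - of_nat (nat (residue_p x)) * 1 \<in> p_ideal 1" using residue_p[OF x] by simp
  then have "theta x = theta (of_nat (nat (residue_p x)) * 1)"
    by (rule theta_cong) (simp add: of_nat_in_Zp)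
  then show ?thesis using theta_nat[OF Zp_closed(2)] by metis
qed

lemma theta_root: "theta 1 ^ CARD('p) = 1" "theta 1 \<noteq> 1"
proof -
  show "theta 1 ^ CARD('p) = 1"
    using theta_nat[OF Zp_closed(2), of "CARD('p)"] theta_p[OF p_power_in_p_ideal(1)[of 1]] by simp
  show "theta 1 \<noteq> 1"
  proof
    assume "theta 1 = 1"
    \<comment> \<open>Then \<mu> is trivial on 1 + p^(n-1) Z_p, against the minimality of n. Since n
      > 1, this is \<open>unit_subgroup (n - 1)\<close> and not the group of all units.\<close>
    then have "\<mu> (1 + \<pp> ^ (n - 1) * x) = 1" if "x \<in> Zp" for x
      using theta_residue[OF that] by (simp add: theta_def)
    then have "\<forall>u\<in>unit_subgroup (n - 1). \<mu> u = 1" using n by (auto simp: unit_subgroup_def)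
    moreover have "n - 1 < n" using n by simp
    ultimately show False using \<mu>(2) by (auto simp: conductor_exponent_def)
  qed
qed

text \<open>h(1/a) is the Borel factor and h(a) the factor in K. The latter has genuine character 1
  because a = 1 mod p, so only \<mu> contributes.\<close>

lemma cell_shift:
  assumes \<kappa>: "\<kappa> \<in> Zp_units" and t: "t \<in> Zp"
  shows "\<exists>b\<in>Borel. \<exists>k\<in>K. lower (\<kappa> * \<pp> ^ n) \<odot> dlow t = b \<odot> lower (\<kappa> * \<pp> ^ n) \<odot> k \<and>
    muB b * gen k = theta (t / (2 * \<kappa>))"
proof -
  let ?s = "t * \<pp> ^ (2 * n - 1)" and ?q = "\<pp> ^ (n - 1) :: 'p padic"
  note \<kappa>0 = Zp_units_nonzero[OF \<kappa>] and u2 = two_unit[OF odd]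
  have tk: "t / \<kappa> \<in> Zp" using t \<kappa> by (simp add: divide_inverse Zp_closed Zp_units_in_Zp Zp_units_closed)
  have pn: "\<pp> ^ (2 * n - 1) = ?q * (\<pp> :: 'p padic) ^ n"
  proof -
    have "2 * n - 1 = n - 1 + n" using n by simp
    then show ?thesis by (simp only: power_add)
  qed
  define u where "u = 1 + ?q * (t / \<kappa>)"
  have u: "u \<in> Zp_units" unfolding u_def by (rule theta_unit[OF tk])
  have "u - (of_int 1)\<^sup>2 \<in> p_ideal 1"
    using p_power_in_p_ideal(3)[OF tk, of "n - 1"] n by (auto simp: u_def intro: p_ideal_mono)
  then obtain a where a: "a \<in> Zp_units" "u = a\<^sup>2" "a - 1 \<in> p_ideal 1"
    using square_unit_lift[OF odd u, of 1] by auto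
  note a0 = Zp_units_nonzero[OF a(1)]
  have a': "1 / a \<in> Zp_units" using Zp_units_closed(5)[OF Zp_units_closed(1) a(1)] .
  have "a\<^sup>2 * (\<kappa> * \<pp> ^ n) = \<kappa> * \<pp> ^ n + ?s"
    unfolding a(2)[symmetric] u_def pn using \<kappa>0 by (simp add: field_simps)
  then have e: "lower (\<kappa> * \<pp> ^ n) \<odot> dlow t = torus (1 / a) \<odot> lower (\<kappa> * \<pp> ^ n) \<odot> torus a"
    using torus_conj[OF odd cell_lower_in(1)[OF \<kappa>] a(1)] lower_add[OF odd cell_lower_in(1)[OF \<kappa>] lower_deep(2)[OF t]]
    by simp
  have mB: "muB (torus (1 / a)) = inverse (\<mu> a)"
    using muB_unit[of "torus (1 / a)"] a' mu_inverse[OF a0] by (simp add: torus_def diag_def)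
  have "1 / a - 1 = - (inverse a * (a - 1))" using a0 by (simp add: field_simps)
  then have "1 / a - 1 \<in> p_ideal 1"
    using a(3) p_ideal_closed(4) p_ideal_unit_mult[OF Zp_units_closed(4)[OF a(1)]] by metis
  then have gk: "gen (torus a) = 1"
    using quadratic_char_cong[OF \<eta> Zp_units_closed(1)] eta_1 by (simp add: genuine_def torus_def diag_def)
  have a2: "(a + 1) - 2 \<in> p_ideal 1" using a(3) by simp
  then have a1: "a + 1 \<in> Zp_units" by (rule Zp_units_cong[OF u2])
  \<comment> \<open>Factoring a^2 - 1 gives a = 1 + p^(n-1) y exactly. As a + 1 = 2 mod p, dividing
    by 2 instead changes y by a multiple of p only.\<close>
  define y where "y = t / \<kappa> / (a + 1)"
  have "y = t / \<kappa> * inverse (a + 1)" by (simp only: y_def divide_inverse)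
  then have y: "y \<in> Zp" using tk a1 by (simp only: Zp_closed Zp_units_in_Zp Zp_units_closed)
  have "(a - 1) * (a + 1) = ?q * (t / \<kappa>)" using a(2) by (simp add: u_def power2_eq_square algebra_simps)
  then have "a - 1 = ?q * (t / \<kappa>) / (a + 1)"
    by (simp only: nonzero_eq_divide_eq[OF Zp_units_nonzero[OF a1]])
  then have "a = 1 + ?q * y" by (simp add: y_def diff_eq_eq add.commute)
  then have "inverse (\<mu> a) = theta y" by (simp add: theta_def)
  also have "\<dots> = theta (t / (2 * \<kappa>))"
  proof (rule theta_cong)
    have "y - t / (2 * \<kappa>) = - (t / \<kappa> * (inverse (2 * (a + 1)) * ((a + 1) - 2)))"
    proof -
      have "inverse c - inverse 2 = - (inverse (2 * c) * (c - 2))" if "c \<noteq> 0" for c :: "'p padic"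
        using that Zp_units_nonzero[OF u2] by (simp add: field_simps)
      note this[OF Zp_units_nonzero[OF a1]]
      moreover have "y - t / (2 * \<kappa>) = t / \<kappa> * (inverse (a + 1) - inverse 2)"
        by (simp only: y_def divide_inverse inverse_mult_distrib right_diff_distrib mult_ac)
      ultimately show ?thesis by (simp only: mult_minus_right)
    qed
    also have "\<dots> \<in> p_ideal 1"
      by (intro p_ideal_closed(4) p_ideal_mult_Zp(2)[OF _ tk] p_ideal_mult_Zp(2)[OF a2] Zp_units_in_Zp Zp_units_closed u2 a1)
    finally show "y - t / (2 * \<kappa>) \<in> p_ideal 1" .
    show "t / (2 * \<kappa>) \<in> Zp"
      unfolding divide_inverse by (intro Zp_closed t Zp_units_in_Zp Zp_units_closed u2 \<kappa>)
  qed
  finally have "muB (torus (1 / a)) * gen (torus a) = theta (t / (2 * \<kappa>))" using mB gk by simp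
  then show ?thesis using e torus_Borel[OF a'] torus_in[OF a(1)] by blast
qed

lemma f_cell_shift_aux:
  assumes \<kappa>: "\<kappa> \<in> Zp_units" and t: "t \<in> Zp" and g: "b \<in> Borel" "k \<in> K" "g = b \<odot> lower (\<kappa> * \<pp> ^ n) \<odot> k"
  shows "g \<odot> dlow t \<in> cell \<kappa>"
    "fc \<kappa> (g \<odot> dlow t) = fc \<kappa> g * theta ((fst k $ 2 $ 2)\<^sup>2 * t / (2 * \<kappa>))"
proof -
  let ?Y = "lower (\<kappa> * \<pp> ^ n)" and ?t = "(fst k $ 2 $ 2)\<^sup>2 * t"
  have "fst k $ 2 $ 2 \<in> Zp" using g(2) by (simp add: full_preimage_iff K0_iff)
  then have t': "?t \<in> Zp" using t by (intro Zp_closed)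
  obtain l where l: "l \<in> K" "k \<odot> dlow t = dlow ?t \<odot> l" "gen l = gen k" using push_right[OF g(2) t] by blast
  obtain b' k' where b': "b' \<in> Borel" "k' \<in> K" "?Y \<odot> dlow ?t = b' \<odot> ?Y \<odot> k'"
    "muB b' * gen k' = theta (?t / (2 * \<kappa>))" using cell_shift[OF \<kappa> t'] by blast
  note M = Mp_I(1)[OF g(1)] Mp_I(2)[OF g(2)] Mp_I(2)[OF l(1)] Mp_I(1)[OF b'(1)] Mp_I(2)[OF b'(2)]
    cell_lower_in(3)[OF \<kappa>] lower_deep(4)[OF t] lower_deep(4)[OF t']
  have bb: "b \<odot> b' \<in> Borel" "k' \<odot> l \<in> K"
    using mp_subgroupD(3)[OF Borel_subgroup g(1) b'(1)] mp_subgroupD(3)[OF K_sub b'(2) l(1)] by auto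
  have "g \<odot> dlow t = b \<odot> (?Y \<odot> (k \<odot> dlow t))" unfolding g(3) using M by (simp add: assoc Mp_closed)
  also have "\<dots> = b \<odot> ((?Y \<odot> dlow ?t) \<odot> l)" unfolding l(2) using M by (simp add: assoc Mp_closed)
  also have "\<dots> = (b \<odot> b') \<odot> ?Y \<odot> (k' \<odot> l)" unfolding b'(3) using M by (simp add: assoc Mp_closed)
  finally have e: "g \<odot> dlow t = (b \<odot> b') \<odot> ?Y \<odot> (k' \<odot> l)" .
  show "g \<odot> dlow t \<in> cell \<kappa>" unfolding cell_def e using bb by blast
  have "fc \<kappa> (g \<odot> dlow t) = muB b * muB b' * (gen k' * gen k)"
    unfolding e f_cell_values(1)[OF \<kappa> bb] muB_mult[OF g(1) b'(1)] gen_mult[OF K_K1[OF b'(2)] K_K1[OF l(1)]] l(3) ..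
  also have "\<dots> = (muB b * gen k) * (muB b' * gen k')" by (simp only: mult_ac)
  finally show "fc \<kappa> (g \<odot> dlow t) = fc \<kappa> g * theta (?t / (2 * \<kappa>))"
    unfolding b'(4) g(3) f_cell_values(1)[OF \<kappa> g(1,2)] .
qed

text \<open>\<open>d\<close> may depend on g but not on t, which is what permits summation over t.
  Off the cell both sides vanish: a translation that moved g into the cell would be undone by the
  one for -t, which preserves the cell.\<close>

lemma f_cell_shift:
  assumes \<kappa>: "\<kappa> \<in> Zp_units" and g: "g \<in> Mp"
  shows "\<exists>d\<in>Zp_units. \<forall>t\<in>Zp. fc \<kappa> (g \<odot> dlow t) = fc \<kappa> g * theta (d\<^sup>2 * t / (2 * \<kappa>))"
proof (cases "g \<in> cell \<kappa>")
  case True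
  then obtain b k where g': "b \<in> Borel" "k \<in> K" "g = b \<odot> lower (\<kappa> * \<pp> ^ n) \<odot> k" by (auto simp: cell_def)
  have "fst k $ 2 $ 2 \<in> Zp_units" using g'(2) n by (intro K0_diagonal(3)[of _ "2 * n"]) (auto simp: full_preimage_iff)
  then show ?thesis using f_cell_shift_aux(2)[OF \<kappa> _ g'] by blast
next
  case False
  have "g \<odot> dlow t \<notin> cell \<kappa>" if t: "t \<in> Zp" for t
  proof
    assume "g \<odot> dlow t \<in> cell \<kappa>"
    then obtain b k where g': "b \<in> Borel" "k \<in> K" "g \<odot> dlow t = b \<odot> lower (\<kappa> * \<pp> ^ n) \<odot> k" by (auto simp: cell_def)
    have "g \<odot> dlow t \<odot> dlow (- t) \<in> cell \<kappa>" by (rule f_cell_shift_aux(1)[OF \<kappa> Zp_closed(5)[OF t] g'])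
    moreover have "g \<odot> dlow t \<odot> dlow (- t) = g"
      using g lower_deep(4)[OF t] lower_deep(4)[OF Zp_closed(5)[OF t]] dlow_add[OF t Zp_closed(5)[OF t]]
      by (simp add: assoc lower_0)
    ultimately show False using False by simp
  qed
  then show ?thesis using False Zp_units_closed(1) f_cell_values(2)[OF \<kappa>] by (intro bexI[of _ 1]) auto
qed

section \<open>Double cosets and the Hecke operators\<close>

definition hecke_coset :: "'p padic \<Rightarrow> 'p mp set"
  where "hecke_coset \<beta> = {k \<odot> dlow \<beta> \<odot> k' |k k'. k \<in> K \<and> k' \<in> K}"

lemma hecke_coset_K1: "\<beta> \<in> Zp \<Longrightarrow> x \<in> hecke_coset \<beta> \<Longrightarrow> x \<in> K1"
  unfolding hecke_coset_def using lower_deep(3) K_K1 mp_subgroupD(3)[OF K1_sub] by blast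

lemma hecke_coset_base: "dlow \<beta> \<in> hecke_coset \<beta>"
  unfolding hecke_coset_def mem_Collect_eq
  by (rule exI[of _ mp_one], rule exI[of _ mp_one]) (simp add: mp_subgroupD(2)[OF K_sub])

lemma hecke_coset_mult:
  assumes \<beta>: "\<beta> \<in> Zp" and k: "k \<in> K" "k' \<in> K" and g: "g \<in> Mp"
  shows "k \<odot> g \<odot> k' \<in> hecke_coset \<beta> \<longleftrightarrow> g \<in> hecke_coset \<beta>"
proof -
  have *: "k \<odot> g \<odot> k' \<in> hecke_coset \<beta>" if k: "k \<in> K" "k' \<in> K" and g: "g \<in> hecke_coset \<beta>" for k k' g
  proof -
    obtain l l' where l: "l \<in> K" "l' \<in> K" "g = l \<odot> dlow \<beta> \<odot> l'" using g by (auto simp: hecke_coset_def)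
    have "k \<odot> g \<odot> k' = (k \<odot> l) \<odot> dlow \<beta> \<odot> (l' \<odot> k')"
      using k l lower_deep(4)[OF \<beta>] by (simp add: assoc Mp_closed Mp_I)
    moreover have "k \<odot> l \<in> K" "l' \<odot> k' \<in> K" using mp_subgroupD(3)[OF K_sub] k l by auto
    ultimately show ?thesis unfolding hecke_coset_def by blast
  qed
  have "mp_inv k \<odot> (k \<odot> g \<odot> k') \<odot> mp_inv k' = g"
    using k g by (simp add: assoc Mp_closed Mp_I mp_cancel[OF odd] mp_inv_mult)
  then show ?thesis using *[OF k] *[OF mp_subgroupD(4)[OF K_sub k(1)] mp_subgroupD(4)[OF K_sub k(2)], of "k \<odot> g \<odot> k'"] by metis
qed

lemma cnj_gen: "x \<in> K1 \<Longrightarrow> cnj (gen x) = gen x"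
  using gen_K1_values[of x] by auto

text \<open>The genuine character of the inverse image of \<open>K0 (2 * n)\<close> extends to that of \<open>K0 1\<close>, which contains
  the double coset supporting the Hecke function. So that function is the extended character,
  cut off to the double coset.\<close>

lemma hecke_fun_eq:
  assumes \<beta>: "\<beta> \<in> Zp"
  shows "hecke_fun \<eta> (2 * n) (dlow \<beta>) = (\<lambda>x. if x \<in> hecke_coset \<beta> then gen x else 0)"
  unfolding hecke_fun_def
proof (rule the_equality)
  let ?F = "\<lambda>x. if x \<in> hecke_coset \<beta> then gen x else 0"
  note D = lower_deep[OF \<beta>]
  show "(\<forall>g. (\<nexists>k k'. k \<in> K \<and> k' \<in> K \<and> g = k \<odot> dlow \<beta> \<odot> k') \<longrightarrow> ?F g = 0) \<and> ?F (dlow \<beta>) = 1 \<and>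
    (\<forall>k\<in>K. \<forall>k'\<in>K. \<forall>g\<in>Mp. ?F (k \<odot> g \<odot> k') = cnj (gen k) * cnj (gen k') * ?F g)"
  proof (intro conjI allI impI ballI)
    fix g assume "\<nexists>k k'. k \<in> K \<and> k' \<in> K \<and> g = k \<odot> dlow \<beta> \<odot> k'"
    then have "g \<notin> hecke_coset \<beta>" unfolding hecke_coset_def by blast
    then show "?F g = 0" by simp
  next
    show "?F (dlow \<beta>) = 1" by (simp only: hecke_coset_base gen_lower if_True)
  next
    fix k k' g :: "'p mp" assume k: "k \<in> K" "k' \<in> K" and g: "g \<in> Mp"
    show "?F (k \<odot> g \<odot> k') = cnj (gen k) * cnj (gen k') * ?F g"
    proof (cases "g \<in> hecke_coset \<beta>")
      case True
      note gK = hecke_coset_K1[OF \<beta> True] and kK = K_K1[OF k(1)] K_K1[OF k(2)]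
      show ?thesis
        using True hecke_coset_mult[OF \<beta> k g] gen_mult[OF mp_subgroupD(3)[OF K1_sub kK(1) gK] kK(2)]
          gen_mult[OF kK(1) gK] by (simp add: cnj_gen[OF kK(1)] cnj_gen[OF kK(2)])
    next
      case False
      then show ?thesis using hecke_coset_mult[OF \<beta> k g] by simp
    qed
  qed
  fix F assume F: "(\<forall>g. (\<nexists>k k'. k \<in> K \<and> k' \<in> K \<and> g = k \<odot> dlow \<beta> \<odot> k') \<longrightarrow> F g = 0) \<and> F (dlow \<beta>) = 1 \<and>
    (\<forall>k\<in>K. \<forall>k'\<in>K. \<forall>g\<in>Mp. F (k \<odot> g \<odot> k') = cnj (gen k) * cnj (gen k') * F g)"
  show "F = ?F"
  proof
    fix g
    show "F g = ?F g"
    proof (cases "g \<in> hecke_coset \<beta>")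
      case True
      then obtain k k' where k: "k \<in> K" "k' \<in> K" "g = k \<odot> dlow \<beta> \<odot> k'" by (auto simp: hecke_coset_def)
      note kK = K_K1[OF k(1)] K_K1[OF k(2)]
      have "F g = gen k * gen k'" using F k D(4) by (simp add: cnj_gen[OF kK(1)] cnj_gen[OF kK(2)])
      also have "\<dots> = gen g"
        unfolding k(3) gen_mult[OF mp_subgroupD(3)[OF K1_sub kK(1) D(3)] kK(2)] gen_mult[OF kK(1) D(3)]
        by (simp add: gen_lower)
      finally show ?thesis using True by simp
    next
      case False
      then have "\<nexists>k k'. k \<in> K \<and> k' \<in> K \<and> g = k \<odot> dlow \<beta> \<odot> k'" unfolding hecke_coset_def by blast
      then have "F g = 0" using F by blast
      then show ?thesis using False by simp
    qed
  qed
qed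

definition left_coset :: "'p mp \<Rightarrow> 'p mp set" where "left_coset x = (\<lambda>k. x \<odot> k) ` K"

lemma left_coset_mult:
  assumes x: "x \<in> Mp" and k: "k \<in> K" shows "left_coset (x \<odot> k) = left_coset x"
proof -
  have *: "left_coset (x \<odot> k) \<subseteq> left_coset x" if x: "x \<in> Mp" and k: "k \<in> K" for x k
  proof
    fix z assume "z \<in> left_coset (x \<odot> k)"
    then obtain l where l: "l \<in> K" "z = x \<odot> k \<odot> l" by (auto simp: left_coset_def)
    then have "z = x \<odot> (k \<odot> l)" using x k by (simp add: assoc Mp_I)
    then show "z \<in> left_coset x" using mp_subgroupD(3)[OF K_sub k l(1)] by (auto simp: left_coset_def)
  qed
  show ?thesis
    using *[OF x k] *[OF Mp_closed(2)[OF x Mp_I(2)[OF k]] mp_subgroupD(4)[OF K_sub k]]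
      mp_cancel(3)[OF odd Mp_I(2)[OF k] x] by auto
qed

sublocale P: odd_prime "CARD('p)"
  by standard (use odd_prime_card[OF odd] in auto)

text \<open>With e the Legendre symbol of a unit \<beta>, these are the residues of u^2 \<beta>;
  they replace the units u taken modulo those with u^2 = 1 mod p.\<close>

definition class_reps :: "int \<Rightarrow> nat set" where "class_reps e = {w. w < CARD('p) \<and> P.Leg w = e}"

abbreviation rep :: "nat \<Rightarrow> 'p mp" where "rep w \<equiv> dlow (of_nat w)"

lemma legendre_of_nat: "legendre_p (of_nat w :: 'p padic) = P.Leg w"
  using legendre_p_of_int[of "int w", where 'p='p] by simp

lemma rep_in_hecke_coset:
  assumes \<beta>: "\<beta> \<in> Zp_units" and w: "w \<in> class_reps (legendre_p \<beta>)"
  shows "rep w \<in> hecke_coset \<beta>"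
proof -
  have L: "P.Leg w = legendre_p \<beta>" using w by (simp add: class_reps_def)
  then have "\<not> CARD('p) dvd w" using legendre_p_unit[OF \<beta>] P.Leg_zero_iff[of w] by auto
  then have "(of_nat w :: 'p padic) \<in> Zp_units" using of_int_unit[of "int w", where 'p='p] by simp
  then obtain e where e: "e \<in> Zp_units" "of_nat w = e\<^sup>2 * \<beta>"
    using square_of_equal_legendre[OF odd _ \<beta>] L legendre_of_nat by metis
  have "rep w = torus (1 / e) \<odot> dlow \<beta> \<odot> torus e"
    unfolding e(2) using torus_conj[OF odd lower_deep(2)[OF Zp_units_in_Zp[OF \<beta>]] e(1)] by (simp add: mult.assoc)
  then show ?thesis
    unfolding hecke_coset_def using torus_in[OF e(1)] torus_in[OF Zp_units_closed(5)[OF Zp_units_closed(1) e(1)]] by blast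
qed

lemma rep_Mp: "rep w \<in> Mp" "rep w \<in> K1"
  using lower_deep[OF of_nat_in_Zp] by blast+

text \<open>The quotient of two representatives is y((v - w) p^(2n-1)), which lies in
  \<open>K0 (2 * n)\<close> only if p divides v - w.\<close>

lemma left_coset_rep_inj: "inj_on (\<lambda>w. left_coset (rep w)) {w. w < CARD('p)}"
proof (rule inj_onI)
  fix v w assume vw: "v \<in> {w. w < CARD('p)}" "w \<in> {w. w < CARD('p)}" "left_coset (rep v) = left_coset (rep w)"
  have "rep v \<in> left_coset (rep v)"
    unfolding left_coset_def by (rule image_eqI[of _ _ mp_one]) (simp_all add: mp_subgroupD(2)[OF K_sub])
  then obtain k where k: "k \<in> K" "rep v = rep w \<odot> k" using vw(3) by (auto simp: left_coset_def)
  have w': "- of_nat w \<in> (Zp :: 'p padic set)" by (intro Zp_closed of_nat_in_Zp)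
  have "dlow (- of_nat w) \<odot> rep v = dlow (- of_nat w) \<odot> rep w \<odot> k"
    unfolding k(2) using assoc[OF lower_deep(4)[OF w'] rep_Mp(1) Mp_I(2)[OF k(1)]] by simp
  then have "dlow (- of_nat w + of_nat v) = k"
    using dlow_add[OF w' of_nat_in_Zp] by (simp add: lower_0)
  then have "y_mat ((- of_nat w + of_nat v) * \<pp> ^ (2 * n - 1)) \<in> (K0 (2 * n) :: 'p mat2 set)"
    using k(1) by (auto simp: full_preimage_iff lower_def)
  then have "(- of_nat w + of_nat v) * \<pp> ^ (2 * n - 1) \<in> (p_ideal (2 * n) :: 'p padic set)"
    by (simp add: K0_iff)
  moreover have "2 * n = 2 * n - 1 + 1" using n by simp
  ultimately have "- of_nat w + of_nat v \<in> (p_ideal 1 :: 'p padic set)"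
    using p_ideal_Suc_mult by (metis mult.commute)
  then have "(of_int (int v - int w) :: 'p padic) \<in> p_ideal 1" by simp
  then have "int CARD('p) dvd int v - int w" unfolding of_int_p_ideal by simp
  then have "int v mod int CARD('p) = int w mod int CARD('p)" by (simp add: mod_eq_dvd_iff)
  then show "v = w" using vw by simp
qed

text \<open>By \<open>push_right\<close>, k y(\<beta>p^(2n-1)) and y(d^2 \<beta> p^(2n-1)) have the
  same left coset. In the latter d^2 \<beta> matters only mod p, and its residue is the
  representative w.\<close>

lemma hecke_left_cosets:
  assumes \<beta>: "\<beta> \<in> Zp_units"
  shows "{C \<in> left_cosets (2 * n). \<exists>x\<in>C. x \<in> hecke_coset \<beta>} = (\<lambda>w. left_coset (rep w)) ` class_reps (legendre_p \<beta>)"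
proof (intro subset_antisym subsetI)
  fix C assume "C \<in> {C \<in> left_cosets (2 * n). \<exists>x\<in>C. x \<in> hecke_coset \<beta>}"
  then obtain x k0 where x: "x \<in> Mp" "C = left_coset x" "k0 \<in> K" "x \<odot> k0 \<in> hecke_coset \<beta>"
    by (auto simp: left_cosets_def left_coset_def)
  obtain k k' where k: "k \<in> K" "k' \<in> K" "x \<odot> k0 = k \<odot> dlow \<beta> \<odot> k'" using x(4) by (auto simp: hecke_coset_def)
  let ?d = "fst k $ 2 $ 2"
  have d: "?d \<in> Zp_units" using k(1) n by (intro K0_diagonal(3)[of _ "2 * n"]) (auto simp: full_preimage_iff)
  have db: "?d\<^sup>2 * \<beta> \<in> Zp_units" using d \<beta> by (intro Zp_units_closed)
  define w where "w = nat (residue_p (?d\<^sup>2 * \<beta>))"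
  note r = residue_p[OF Zp_units_in_Zp[OF db]]
  have wr: "int w = residue_p (?d\<^sup>2 * \<beta>)" using r(1) by (simp add: w_def)
  then have wi: "?d\<^sup>2 * \<beta> - of_nat w \<in> p_ideal 1" using r(2) by (metis of_int_of_nat_eq)
  have "P.Leg w = legendre_p (?d\<^sup>2 * \<beta>)" by (simp add: wr legendre_p_def)
  also have "\<dots> = legendre_p \<beta>"
    using legendre_p_mult[OF odd] legendre_p_squares(1)[OF odd d] d \<beta> by (simp add: Zp_units_in_Zp Zp_units_closed)
  finally have w: "w \<in> class_reps (legendre_p \<beta>)" using r(1) wr by (simp add: class_reps_def)
  obtain l where l: "l \<in> K" "k \<odot> dlow \<beta> = dlow (?d\<^sup>2 * \<beta>) \<odot> l" using push_right[OF k(1) Zp_units_in_Zp[OF \<beta>]] by blast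
  let ?z = "dlow (?d\<^sup>2 * \<beta> - of_nat w)"
  note z = dlow_in_K[OF wi]
  have dz: "dlow (?d\<^sup>2 * \<beta>) = rep w \<odot> ?z"
    using dlow_add[OF of_nat_in_Zp p_ideal_subset_Zp[OF wi]] by simp
  have "left_coset x = left_coset (x \<odot> k0)" using left_coset_mult[OF x(1,3)] by simp
  also have "x \<odot> k0 = rep w \<odot> ?z \<odot> l \<odot> k'" unfolding k(3) l(2) dz ..
  also have "left_coset \<dots> = left_coset (rep w)"
  proof -
    have "rep w \<odot> ?z \<in> Mp" "rep w \<odot> ?z \<odot> l \<in> Mp"
      by (intro Mp_closed rep_Mp(1) Mp_I(2) z l(1))+
    then show ?thesis by (simp only: left_coset_mult rep_Mp(1) z l(1) k(2))
  qed
  finally show "C \<in> (\<lambda>w. left_coset (rep w)) ` class_reps (legendre_p \<beta>)" using x(2) w by blast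
next
  fix C assume "C \<in> (\<lambda>w. left_coset (rep w)) ` class_reps (legendre_p \<beta>)"
  then obtain w where w: "w \<in> class_reps (legendre_p \<beta>)" "C = left_coset (rep w)" by blast
  have "C \<in> left_cosets (2 * n)" using w(2) rep_Mp(1) by (auto simp: left_cosets_def left_coset_def)
  moreover have "rep w \<in> C"
    unfolding w(2) left_coset_def by (rule image_eqI[of _ _ mp_one]) (simp_all add: mp_subgroupD(2)[OF K_sub])
  ultimately show "C \<in> {C \<in> left_cosets (2 * n). \<exists>x\<in>C. x \<in> hecke_coset \<beta>}"
    using rep_in_hecke_coset[OF \<beta> w(1)] by blast
qed

text \<open>The element picked by \<open>SOME\<close> is immaterial: passing from x to x k
  multiplies the Hecke function and f by the same sign \<open>gen k\<close>. At the representatives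
  themselves the Hecke function is 1, so the sum carries no weights.\<close>

lemma hecke_operator_sum:
  assumes \<beta>: "\<beta> \<in> Zp_units" and f: "\<And>g k. g \<in> Mp \<Longrightarrow> k \<in> K \<Longrightarrow> f (g \<odot> k) = f g * gen k" and g: "g \<in> Mp"
  shows "\<V> \<eta> n \<beta> f g = (\<Sum>w\<in>class_reps (legendre_p \<beta>). f (g \<odot> rep w))"
proof -
  let ?F = "\<lambda>x. if x \<in> hecke_coset \<beta> then gen x else 0"
  note \<beta>Z = Zp_units_in_Zp[OF \<beta>]
  have nz: "?F x \<noteq> 0 \<longleftrightarrow> x \<in> hecke_coset \<beta>" for x
    using gen_K1_values[OF hecke_coset_K1[OF \<beta>Z], of x] by auto
  have "\<V> \<eta> n \<beta> f g = (\<Sum>C\<in>{C \<in> left_cosets (2 * n). \<exists>x\<in>C. x \<in> hecke_coset \<beta>}.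
      let x = (SOME x. x \<in> C) in ?F x * f (g \<odot> x))"
    unfolding \<V>_def hecke_conv_def lower_def[symmetric] hecke_fun_eq[OF \<beta>Z] nz ..
  also have "\<dots> = (\<Sum>w\<in>class_reps (legendre_p \<beta>). let x = (SOME x. x \<in> left_coset (rep w)) in ?F x * f (g \<odot> x))"
  proof -
    have "inj_on (\<lambda>w. left_coset (rep w)) (class_reps (legendre_p \<beta>))"
      by (rule inj_on_subset[OF left_coset_rep_inj]) (auto simp: class_reps_def)
    then show ?thesis unfolding hecke_left_cosets[OF \<beta>] by (simp only: sum.reindex o_def)
  qed
  also have "\<dots> = (\<Sum>w\<in>class_reps (legendre_p \<beta>). f (g \<odot> rep w))"
  proof (rule sum.cong[OF refl])
    fix w assume w: "w \<in> class_reps (legendre_p \<beta>)"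
    define x where "x = (SOME x. x \<in> left_coset (rep w))"
    have "rep w \<odot> mp_one \<in> left_coset (rep w)"
      unfolding left_coset_def by (intro imageI mp_subgroupD(2)[OF K_sub])
    then have "x \<in> left_coset (rep w)" unfolding x_def by (rule someI)
    then obtain k where k: "k \<in> K" "x = rep w \<odot> k" by (auto simp: left_coset_def)
    have "x \<in> hecke_coset \<beta>"
      using hecke_coset_mult[OF \<beta>Z mp_subgroupD(2)[OF K_sub] k(1) rep_Mp(1)] rep_in_hecke_coset[OF \<beta> w] k(2) by simp
    moreover have "gen x = gen k" using gen_mult[OF rep_Mp(2) K_K1[OF k(1)]] k(2) by (simp add: gen_lower)
    moreover have "f (g \<odot> x) = f (g \<odot> rep w) * gen k"
      using f[OF Mp_closed(2)[OF g rep_Mp(1)] k(1)] assoc[OF g rep_Mp(1) Mp_I(2)[OF k(1)]] k(2) by simp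
    ultimately have "?F x * f (g \<odot> x) = f (g \<odot> rep w)"
      using gen_K1_square[OF K_K1[OF k(1)]] by simp
    then show "(let x = (SOME x. x \<in> left_coset (rep w)) in ?F x * f (g \<odot> x)) = f (g \<odot> rep w)"
      unfolding x_def Let_def .
  qed
  finally show ?thesis .
qed

text \<open>The translates have the value f(g) times powers of \<open>theta 1\<close> with exponents
  r w, where r is the residue of d^2 / 2\<kappa>. Only d depends on g, and its square drops out of
  the Legendre symbol of r, so the eigenvalue is the same for all g.\<close>

lemma hecke_operator_cell:
  assumes \<beta>: "\<beta> \<in> Zp_units" and \<kappa>: "\<kappa> \<in> Zp_units" and g: "g \<in> Mp"
  shows "\<V> \<eta> n \<beta> (fc \<kappa>) g =
    (- 1 + of_int (legendre_p \<beta> * (legendre_p (2 :: 'p padic) * legendre_p \<kappa>)) * P.gauss_sum (theta 1)) / 2 * fc \<kappa> g"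
proof -
  obtain d where d: "d \<in> Zp_units" "\<And>t. t \<in> Zp \<Longrightarrow> fc \<kappa> (g \<odot> dlow t) = fc \<kappa> g * theta (d\<^sup>2 * t / (2 * \<kappa>))"
    using f_cell_shift[OF \<kappa> g] by blast
  define q where "q = d\<^sup>2 / (2 * \<kappa>)"
  have k2: "2 * \<kappa> \<in> Zp_units" using two_unit[OF odd] \<kappa> by (rule Zp_units_closed)
  have q: "q \<in> Zp_units" unfolding q_def by (rule Zp_units_closed(5)[OF Zp_units_closed(7)[OF d(1)] k2])
  define r where "r = nat (residue_p q)"
  have r: "\<not> CARD('p) dvd r" unfolding r_def by (rule residue_unit[OF odd \<psi> q])
  have "legendre_p q * legendre_p (2 * \<kappa>) = 1"
  proof -
    have "q * (2 * \<kappa>) = d\<^sup>2" using Zp_units_nonzero[OF k2] by (simp add: q_def)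
    then show ?thesis
      using legendre_p_mult[OF odd Zp_units_in_Zp[OF q] Zp_units_in_Zp[OF k2]] legendre_p_squares(1)[OF odd d(1)] by simp
  qed
  then have "legendre_p q = legendre_p (2 * \<kappa>)" using legendre_p_unit[OF q] legendre_p_unit[OF k2] by auto
  then have Lr: "P.Leg r = legendre_p (2 :: 'p padic) * legendre_p \<kappa>"
    using legendre_p_residue[OF odd \<psi> Zp_units_in_Zp[OF q]] legendre_p_mult[OF odd] two_unit[OF odd] \<kappa>
    by (simp add: r_def Zp_units_in_Zp)
  have t: "fc \<kappa> (g \<odot> rep w) = fc \<kappa> g * theta 1 ^ (r * w)" for w
  proof -
    have "theta (d\<^sup>2 * of_nat w / (2 * \<kappa>)) = theta (of_nat w * q)" by (simp add: q_def mult.commute)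
    also have "\<dots> = theta q ^ w" by (rule theta_nat[OF Zp_units_in_Zp[OF q]])
    also have "theta q = theta 1 ^ r" unfolding r_def by (rule theta_residue[OF Zp_units_in_Zp[OF q]])
    finally show ?thesis using d(2)[OF of_nat_in_Zp] by (simp add: power_mult)
  qed
  have "\<V> \<eta> n \<beta> (fc \<kappa>) g = (\<Sum>w\<in>class_reps (legendre_p \<beta>). fc \<kappa> (g \<odot> rep w))"
    by (rule hecke_operator_sum[OF \<beta> f_cell_right[OF \<kappa>] g])
  also have "\<dots> = fc \<kappa> g * (\<Sum>w\<in>class_reps (legendre_p \<beta>). theta 1 ^ (r * w))"
    unfolding t sum_distrib_left ..
  also have "(\<Sum>w\<in>class_reps (legendre_p \<beta>). theta 1 ^ (r * w)) =
      (- 1 + of_int (legendre_p \<beta> * P.Leg r) * P.gauss_sum (theta 1)) / 2"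
    unfolding class_reps_def using P.sum_over_class[OF theta_root r] legendre_p_unit[OF \<beta>] by simp
  finally show ?thesis unfolding Lr by (simp only: mult.commute)
qed

text \<open>\<mu> and \<psi> are unrelated, but each gives a nontrivial p-th root of unity. By
  counting, the powers of \<open>psi_root\<close> exhaust the p-th roots of unity; so
  \<open>theta 1\<close> is one of them, and the Gauss sums differ by a Legendre symbol.\<close>

lemma gauss_sum_theta: "\<exists>s\<in>{1, -1}. P.gauss_sum (theta 1) = of_int s * sqrt_p_star \<psi>"
proof -
  let ?z = "psi_root \<psi>"
  note z = psi_root_power[OF odd \<psi>] psi_root_ne_1[OF odd \<psi>]
  have "inj_on (\<lambda>j. ?z ^ j) {..<CARD('p)}"
  proof (rule linorder_inj_onI)
    fix i j assume ij: "i < j" "i \<in> {..<CARD('p)}" "j \<in> {..<CARD('p)}"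
    have "\<not> CARD('p) dvd j - i" using ij by (auto dest: dvd_imp_le)
    then have "?z ^ (j - i) \<noteq> 1" by (rule P.root_power_ne_1[OF z])
    moreover have "?z \<noteq> 0" using z(1) P.p_gt_0 by (auto simp: power_0_left)
    ultimately show "?z ^ i \<noteq> ?z ^ j" using ij(1) by (auto simp: power_diff)
  qed auto
  then have "card ((\<lambda>j. ?z ^ j) ` {..<CARD('p)}) = CARD('p)" by (simp add: card_image)
  moreover have "(\<lambda>j. ?z ^ j) ` {..<CARD('p)} \<subseteq> {x. x ^ CARD('p) = 1}"
  proof (rule image_subsetI, rule CollectI)
    fix j
    have "(?z ^ j) ^ CARD('p) = (?z ^ CARD('p)) ^ j" by (simp only: power_mult[symmetric] mult.commute)
    then show "(?z ^ j) ^ CARD('p) = 1" by (simp only: z(1) power_one)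
  qed
  ultimately have "(\<lambda>j. ?z ^ j) ` {..<CARD('p)} = {x. x ^ CARD('p) = 1}"
    using card_roots_unity_eq[of "CARD('p)"] P.p_gt_0 finite_roots_unity[of "CARD('p)", where 'a=complex]
    by (intro card_subset_eq) auto
  then obtain c where c: "theta 1 = ?z ^ c" using theta_root(1) by blast
  have nd: "\<not> CARD('p) dvd c" using theta_root(2) z(1) by (auto simp: c power_mult)
  have "P.gauss_sum (theta 1) = of_int (P.Leg c) * sqrt_p_star \<psi>"
    unfolding c P.gauss_sum_power[OF z(1) nd] sqrt_p_star_gauss[OF odd \<psi>] ..
  moreover have "P.Leg c \<in> {1, -1}" using nd P.Leg_zero_iff[of c] Legendre_values[of "int c" "int CARD('p)"] by auto
  ultimately show ?thesis by blast
qed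

end

theorem corollary4p4:
  fixes \<psi> \<mu> \<eta> :: "'p::prime_card padic \<Rightarrow> complex"
    and lam :: "'p padic"
    and n :: nat
  assumes "odd CARD('p)"
    and "additive_character \<psi>" and "additive_conductor_0 \<psi>"
    and "mult_character \<mu>" and "conductor_exponent \<mu> n" and "n > 1"
    and "(\<forall>u\<in>Zp_units. \<eta> u = 1) \<or> (\<forall>u\<in>Zp_units. \<eta> u = of_int (legendre_p u))"
    and "\<mu> (-1) = \<eta> (-1)"
    and "lam \<in> Zp_units" and "legendre_p lam = -1"
  shows "let f1 = f_cell \<psi> \<mu> \<eta> n 1; flam = f_cell \<psi> \<mu> \<eta> n lam; r = sqrt_p_star \<psi> in
    (\<forall>f\<in>{f1, flam}. f \<in> principal_series_K \<psi> \<mu> \<eta> (2 * n) \<and> (\<exists>g\<in>Mp. f g \<noteq> 0)) \<and>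
    (\<exists>s\<in>{1, -1}. \<forall>g\<in>Mp.
      \<V> \<eta> n 1 f1 g = (-1 + s * r) / 2 * f1 g \<and>
      \<V> \<eta> n lam f1 g = (-1 - s * r) / 2 * f1 g \<and>
      \<V> \<eta> n 1 flam g = (-1 - s * r) / 2 * flam g \<and>
      \<V> \<eta> n lam flam g = (-1 + s * r) / 2 * flam g \<and>
      \<Y> \<eta> n lam f1 g = 0 \<and> \<Y> \<eta> n lam flam g = 0 \<and>
      \<W> \<eta> n lam f1 g = s * r * f1 g \<and>
      \<W> \<eta> n lam flam g = - s * r * flam g)"
proof -
  interpret ramified_data \<psi> \<mu> \<eta> n
    using assms by unfold_locales (auto simp: quadratic_char_def)
  note one = Zp_units_closed(1)[where 'p='p] and lam = assms(9)
  have L1: "legendre_p (1 :: 'p padic) = 1" using legendre_p_squares(1)[OF odd one] by simp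
  obtain s0 where s0: "s0 \<in> {1, -1}" "P.gauss_sum (theta 1) = of_int s0 * sqrt_p_star \<psi>"
    using gauss_sum_theta by blast
  \<comment> \<open>The Legendre symbol of 2 comes from the term t / 2\<kappa>, and
    \<open>s0\<close> from comparing the roots of unity of \<mu> and \<psi>. Neither depends on
    \<beta>, \<kappa> or g.\<close>
  define s :: complex where "s = of_int (legendre_p (2 :: 'p padic) * s0)"
  have s: "s \<in> {1, -1}" using s0(1) legendre_p_unit[OF two_unit[OF odd]] by (auto simp: s_def)
  \<comment> \<open>\<beta> and \<kappa> enter only through the product of their Legendre symbols,
    hence the pattern of the four signs. For fixed \<kappa> the two eigenvalues add up to -1, which
    is why \<open>\<Y>\<close> annihilates both functions.\<close>
  have V: "\<V> \<eta> n \<beta> (fc \<kappa>) g = (- 1 + of_int (legendre_p \<beta> * legendre_p \<kappa>) * (s * sqrt_p_star \<psi>)) / 2 * fc \<kappa> g"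
    if "\<beta> \<in> Zp_units" "\<kappa> \<in> Zp_units" "g \<in> Mp" for \<beta> \<kappa> g
    unfolding hecke_operator_cell[OF that] s0(2) s_def by (simp add: mult_ac)
  have "\<forall>f\<in>{fc 1, fc lam}. f \<in> principal_series_K \<psi> \<mu> \<eta> (2 * n) \<and> (\<exists>g\<in>Mp. f g \<noteq> 0)"
    using f_cell_principal_series[OF one] f_cell_principal_series[OF lam] f_cell_nonzero[OF one] f_cell_nonzero[OF lam]
    by blast
  moreover have "\<forall>g\<in>Mp. \<V> \<eta> n 1 (fc 1) g = (-1 + s * sqrt_p_star \<psi>) / 2 * fc 1 g \<and>
      \<V> \<eta> n lam (fc 1) g = (-1 - s * sqrt_p_star \<psi>) / 2 * fc 1 g \<and>
      \<V> \<eta> n 1 (fc lam) g = (-1 - s * sqrt_p_star \<psi>) / 2 * fc lam g \<and>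
      \<V> \<eta> n lam (fc lam) g = (-1 + s * sqrt_p_star \<psi>) / 2 * fc lam g \<and>
      \<Y> \<eta> n lam (fc 1) g = 0 \<and> \<Y> \<eta> n lam (fc lam) g = 0 \<and>
      \<W> \<eta> n lam (fc 1) g = s * sqrt_p_star \<psi> * fc 1 g \<and>
      \<W> \<eta> n lam (fc lam) g = - s * sqrt_p_star \<psi> * fc lam g"
  proof
    fix g :: "'p mp" assume g: "g \<in> Mp"
    have v: "\<V> \<eta> n 1 (fc 1) g = (-1 + s * sqrt_p_star \<psi>) / 2 * fc 1 g"
      "\<V> \<eta> n lam (fc 1) g = (-1 - s * sqrt_p_star \<psi>) / 2 * fc 1 g"
      "\<V> \<eta> n 1 (fc lam) g = (-1 - s * sqrt_p_star \<psi>) / 2 * fc lam g"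
      "\<V> \<eta> n lam (fc lam) g = (-1 + s * sqrt_p_star \<psi>) / 2 * fc lam g"
      using V[OF one one g] V[OF lam one g] V[OF one lam g] V[OF lam lam g] by (simp_all add: L1 assms(10))
    show "\<V> \<eta> n 1 (fc 1) g = (-1 + s * sqrt_p_star \<psi>) / 2 * fc 1 g \<and>
      \<V> \<eta> n lam (fc 1) g = (-1 - s * sqrt_p_star \<psi>) / 2 * fc 1 g \<and>
      \<V> \<eta> n 1 (fc lam) g = (-1 - s * sqrt_p_star \<psi>) / 2 * fc lam g \<and>
      \<V> \<eta> n lam (fc lam) g = (-1 + s * sqrt_p_star \<psi>) / 2 * fc lam g \<and>
      \<Y> \<eta> n lam (fc 1) g = 0 \<and> \<Y> \<eta> n lam (fc lam) g = 0 \<and>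
      \<W> \<eta> n lam (fc 1) g = s * sqrt_p_star \<psi> * fc 1 g \<and>
      \<W> \<eta> n lam (fc lam) g = - s * sqrt_p_star \<psi> * fc lam g"
      unfolding \<Y>_def \<W>_def v by (simp add: field_simps)
  qed
  ultimately show ?thesis unfolding Let_def using s by blast
qed

end
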